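(* For all integers $n\ge 2$, $L_{\mathrm{cub}}(n)=\ell_{\mathrm{cub}}(n)$, and the asymptotic growth of $L_{\mathrm{cub}}$ is given by $L_{\mathrm{cub}}(n)\sim \frac{28}{41}\,n$ as $n\to\infty$.
   Context: The cubic lattice is the infinite simple graph with vertex set $\mathbb{Z}^3$ in which two points are adjacent iff their Euclidean distance is $1$. A tree-like polycube of size $n$ is a subgraph of the cubic lattice induced by a set of $n$ vertices (cells) which is a tree. A leaf of a tree $T$ is a vertex of degree $1$ in $T$; $n_1(T)$ denotes the number of leaves. For $n\ge2$, $L_{\mathrm{cub}}(n)$ is the maximum of $n_1(T)$ over all tree-like polycubes $T$ of size $n$. Define $$f_{\mathrm{cub}}(n)=\begin{cases}\lfloor (2n+2)/3\rfloor, & 0\le n\le 11,\\ \lfloor (2n+3)/3\rfloor, & 12\le n\le 27,\\ \lfloor (2n+4)/3\rfloor, & 28\le n\le 40,\end{cases}$$ and, for integers $n\ge 2$, $$\ell_{\mathrm{cub}}(n)=\begin{cases} f_{\mathrm{cub}}(n)+1, & n\in\{6,7,13,19,25\},\\ f_{\mathrm{cub}}(n), & 2\le n\le 40,\ n\notin\{6,7,13,19,25\},\\ f_{\mathrm{cub}}(n-41)+28, & 41\le n\le 81,\\ \ell_{\mathrm{cub}}(n-41)+28, & n\ge 82.\end{cases}$$ *)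

theory Defs
  imports
    "HOL-Analysis.Product_Vector"
    "HOL-Library.Landau_Symbols"
    "Graph_Theory.Graph_Theory"
begin

text \<open>
  Undirected graphs are represented, as in \<^theory>\<open>Graph_Theory.Digraph\<close>, by symmetric
  loop-free digraphs: each edge is a pair of opposite arcs, and the degree of a vertex
  is its out-degree.
\<close>

fun to_R3 :: "int \<times> int \<times> int \<Rightarrow> real \<times> real \<times> real"
  where "to_R3 (a, b, c) = (of_int a, of_int b, of_int c)"

text \<open>The library metric on a product of copies of \<^typ>\<open>real\<close> is the Euclidean one:\<close>

lemma dist_to_R3:
  "dist (to_R3 (a, b, c)) (to_R3 (a', b', c')) =
    sqrt (of_int ((a - a')\<^sup>2 + (b - b')\<^sup>2 + (c - c')\<^sup>2))"
  by (simp add: dist_Pair_Pair dist_real_def)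

definition cubic_lattice :: "(int \<times> int \<times> int, (int \<times> int \<times> int) \<times> (int \<times> int \<times> int)) pre_digraph"
  where "cubic_lattice =
    with_proj \<lparr> pverts = UNIV, parcs = {(u, v). dist (to_R3 u) (to_R3 v) = 1} \<rparr>"

text \<open>
  The library's \<^const>\<open>forest\<close> forbids directed cycles, including the closed walk \<open>u, v, u\<close>
  along a pair of opposite arcs. In a symmetric loop-free digraph without parallel arcs,
  the cycles of the underlying undirected graph are the \<open>cycle\<close>s of length at least 3.
\<close>

definition undirected_tree :: "('a, 'b) pre_digraph \<Rightarrow> bool"
  where "undirected_tree G \<longleftrightarrow>
    Digraph_Component.connected G \<and> \<not> (\<exists>p. pre_digraph.cycle G p \<and> 3 \<le> length p)"

definition leaves :: "('a, 'b) pre_digraph \<Rightarrow> 'a set"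
  where "leaves G = {v \<in> verts G. out_degree G v = 1}"

definition num_leaves :: "('a, 'b) pre_digraph \<Rightarrow> nat"
  where "num_leaves G = card (leaves G)"

definition tree_like_polycube ::
  "nat \<Rightarrow> (int \<times> int \<times> int, (int \<times> int \<times> int) \<times> (int \<times> int \<times> int)) pre_digraph \<Rightarrow> bool"
  where "tree_like_polycube n T \<longleftrightarrow>
    (\<exists>S. finite S \<and> card S = n \<and> T = cubic_lattice \<restriction> S) \<and> undirected_tree T"

definition L_cub :: "nat \<Rightarrow> nat"
  where "L_cub n = Max {num_leaves T | T. tree_like_polycube n T}"

text \<open>Only the values of \<open>f_cub\<close> on \<open>{0..40}\<close> are meaningful.\<close>

definition f_cub :: "nat \<Rightarrow> nat"
  where "f_cub n =
    (if n \<le> 11 then (2 * n + 2) div 3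
     else if n \<le> 27 then (2 * n + 3) div 3
     else (2 * n + 4) div 3)"

text \<open>Only the values of \<open>ell_cub\<close> at arguments at least 2 are meaningful.\<close>

fun ell_cub :: "nat \<Rightarrow> nat"
  where "ell_cub n =
    (if n \<in> {6, 7, 13, 19, 25} then f_cub n + 1
     else if n \<le> 40 then f_cub n
     else if n \<le> 81 then f_cub (n - 41) + 28
     else ell_cub (n - 41) + 28)"

declare ell_cub.simps [simp del]

lemma wf_digraph_cubic_lattice: "wf_digraph cubic_lattice"
  by unfold_locales (simp_all add: cubic_lattice_def)

lemma loopfree_cubic_lattice: "loopfree_digraph cubic_lattice"
  by unfold_locales (auto simp: cubic_lattice_def)

lemma nomulti_cubic_lattice: "nomulti_digraph cubic_lattice"
  by unfold_locales (auto simp: cubic_lattice_def arc_to_ends_def)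

lemma symmetric_cubic_lattice: "symmetric cubic_lattice"
  by (auto simp: symmetric_def cubic_lattice_def sym_def dist_commute)

lemma finite_num_leaves: "finite {num_leaves T | T. tree_like_polycube n T}"
proof (rule finite_subset)
  show "{num_leaves T | T. tree_like_polycube n T} \<subseteq> {..n}"
    by (auto simp: tree_like_polycube_def num_leaves_def leaves_def intro!: card_mono)
qed simp

end

theory Submission
  imports Defs
begin

text \<open>
  Call a cell inner if its degree is at least 2. For a tree with \<open>m\<close> inner cells and
  \<open>e = \<Sum> (deg - 4)\<close> over them, counting edges gives \<open>n = 3 * m + e + 2\<close> cells and \<open>n - m\<close> leaves,
  so one has to bound \<open>\<phi> = 13 * e - 2 * m\<close>. Cutting at a cell of degree 2 is additive, and a cell of
  degree 6 has no inner neighbour of degree above 2, so only trees with degrees 1, 3, 4, 5 are left.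
  If such a tree violates the bound and is minimal, then the minimality of the complement forces
  every branch that is not too large to have large \<open>\<phi>\<close>; by induction along the branch this forces
  it to contain one of 38 explicit patterns of cells near its root. The patterns at a centroid are
  incompatible with each other.

  Conversely, a piece of 41 cells with 28 leaves can be appended repeatedly to a tree at a leaf.
\<close>

section \<open>Graphs and branches of trees\<close>

text \<open>The weights come from the extremal piece of 41 cells: it has 13 inner cells and excess
  2, so appending it leaves \<open>\<phi>\<close> unchanged. Equivalently
  \<open>\<phi> = 13 * n - 26 - 41 * m\<close>, and a bound on \<open>\<phi>\<close> independent of
  \<open>n\<close> amounts to the slope 28/41. The exact formula needs more: \<open>\<phi>\<close>
  has the parity of \<open>e\<close>, and the sharp bound is 7 for odd and 10 for even values. It
  fails for chains of one to four cells of degree 6 joined through cells of degree 2, where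
  \<open>e = 2\<close> and \<open>m\<close> is 1, 3, 5, 7, and for a single cell of degree 5: these
  trees have 7, 13, 19, 25 and 6 cells, the exceptions in the formula. The obstacle is that branches
  can be arbitrarily long, so only finite information can be carried along them: some cells near the
  root, an upper bound of \<open>\<phi>\<close> of the right parity and, for some small branches,
  the exact number of inner cells. The patterns are such that this information reproduces itself:
  those carried by the children of a cell collide, or make \<open>\<phi>\<close> too small, or
  contain a pattern for the cell itself.\<close>

locale sym_graph =
  fixes adj :: "'v \<Rightarrow> 'v \<Rightarrow> bool"
  assumes adj_sym: "adj u v \<longleftrightarrow> adj v u"
    and adj_irrefl [simp]: "\<not> adj u u"
begin

definition edges :: "'v set \<Rightarrow> ('v \<times> 'v) set" where
  "edges A = {(u, v). u \<in> A \<and> v \<in> A \<and> adj u v}"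

definition nbrs :: "'v set \<Rightarrow> 'v \<Rightarrow> 'v set" where
  "nbrs S v = {u \<in> S. adj v u}"

definition deg :: "'v set \<Rightarrow> 'v \<Rightarrow> nat" where
  "deg S v = card (nbrs S v)"

text \<open>Acyclicity is stated as a cut condition: distinct neighbours of a cell are disconnected
  once the cell is removed. This is the form in which branches use it;
  \<open>undirected_tree_polycube\<close> relates it to cycles.\<close>

definition tree :: "'v set \<Rightarrow> bool" where
  "tree S \<longleftrightarrow> finite S \<and> S \<noteq> {} \<and> (\<forall>u\<in>S. \<forall>v\<in>S. (u, v) \<in> (edges S)\<^sup>*) \<and>
     (\<forall>r\<in>S. \<forall>c\<in>nbrs S r. \<forall>c'\<in>nbrs S r. c \<noteq> c' \<longrightarrow> (c, c') \<notin> (edges (S - {r}))\<^sup>*)"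

text \<open>The part of the tree beyond the arc from \<open>p\<close> to \<open>r\<close>.\<close>

definition branch :: "'v set \<Rightarrow> 'v \<Rightarrow> 'v \<Rightarrow> 'v set" where
  "branch S p r = {v. (r, v) \<in> (edges (S - {p}))\<^sup>*}"

lemma edges_mono: "A \<subseteq> B \<Longrightarrow> edges A \<subseteq> edges B"
  by (auto simp: edges_def)

lemma edges_sym: "sym (edges A)"
  by (auto simp: edges_def sym_def adj_sym)

lemma edges_rtrancl_sym: "(u, v) \<in> (edges A)\<^sup>* \<Longrightarrow> (v, u) \<in> (edges A)\<^sup>*"
  using sym_rtrancl[OF edges_sym] by (meson symD)

lemma edges_rtrancl_mem: "(u, v) \<in> (edges A)\<^sup>* \<Longrightarrow> u \<in> A \<Longrightarrow> v \<in> A"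
  by (induction rule: rtrancl_induct) (auto simp: edges_def)

lemma finite_nbrs [simp]: "finite S \<Longrightarrow> finite (nbrs S v)"
  by (simp add: nbrs_def)

lemma nbrs_sym: "p \<in> S \<Longrightarrow> r \<in> nbrs S p \<Longrightarrow> p \<in> nbrs S r"
  by (simp add: nbrs_def adj_sym)

text \<open>Cut the walk at its last visit to \<open>r\<close>: what follows never returns
  there.\<close>

lemma rtrancl_first_step:
  assumes "(r, v) \<in> (edges A)\<^sup>*" "v \<noteq> r"
  shows "\<exists>c\<in>nbrs A r. (c, v) \<in> (edges (A - {r}))\<^sup>*"
proof -
  have "v = r \<or> (\<exists>c\<in>nbrs A r. (c, v) \<in> (edges (A - {r}))\<^sup>*)"
    using assms(1)
  proof (induction rule: rtrancl_induct)
    case (step x y)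
    show ?case
    proof (cases "y = r \<or> x = r")
      case True
      with step.hyps(2) show ?thesis by (auto simp: edges_def nbrs_def)
    next
      case False
      then obtain c where c: "c \<in> nbrs A r" "(c, x) \<in> (edges (A - {r}))\<^sup>*"
        using step.IH by auto
      have "(x, y) \<in> edges (A - {r})"
        using False step.hyps(2) by (auto simp: edges_def)
      with c show ?thesis by (meson rtrancl.rtrancl_into_rtrancl)
    qed
  qed simp
  with assms(2) show ?thesis by simp
qed

context
  fixes S :: "'v set"
  assumes tree: "tree S"
begin

lemma tree_finite: "finite S"
  using tree by (simp add: tree_def)

lemma tree_connected: "u \<in> S \<Longrightarrow> v \<in> S \<Longrightarrow> (u, v) \<in> (edges S)\<^sup>*"
  using tree by (simp add: tree_def)

lemma tree_acyclic:
  "r \<in> S \<Longrightarrow> c \<in> nbrs S r \<Longrightarrow> c' \<in> nbrs S r \<Longrightarrow> (c, c') \<in> (edges (S - {r}))\<^sup>* \<Longrightarrow> c = c'"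
  using tree unfolding tree_def by blast

lemma branch_root [simp]: "r \<in> branch S p r"
  by (simp add: branch_def)

lemma branch_subset: "r \<in> nbrs S p \<Longrightarrow> branch S p r \<subseteq> S - {p}"
  using edges_rtrancl_mem[of r _ "S - {p}"]
  by (auto simp: branch_def nbrs_def dest!: edges_rtrancl_mem)

lemma branch_finite: "r \<in> nbrs S p \<Longrightarrow> finite (branch S p r)"
  using branch_subset tree_finite by (meson finite_Diff finite_subset)

lemma branch_step:
  "v \<in> branch S p r \<Longrightarrow> r \<in> nbrs S p \<Longrightarrow> w \<in> S \<Longrightarrow> adj v w \<Longrightarrow> w \<noteq> p \<Longrightarrow> w \<in> branch S p r"
  using branch_subset[of r p] unfolding branch_def
  by (auto simp: edges_def intro: rtrancl.rtrancl_into_rtrancl)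

lemma sibling_branches_disjoint:
  assumes "r \<in> S" "c \<in> nbrs S r" "c' \<in> nbrs S r" "c \<noteq> c'"
  shows "branch S r c \<inter> branch S r c' = {}"
proof (rule ccontr)
  assume "\<not> ?thesis"
  then obtain v where "(c, v) \<in> (edges (S - {r}))\<^sup>*" "(c', v) \<in> (edges (S - {r}))\<^sup>*"
    by (auto simp: branch_def)
  then have "(c, c') \<in> (edges (S - {r}))\<^sup>*"
    using edges_rtrancl_sym rtrancl_trans by meson
  with tree_acyclic assms show False by blast
qed

lemma sibling_branches_not_adj:
  assumes "r \<in> S" "c \<in> nbrs S r" "c' \<in> nbrs S r" "c \<noteq> c'" "v \<in> branch S r c" "w \<in> branch S r c'"
  shows "v \<noteq> w" "\<not> adj v w"
proof -
  show "v \<noteq> w" using sibling_branches_disjoint[OF assms(1-4)] assms(5,6) by auto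
  show "\<not> adj v w"
  proof
    assume "adj v w"
    moreover have "w \<in> S" "w \<noteq> r" using branch_subset[OF assms(3)] assms(6) by auto
    ultimately have "w \<in> branch S r c" using branch_step assms(2,5) by blast
    then show False using sibling_branches_disjoint[OF assms(1-4)] assms(6) by auto
  qed
qed

lemma branch_adj_parent:
  assumes "r \<in> S" "c \<in> nbrs S r" "v \<in> branch S r c" "adj v r"
  shows "v = c"
proof (rule ccontr)
  assume "v \<noteq> c"
  have "v \<in> nbrs S r" using assms branch_subset[OF assms(2)] by (auto simp: nbrs_def adj_sym)
  then show False
    using sibling_branches_disjoint[OF assms(1,2) _ \<open>v \<noteq> c\<close>[symmetric]] assms(3) branch_root[of v r] by auto
qed

lemma branch_decomp:
  assumes "p \<in> S" "r \<in> nbrs S p"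
  shows "branch S p r = insert r (\<Union>c\<in>nbrs S r - {p}. branch S r c)"
proof
  have r: "r \<in> S" "p \<in> nbrs S r" using assms nbrs_sym by (auto simp: nbrs_def)
  show "branch S p r \<subseteq> insert r (\<Union>c\<in>nbrs S r - {p}. branch S r c)"
  proof
    fix v assume v: "v \<in> branch S p r"
    show "v \<in> insert r (\<Union>c\<in>nbrs S r - {p}. branch S r c)"
    proof (cases "v = r")
      case False
      then obtain c where c: "c \<in> nbrs (S - {p}) r" "(c, v) \<in> (edges (S - {p} - {r}))\<^sup>*"
        using rtrancl_first_step[of r v "S - {p}"] v by (auto simp: branch_def)
      then have "(c, v) \<in> (edges (S - {r}))\<^sup>*"
        by (meson Diff_mono Diff_subset edges_mono order_refl rtrancl_mono subsetD)
      with c show ?thesis by (auto simp: branch_def nbrs_def)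
    qed simp
  qed
  have "v \<in> branch S p r" if c: "c \<in> nbrs S r" "c \<noteq> p" and v: "v \<in> branch S r c" for v c
  proof -
    \<comment> \<open>Seen from \<open>r\<close>, the cell \<open>p\<close> is the root of another
      sibling branch, so a walk inside the branch of \<open>c\<close> cannot run through
      \<open>p\<close>.\<close>
    have np: "p \<notin> branch S r c"
      using sibling_branches_disjoint[OF r(1) c(1) r(2) c(2)] branch_root[of p r] by auto
    have "(c, v) \<in> (edges (S - {r}))\<^sup>*" using v by (simp add: branch_def)
    then show ?thesis
    proof (induction rule: rtrancl_induct)
      case base
      show ?case using branch_step[OF branch_root assms(2)] c by (auto simp: nbrs_def)
    next
      case (step x y)
      have "y \<in> branch S r c"
        using step.hyps unfolding branch_def by (auto intro: rtrancl.rtrancl_into_rtrancl)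
      then have "y \<noteq> p" using np by auto
      then show ?case using branch_step[OF step.IH assms(2)] step.hyps by (auto simp: edges_def)
    qed
  qed
  then show "insert r (\<Union>c\<in>nbrs S r - {p}. branch S r c) \<subseteq> branch S p r" by auto
qed

lemma tree_decomp:
  assumes "x \<in> S"
  shows "S = insert x (\<Union>c\<in>nbrs S x. branch S x c)"
proof
  show "S \<subseteq> insert x (\<Union>c\<in>nbrs S x. branch S x c)"
  proof
    fix v assume "v \<in> S"
    then show "v \<in> insert x (\<Union>c\<in>nbrs S x. branch S x c)"
      using rtrancl_first_step[OF tree_connected[OF assms]] by (auto simp: branch_def)
  qed
  show "insert x (\<Union>c\<in>nbrs S x. branch S x c) \<subseteq> S"
    using assms branch_subset by auto
qed

text \<open>Removing an edge splits the tree in two: seen from \<open>r\<close>, one side is the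
  branch towards \<open>p\<close>, the other is \<open>r\<close> with all remaining
  branches.\<close>

lemma branch_compl:
  assumes "p \<in> S" "r \<in> nbrs S p"
  shows "branch S p r \<inter> branch S r p = {}" "branch S p r \<union> branch S r p = S"
proof -
  have r: "r \<in> S" "p \<in> nbrs S r" using assms nbrs_sym by (auto simp: nbrs_def)
  show "branch S p r \<inter> branch S r p = {}"
    using sibling_branches_disjoint[OF r(1) _ r(2)] branch_subset[OF r(2)]
    by (subst branch_decomp[OF assms]) auto
  have "S = insert r (\<Union>c\<in>nbrs S r. branch S r c)" by (rule tree_decomp[OF r(1)])
  also have "nbrs S r = insert p (nbrs S r - {p})" using r by auto
  finally have "S = insert r (\<Union>c\<in>nbrs S r - {p}. branch S r c) \<union> branch S r p" by auto
  then show "branch S p r \<union> branch S r p = S" using branch_decomp[OF assms] by simp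
qed

lemma branch_less:
  assumes "p \<in> S" "r \<in> nbrs S p" "c \<in> nbrs S r - {p}"
  shows "card (branch S r c) < card (branch S p r)"
proof (rule psubset_card_mono)
  show "finite (branch S p r)" using branch_finite assms by blast
  have "r \<notin> branch S r c" using branch_subset[of c r] assms by auto
  then show "branch S r c \<subset> branch S p r" using branch_decomp[OF assms(1,2)] assms(3) by auto
qed

lemma sum_branch:
  assumes "p \<in> S" "r \<in> nbrs S p"
  shows "sum f (branch S p r) = f r + (\<Sum>c\<in>nbrs S r - {p}. sum f (branch S r c))"
proof -
  have r: "r \<in> S" using assms by (auto simp: nbrs_def)
  have "sum f (\<Union>c\<in>nbrs S r - {p}. branch S r c) = (\<Sum>c\<in>nbrs S r - {p}. sum f (branch S r c))"
    using tree_finite branch_finite sibling_branches_disjoint[OF r]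
    by (intro sum.UNION_disjoint) (auto)
  moreover have "r \<notin> (\<Union>c\<in>nbrs S r - {p}. branch S r c)" using branch_subset by auto
  moreover have "finite (\<Union>c\<in>nbrs S r - {p}. branch S r c)" using tree_finite branch_finite by auto
  ultimately show ?thesis using branch_decomp[OF assms] by simp
qed

lemma sum_tree:
  assumes "x \<in> S"
  shows "sum f S = f x + (\<Sum>c\<in>nbrs S x. sum f (branch S x c))"
proof -
  have "sum f (\<Union>c\<in>nbrs S x. branch S x c) = (\<Sum>c\<in>nbrs S x. sum f (branch S x c))"
    using tree_finite branch_finite sibling_branches_disjoint[OF assms]
    by (intro sum.UNION_disjoint) (auto)
  moreover have "x \<notin> (\<Union>c\<in>nbrs S x. branch S x c)" using branch_subset by auto
  moreover have "finite (\<Union>c\<in>nbrs S x. branch S x c)" using tree_finite branch_finite by auto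
  ultimately show ?thesis using arg_cong[OF tree_decomp[OF assms], of "sum f"] by simp
qed

lemma sum_split:
  assumes "p \<in> S" "r \<in> nbrs S p"
  shows "sum f S = sum f (branch S p r) + sum f (branch S r p)"
proof -
  have "finite (branch S p r)" "finite (branch S r p)"
    using branch_finite assms nbrs_sym by auto
  then show ?thesis
    using branch_compl[OF assms] sum.union_disjoint[of "branch S p r" "branch S r p" f] by simp
qed

text \<open>The root contributes \<open>deg - 2\<close>, each of its \<open>deg - 1\<close>
  children's branches contributes -1 by induction.\<close>

lemma handshake_branch:
  assumes "p \<in> S" "r \<in> nbrs S p"
  shows "(\<Sum>v\<in>branch S p r. int (deg S v) - 2) = - 1"
  using assms
proof (induction "card (branch S p r)" arbitrary: p r rule: less_induct)
  case less
  have r: "r \<in> S" "p \<in> nbrs S r" using less.prems nbrs_sym by (auto simp: nbrs_def)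
  have "(\<Sum>c\<in>nbrs S r - {p}. \<Sum>v\<in>branch S r c. int (deg S v) - 2) = (\<Sum>c\<in>nbrs S r - {p}. - 1)"
    using less.hyps branch_less[OF less.prems] r by (intro sum.cong) auto
  also have "\<dots> = - (int (deg S r) - 1)"
    using r tree_finite card_Suc_Diff1[of "nbrs S r" p] by (simp add: deg_def)
  finally show ?case using sum_branch[OF less.prems, of "\<lambda>v. int (deg S v) - 2"] by simp
qed

lemma handshake:
  "(\<Sum>v\<in>S. int (deg S v) - 2) = - 2"
proof -
  obtain x where x: "x \<in> S" using tree by (auto simp: tree_def)
  have "(\<Sum>c\<in>nbrs S x. \<Sum>v\<in>branch S x c. int (deg S v) - 2) = (\<Sum>c\<in>nbrs S x. - 1)"
    using handshake_branch[OF x] by (intro sum.cong) auto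
  then show ?thesis using sum_tree[OF x, of "\<lambda>v. int (deg S v) - 2"] by (simp add: deg_def)
qed

text \<open>The surgery behind the inductions on trees: keeping \<open>r\<close> as a leaf preserves
  the degree of every cell of the other side, hence its excess and its number of inner
  cells.\<close>

lemma prune_tree:
  assumes "p \<in> S" "r \<in> nbrs S p"
  shows "tree (insert r (branch S r p))"
    and "v \<in> branch S r p \<Longrightarrow> nbrs (insert r (branch S r p)) v = nbrs S v"
    and "nbrs (insert r (branch S r p)) r = {p}"
proof -
  let ?T = "insert r (branch S r p)"
  have r: "r \<in> S" "p \<in> nbrs S r" using assms nbrs_sym by (auto simp: nbrs_def)
  have sub: "branch S r p \<subseteq> S - {r}" by (rule branch_subset[OF r(2)])
  show n1: "nbrs ?T v = nbrs S v" if v: "v \<in> branch S r p" for v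
  proof -
    have "w \<in> ?T" if "w \<in> S" "adj v w" for w
      using branch_step[OF v r(2) that] by auto
    then show ?thesis using sub r by (auto simp: nbrs_def)
  qed
  show n2: "nbrs ?T r = {p}"
    using branch_adj_parent[OF r] r branch_root by (auto simp: nbrs_def adj_sym)
  have reach: "(p, v) \<in> (edges ?T)\<^sup>*" if "v \<in> ?T" for v
  proof (cases "v = r")
    case True
    then show ?thesis using r branch_root by (auto simp: edges_def nbrs_def adj_sym)
  next
    case False
    then have "(p, v) \<in> (edges (S - {r}))\<^sup>*" using that by (simp add: branch_def)
    then show ?thesis
    proof (induction rule: rtrancl_induct)
      case (step x y)
      then have "x \<in> branch S r p" "y \<in> branch S r p"
        unfolding branch_def by (auto intro: rtrancl.rtrancl_into_rtrancl)
      then have "(x, y) \<in> edges ?T" using step.hyps by (auto simp: edges_def)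
      with step.IH show ?case by (meson rtrancl.rtrancl_into_rtrancl)
    qed simp
  qed
  have "finite ?T" using branch_finite r by simp
  moreover have "(u, v) \<in> (edges ?T)\<^sup>*" if "u \<in> ?T" "v \<in> ?T" for u v
    using reach that edges_rtrancl_sym rtrancl_trans by meson
  moreover have "c = c'" if "q \<in> ?T" "c \<in> nbrs ?T q" "c' \<in> nbrs ?T q" "(c, c') \<in> (edges (?T - {q}))\<^sup>*" for q c c'
  proof (rule tree_acyclic)
    have TS: "?T \<subseteq> S" using sub r by auto
    show "q \<in> S" using that TS by auto
    show "c \<in> nbrs S q" "c' \<in> nbrs S q" using that TS by (auto simp: nbrs_def)
    show "(c, c') \<in> (edges (S - {q}))\<^sup>*"
      using that(4) TS by (meson Diff_mono edges_mono order_refl rtrancl_mono subsetD)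
  qed
  ultimately show "tree ?T" unfolding tree_def by blast
qed

end

end

section \<open>The cubic lattice\<close>

declare split_paired_All [simp del] split_paired_Ex [simp del]

type_synonym cell = "int \<times> int \<times> int"

fun norm1 :: "cell \<Rightarrow> int" where
  "norm1 (a, b, c) = \<bar>a\<bar> + \<bar>b\<bar> + \<bar>c\<bar>"

definition adj :: "cell \<Rightarrow> cell \<Rightarrow> bool" where
  "adj u v \<longleftrightarrow> norm1 (u - v) = 1"

lemma norm1_uminus [simp]: "norm1 (- u) = norm1 u"
  by (cases u) simp

lemma norm1_zero_iff [simp]: "norm1 u = 0 \<longleftrightarrow> u = 0"
  by (cases u) (auto simp: zero_prod_def)

lemma norm1_diff_commute: "norm1 (u - v) = norm1 (v - u)"
  by (metis minus_diff_eq norm1_uminus)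

interpretation lattice: sym_graph adj
proof
  show "adj u v \<longleftrightarrow> adj v u" for u v
    by (simp add: adj_def norm1_diff_commute)
  show "\<not> adj u u" for u
    by (simp add: adj_def del: split_paired_All) (metis norm1_zero_iff zero_neq_one)
qed

abbreviation nbrs where "nbrs \<equiv> lattice.nbrs"
abbreviation deg where "deg \<equiv> lattice.deg"
abbreviation tree where "tree \<equiv> lattice.tree"
abbreviation branch where "branch \<equiv> lattice.branch"

text \<open>Nested conditionals, because \<open>code_simp\<close> then evaluates only the
  comparisons it needs. Equality is included: cells of separate branches may neither touch nor
  coincide.\<close>

fun near :: "cell \<Rightarrow> cell \<Rightarrow> bool" where
  "near (a, b, c) (a', b', c') =
    (if a = a' then if b = b' then if c = c' then True else if c = c' + 1 then True else c' = c + 1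
                    else if c = c' then if b = b' + 1 then True else b' = b + 1 else False
     else if b = b' then if c = c' then if a = a' + 1 then True else a' = a + 1 else False else False)"

lemma near_iff: "near u v \<longleftrightarrow> u = v \<or> adj u v"
proof -
  obtain a b c a' b' c' where [simp]: "u = (a, b, c)" "v = (a', b', c')"
    by (metis surj_pair)
  show ?thesis by (simp add: adj_def) arith
qed

text \<open>The symmetries of the lattice that fix the third unit vector.\<close>

datatype sym = S0 | S1 | S2 | S3 | S4 | S5 | S6 | S7

fun act :: "sym \<Rightarrow> cell \<Rightarrow> cell" where
    "act S0 (a, b, c) = (a, b, c)"
  | "act S1 (a, b, c) = (- a, b, c)"
  | "act S2 (a, b, c) = (a, - b, c)"
  | "act S3 (a, b, c) = (- a, - b, c)"
  | "act S4 (a, b, c) = (b, a, c)"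
  | "act S5 (a, b, c) = (- b, a, c)"
  | "act S6 (a, b, c) = (b, - a, c)"
  | "act S7 (a, b, c) = (- b, - a, c)"

datatype dir = XP | XN | YP | YN | ZP | ZN

primrec vec :: "dir \<Rightarrow> cell" where
    "vec XP = (1, 0, 0)" | "vec XN = (-1, 0, 0)" | "vec YP = (0, 1, 0)"
  | "vec YN = (0, -1, 0)" | "vec ZP = (0, 0, 1)" | "vec ZN = (0, 0, -1)"

fun turn :: "dir \<Rightarrow> cell \<Rightarrow> cell" where
    "turn XP (a, b, c) = (c, a, b)"
  | "turn XN (a, b, c) = (- c, a, b)"
  | "turn YP (a, b, c) = (a, c, b)"
  | "turn YN (a, b, c) = (a, - c, b)"
  | "turn ZP (a, b, c) = (a, b, c)"
  | "turn ZN (a, b, c) = (a, b, - c)"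

text \<open>Places a pattern as a branch that leaves the origin in direction \<open>d\<close>: the
  pattern's root (0,0,0) goes to \<open>vec d\<close>, its parent (0,0,-1) to the origin.\<close>

fun shift :: "dir \<Rightarrow> cell \<Rightarrow> cell" where
    "shift XP (a, b, c) = (c + 1, a, b)"
  | "shift XN (a, b, c) = (- c - 1, a, b)"
  | "shift YP (a, b, c) = (a, c + 1, b)"
  | "shift YN (a, b, c) = (a, - c - 1, b)"
  | "shift ZP (a, b, c) = (a, b, c + 1)"
  | "shift ZN (a, b, c) = (a, b, - c - 1)"

lemma shift_eq: "shift d u = vec d + turn d u"
  by (cases u; cases d) auto

section \<open>Isometries of the lattice that fix the origin\<close>

text \<open>Translations are kept apart: an embedded cell is always written as
  \<open>x + h c\<close>. Reflections are included.\<close>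

definition isometry :: "(cell \<Rightarrow> cell) \<Rightarrow> bool" where
  "isometry h \<longleftrightarrow> bij h \<and> (\<forall>u v. h (u + v) = h u + h v) \<and> (\<forall>u. norm1 (h u) = norm1 u)"

lemma isometry_add: "isometry h \<Longrightarrow> h (u + v) = h u + h v"
  by (simp add: isometry_def)

lemma isometry_norm1: "isometry h \<Longrightarrow> norm1 (h u) = norm1 u"
  by (simp add: isometry_def)

lemma isometry_zero: "isometry h \<Longrightarrow> h 0 = 0"
  by (metis add_cancel_right_left isometry_add add_0)

lemma isometry_minus: "isometry h \<Longrightarrow> h (- u) = - h u"
  by (metis add.right_inverse add_eq_0_iff isometry_add isometry_zero)

lemma isometry_diff: "isometry h \<Longrightarrow> h (u - v) = h u - h v"
  by (metis (no_types) add_uminus_conv_diff isometry_add isometry_minus)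

lemma isometry_comp: "isometry h \<Longrightarrow> isometry k \<Longrightarrow> isometry (h \<circ> k)"
  by (simp add: isometry_def bij_comp)

lemma isometry_inv:
  assumes "isometry h"
  shows "isometry (inv h)"
proof -
  have b: "bij h" using assms by (simp add: isometry_def)
  have i: "h (inv h u) = u" for u using b by (meson bij_inv_eq_iff)
  have "inv h (u + v) = inv h u + inv h v" for u v
  proof -
    have "h (inv h u + inv h v) = u + v" by (simp only: isometry_add[OF assms] i)
    then show ?thesis using b by (metis bij_inv_eq_iff)
  qed
  moreover have "norm1 (inv h u) = norm1 u" for u
    using isometry_norm1[OF assms, of "inv h u"] i by simp
  ultimately show ?thesis using b bij_imp_bij_inv unfolding isometry_def by blast
qed

lemma isometry_adj: "isometry h \<Longrightarrow> adj (x + h u) (x + h v) \<longleftrightarrow> adj u v"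
  by (metis (no_types, lifting) add_diff_cancel_left adj_def isometry_diff isometry_norm1)

lemma isometry_inj: "isometry h \<Longrightarrow> h u = h v \<longleftrightarrow> u = v"
  by (simp add: isometry_def bij_def inj_eq)

lemma isometry_uminus: "isometry uminus"
  unfolding isometry_def by (auto simp: bij_uminus)

lemma isometry_turn: "isometry (turn d)"
proof -
  have "bij (turn d)"
  proof (rule o_bij)
    let ?g = "case d of XP \<Rightarrow> \<lambda>(a, b, c). (b, c, a) | XN \<Rightarrow> \<lambda>(a, b, c). (b, c, - a) | YP \<Rightarrow> \<lambda>(a, b, c). (a, c, b)
      | YN \<Rightarrow> \<lambda>(a, b, c). (a, c, - b) | ZP \<Rightarrow> id | ZN \<Rightarrow> \<lambda>(a, b, c). (a, b, - c)"
    show "?g \<circ> turn d = id" "turn d \<circ> ?g = id" by (cases d; auto simp: fun_eq_iff)+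
  qed
  moreover have "turn d (u + v) = turn d u + turn d v" "norm1 (turn d u) = norm1 u" for u v
    by (cases u; cases v; cases d; simp)+
  ultimately show ?thesis unfolding isometry_def by blast
qed

lemma isometry_act: "isometry (act g)"
proof -
  have "bij (act g)"
  proof (rule o_bij)
    let ?h = "case g of S5 \<Rightarrow> S6 | S6 \<Rightarrow> S5 | _ \<Rightarrow> g"
    show "act ?h \<circ> act g = id" "act g \<circ> act ?h = id" by (cases g; auto simp: fun_eq_iff)+
  qed
  moreover have "act g (u + v) = act g u + act g v" "norm1 (act g u) = norm1 u" for u v
    by (cases u; cases v; cases g; simp)+
  ultimately show ?thesis unfolding isometry_def by blast
qed

lemma turn_ZP: "turn d (0, 0, 1) = vec d"
  by (cases d) auto

lemma act_Z [simp]: "act g (0, 0, c) = (0, 0, c)"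
  by (cases g) auto

lemma norm1_eq_1_iff: "norm1 u = 1 \<longleftrightarrow> (\<exists>d. u = vec d)"
proof
  obtain a b c where [simp]: "u = (a, b, c)" by (metis surj_pair)
  assume "norm1 u = 1"
  then have "(a = 1 \<or> a = -1) \<and> b = 0 \<and> c = 0 \<or> a = 0 \<and> (b = 1 \<or> b = -1) \<and> c = 0 \<or> a = 0 \<and> b = 0 \<and> (c = 1 \<or> c = -1)"
    by simp arith
  then show "\<exists>d. u = vec d"
    by (auto intro: exI[of _ XP] exI[of _ XN] exI[of _ YP] exI[of _ YN] exI[of _ ZP] exI[of _ ZN])
next
  show "\<exists>d. u = vec d \<Longrightarrow> norm1 u = 1"
    by (elim exE, rename_tac d, case_tac d) auto
qed

lemma isometry_scale:
  assumes "isometry h" "h (a, b, c) = (a', b', c')"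
  shows "h (n * a, n * b, n * c) = (n * a', n * b', n * c')"
proof (induction n rule: int_induct[where k = 0])
  case base
  show ?case using isometry_zero[OF assms(1)] by (simp add: zero_prod_def)
next
  case (step1 i)
  have "((i + 1) * a, (i + 1) * b, (i + 1) * c) = (i * a, i * b, i * c) + (a, b, c)"
    by (simp add: algebra_simps)
  then have "h ((i + 1) * a, (i + 1) * b, (i + 1) * c) = (i * a', i * b', i * c') + (a', b', c')"
    by (simp only: isometry_add[OF assms(1)] step1 assms(2))
  then show ?case by (simp add: algebra_simps)
next
  case (step2 i)
  have "((i - 1) * a, (i - 1) * b, (i - 1) * c) = (i * a, i * b, i * c) - (a, b, c)"
    by (simp add: algebra_simps)
  then have "h ((i - 1) * a, (i - 1) * b, (i - 1) * c) = (i * a', i * b', i * c') - (a', b', c')"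
    by (simp only: isometry_diff[OF assms(1)] step2 assms(2))
  then show ?case by (simp add: algebra_simps)
qed

lemma isometry_fix_Z:
  assumes h: "isometry h" and Z: "h (0, 0, 1) = (0, 0, 1)"
  shows "\<exists>g. h = act g"
proof -
  obtain d e where d: "h (1, 0, 0) = vec d" and e: "h (0, 1, 0) = vec e"
    using norm1_eq_1_iff isometry_norm1[OF h] by (metis (no_types) vec.simps(1,3))
  have eq: "h (a, b, c) = (a * fst (vec d) + b * fst (vec e), a * fst (snd (vec d)) + b * fst (snd (vec e)),
      a * snd (snd (vec d)) + b * snd (snd (vec e)) + c)" for a b c
  proof -
    have "h (a * 1, a * 0, a * 0) = (a * fst (vec d), a * fst (snd (vec d)), a * snd (snd (vec d)))"
      using d by (intro isometry_scale[OF h]) simp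
    moreover have "h (b * 0, b * 1, b * 0) = (b * fst (vec e), b * fst (snd (vec e)), b * snd (snd (vec e)))"
      using e by (intro isometry_scale[OF h]) simp
    moreover have "h (c * 0, c * 0, c * 1) = (c * 0, c * 0, c * 1)"
      using Z by (intro isometry_scale[OF h]) simp
    moreover have "h ((a, 0, 0) + (0, b, 0) + (0, 0, c)) = h (a, 0, 0) + h (0, b, 0) + h (0, 0, c)"
      by (simp only: isometry_add[OF h])
    ultimately show ?thesis by simp
  qed
  \<comment> \<open>These norms forbid that the images of the first two unit vectors are vertical or
    parallel to each other, which leaves the eight cases of \<open>?g\<close>.\<close>
  have n: "norm1 (h (1, 0, 1)) = 2" "norm1 (h (-1, 0, 1)) = 2" "norm1 (h (0, 1, 1)) = 2" "norm1 (h (0, -1, 1)) = 2"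
    "norm1 (h (1, 1, 0)) = 2" "norm1 (h (1, -1, 0)) = 2"
    using isometry_norm1[OF h] by simp_all
  let ?g = "case d of XP \<Rightarrow> (case e of YP \<Rightarrow> S0 | _ \<Rightarrow> S2) | XN \<Rightarrow> (case e of YP \<Rightarrow> S1 | _ \<Rightarrow> S3)
     | YP \<Rightarrow> (case e of XP \<Rightarrow> S4 | _ \<Rightarrow> S5) | _ \<Rightarrow> (case e of XP \<Rightarrow> S6 | _ \<Rightarrow> S7)"
  have "h (a, b, c) = act ?g (a, b, c)" for a b c
    using n eq by (cases d; cases e) simp_all
  then show ?thesis by (intro exI[of _ ?g] ext) (metis surj_pair)
qed

lemma isometry_to_vec:
  assumes h: "isometry h" and Z: "h (0, 0, 1) = vec d"
  shows "\<exists>g. h = turn d \<circ> act g"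
proof -
  have t: "bij (turn d)" using isometry_turn by (simp add: isometry_def)
  have "isometry (inv (turn d) \<circ> h)" by (intro isometry_comp isometry_inv isometry_turn h)
  moreover have "(inv (turn d) \<circ> h) (0, 0, 1) = (0, 0, 1)"
    using t Z turn_ZP by (metis bij_inv_eq_iff comp_apply)
  ultimately obtain g where "inv (turn d) \<circ> h = act g" using isometry_fix_Z by blast
  then have "turn d \<circ> act g = h" using t by (metis (no_types) bij_is_surj comp_assoc fun.map_id surj_iff id_comp)
  then show ?thesis by blast
qed

section \<open>Certified patterns\<close>

datatype pid = P0 | P1 | P2 | P3 | P4 | P5 | P6 | P7 | P8 | P9 | P10 | P11 | P12 | P13 | P14 | P15 | P16 | P17 | P18 | P19 | P20 | P21 | P22 | P23 | P24 | P25 | P26 | P27 | P28 | P29 | P30 | P31 | P32 | P33 | P34 | P35 | P36 | P37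

definition pids :: "pid list" where
  "pids = [P0, P1, P2, P3, P4, P5, P6, P7, P8, P9, P10, P11, P12, P13, P14, P15, P16, P17, P18, P19, P20, P21, P22, P23, P24, P25, P26, P27, P28, P29, P30, P31, P32, P33, P34, P35, P36, P37]"

text \<open>In a \<open>good_branch\<close> this bounds \<open>\<phi>\<close> of the branch from
  above and has the same parity, see \<open>fits\<close>.\<close>

primrec pval :: "pid \<Rightarrow> int" where
    "pval P0 = 7"
  | "pval P1 = 10"
  | "pval P2 = 5"
  | "pval P3 = 5"
  | "pval P4 = 8"
  | "pval P5 = 2"
  | "pval P6 = 1"
  | "pval P7 = 8"
  | "pval P8 = 4"
  | "pval P9 = 3"
  | "pval P10 = 12"
  | "pval P11 = -1"
  | "pval P12 = 3"
  | "pval P13 = -1"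
  | "pval P14 = 12"
  | "pval P15 = 6"
  | "pval P16 = 6"
  | "pval P17 = -1"
  | "pval P18 = 7"
  | "pval P19 = 6"
  | "pval P20 = 4"
  | "pval P21 = 4"
  | "pval P22 = 3"
  | "pval P23 = 2"
  | "pval P24 = 1"
  | "pval P25 = -1"
  | "pval P26 = 12"
  | "pval P27 = 12"
  | "pval P28 = 11"
  | "pval P29 = 11"
  | "pval P30 = 10"
  | "pval P31 = 7"
  | "pval P32 = 5"
  | "pval P33 = 5"
  | "pval P34 = 3"
  | "pval P35 = 2"
  | "pval P36 = 1"
  | "pval P37 = 4"

text \<open>A nonzero tag is the exact number of inner cells of the branch, 0 stands for no
  information. Exact counts make it possible to recognise a total of seven inner cells at the value
  12, which \<open>small\<close> admits.\<close>

primrec ptag :: "pid \<Rightarrow> int" where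
    "ptag P0 = 0"
  | "ptag P1 = 0"
  | "ptag P2 = 0"
  | "ptag P3 = 0"
  | "ptag P4 = 0"
  | "ptag P5 = 0"
  | "ptag P6 = 0"
  | "ptag P7 = 0"
  | "ptag P8 = 0"
  | "ptag P9 = 0"
  | "ptag P10 = 0"
  | "ptag P11 = 0"
  | "ptag P12 = 0"
  | "ptag P13 = 0"
  | "ptag P14 = 0"
  | "ptag P15 = 0"
  | "ptag P16 = 0"
  | "ptag P17 = 0"
  | "ptag P18 = 0"
  | "ptag P19 = 0"
  | "ptag P20 = 0"
  | "ptag P21 = 0"
  | "ptag P22 = 5"
  | "ptag P23 = 0"
  | "ptag P24 = 6"
  | "ptag P25 = 0"
  | "ptag P26 = 0"
  | "ptag P27 = 0"
  | "ptag P28 = 1"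
  | "ptag P29 = 1"
  | "ptag P30 = 0"
  | "ptag P31 = 3"
  | "ptag P32 = 4"
  | "ptag P33 = 0"
  | "ptag P34 = 0"
  | "ptag P35 = 0"
  | "ptag P36 = 6"
  | "ptag P37 = 0"

text \<open>Coordinates are relative to the branch: its root is (0,0,0), the parent is (0,0,-1). The
  branch has to contain the listed cells and may contain others.\<close>

primrec pcells :: "pid \<Rightarrow> cell list" where
    "pcells P0 = [(0,0,0), (-1,-1,-1), (-1,0,0), (1,0,0), (-1,-1,0), (-1,1,0)]"
  | "pcells P1 = [(0,0,0), (-1,-1,-1), (-1,0,0), (1,0,0), (-1,-1,0), (-1,1,0)]"
  | "pcells P2 = [(0,0,0), (-2,0,-2), (-1,0,-2), (-2,0,-1), (-1,0,0), (1,0,0), (-2,0,0), (-1,-1,0), (-1,1,0)]"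
  | "pcells P3 = [(0,0,0), (-1,0,0), (1,0,0), (-2,0,0), (-1,-1,0), (-1,1,0), (1,-1,0), (1,1,0), (2,0,0)]"
  | "pcells P4 = [(0,0,0), (-2,0,-2), (-1,0,-2), (-2,0,-1), (-1,0,0), (1,0,0), (-2,0,0), (-1,-1,0), (-1,1,0)]"
  | "pcells P5 = [(0,0,0), (-1,0,0), (1,0,0), (-1,-1,0), (-1,1,0)]"
  | "pcells P6 = [(0,0,0), (-1,0,0), (1,0,0), (-1,-1,0), (-1,1,0)]"
  | "pcells P7 = [(0,0,0), (-2,0,-2), (-2,0,-1), (2,0,-1), (-2,-1,-1), (-2,1,-1), (2,-1,-1), (2,1,-1), (-1,0,0), (1,0,0), (-2,0,0), (-1,-1,0), (-1,1,0), (1,-1,0), (1,1,0), (2,0,0), (-2,0,1), (2,0,1), (-2,-1,1), (-2,1,1), (2,-1,1), (2,1,1)]"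
  | "pcells P8 = [(0,0,0), (-2,0,-1), (-1,0,0), (1,0,0), (-2,0,0), (-1,-1,0), (-1,1,0), (0,0,1), (0,-1,1), (0,1,1)]"
  | "pcells P9 = [(0,0,0), (-1,0,0), (1,0,0), (-1,-1,0), (-1,1,0), (0,0,1), (0,-1,1), (0,1,1)]"
  | "pcells P10 = [(0,0,0), (-1,0,0), (0,-1,0), (0,1,0), (1,0,0)]"
  | "pcells P11 = [(0,0,0), (-1,0,0), (0,-1,0)]"
  | "pcells P12 = [(0,0,0), (-1,0,0), (1,0,0), (0,0,1), (0,-1,1), (0,1,1), (0,0,2), (-1,0,2), (1,0,2)]"
  | "pcells P13 = [(0,0,0), (-1,0,0), (1,0,0), (-1,-1,0)]"
  | "pcells P14 = [(0,0,0), (1,-1,-1), (-1,0,0), (0,-1,0), (0,1,0), (1,-1,0)]"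
  | "pcells P15 = [(0,0,0), (2,0,-2), (2,0,-1), (2,-1,-1), (2,1,-1), (-1,0,0), (1,0,0), (-2,0,0), (-1,-1,0), (-1,1,0), (1,-1,0), (1,1,0), (2,0,0), (-3,0,0), (-3,-1,0), (-3,1,0), (2,0,1), (2,-1,1), (2,1,1)]"
  | "pcells P16 = [(0,0,0), (-1,-1,-1), (-1,0,0), (1,0,0), (-1,-1,0)]"
  | "pcells P17 = [(0,0,0), (-1,0,0), (1,0,0), (0,0,1), (0,-1,1)]"
  | "pcells P18 = [(0,0,0), (-2,0,-1), (2,0,-1), (-1,0,0), (1,0,0), (-2,0,0), (-1,-1,0), (-1,1,0), (1,-1,0), (1,1,0), (2,0,0), (-3,0,0), (3,0,0), (0,0,1), (0,-1,1), (0,1,1), (-2,0,1), (2,0,1), (0,0,2), (-1,0,2), (1,0,2)]"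
  | "pcells P19 = [(0,0,0), (0,-2,-1), (-1,0,0), (1,0,0), (0,-2,0), (0,2,0), (-1,-2,0), (-1,2,0), (1,-2,0), (1,2,0), (0,0,1), (0,-1,1), (0,1,1), (-1,-1,1), (-1,1,1), (0,-2,1), (0,2,1), (1,-1,1), (1,1,1), (0,-2,2), (0,2,2), (-1,-2,2), (-1,2,2), (1,-2,2), (1,2,2)]"
  | "pcells P20 = [(0,0,0), (-2,0,-1), (2,0,-1), (-1,0,0), (1,0,0), (-2,0,0), (-1,-1,0), (-1,1,0), (1,-1,0), (1,1,0), (2,0,0), (-3,0,0), (3,0,0), (-2,0,1), (2,0,1)]"
  | "pcells P21 = [(0,0,0), (0,2,-1), (-1,0,0), (1,0,0), (0,2,0), (-1,2,0), (1,2,0), (0,0,1), (0,-1,1), (0,1,1), (-1,-1,1), (-1,1,1), (0,-2,1), (0,2,1), (1,-1,1), (1,1,1), (0,-3,1), (-1,-3,1), (1,-3,1), (0,2,2), (-1,2,2), (1,2,2)]"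
  | "pcells P22 = [(0,0,0), (-2,0,-2), (-2,0,-1), (-2,-1,-1), (-2,1,-1), (-1,0,0), (1,0,0), (-2,0,0), (-1,-1,0), (-1,1,0), (-2,0,1), (-2,-1,1), (-2,1,1)]"
  | "pcells P23 = [(0,0,0), (-1,0,0), (1,0,0), (0,-2,0), (0,0,1), (0,-1,1), (0,1,1), (-1,-1,1), (0,-2,1), (1,-1,1), (0,0,2), (-1,0,2), (1,0,2)]"
  | "pcells P24 = [(0,0,0), (0,-2,-1), (-1,0,0), (1,0,0), (0,-2,0), (-1,-2,0), (1,-2,0), (0,0,1), (0,-1,1), (-1,-1,1), (0,-2,1), (1,-1,1), (0,-2,2), (-1,-2,2), (1,-2,2)]"
  | "pcells P25 = [(0,0,0), (-2,0,-1), (-1,0,0), (-2,0,0), (-1,-1,0), (-1,1,0), (0,0,1), (0,-1,1), (0,1,1)]"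
  | "pcells P26 = [(0,0,0), (-1,-1,-1), (-1,1,-1), (1,-1,-1), (1,1,-1), (-1,0,0), (1,0,0), (-1,-1,0), (-1,1,0), (1,-1,0), (1,1,0), (-2,-1,0), (-2,1,0), (-1,-2,0), (-1,2,0), (1,-2,0), (1,2,0), (2,-1,0), (2,1,0), (-1,-1,1), (-1,1,1), (1,-1,1), (1,1,1)]"
  | "pcells P27 = [(0,0,0), (2,0,-1), (-1,0,0), (0,-1,0), (0,1,0), (2,0,0), (2,-1,0), (2,1,0), (0,0,1), (1,0,1), (1,-1,1), (1,1,1), (2,0,1), (0,0,2), (0,-1,2), (0,1,2), (2,0,2), (2,-1,2), (2,1,2)]"
  | "pcells P28 = [(0,0,0), (-1,0,0), (0,-1,0), (0,1,0), (0,0,1)]"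
  | "pcells P29 = [(0,0,0), (-1,0,0), (0,-1,0), (0,1,0), (1,0,0)]"
  | "pcells P30 = [(0,0,0), (-1,0,0), (0,-1,0), (0,1,0), (2,0,0), (0,0,1), (1,0,1), (1,-1,1), (1,1,1), (2,0,1), (0,0,2), (0,-1,2), (0,1,2)]"
  | "pcells P31 = [(0,0,0), (-1,0,0), (1,0,0), (-2,0,0), (-1,-1,0), (-1,1,0), (1,-1,0), (1,1,0), (2,0,0), (-1,0,1), (1,0,1)]"
  | "pcells P32 = [(0,0,0), (-1,0,0), (1,0,0), (0,0,1), (0,-1,1), (0,1,1), (-1,-1,1), (-1,1,1), (0,-2,1), (0,2,1), (1,-1,1), (1,1,1), (0,-1,2), (0,1,2)]"
  | "pcells P33 = [(0,0,0), (-1,0,0), (1,0,0), (0,-2,0), (0,2,0), (0,0,1), (0,-1,1), (0,1,1), (-1,-1,1), (-1,1,1), (0,-2,1), (0,2,1), (1,-1,1), (1,1,1), (0,-3,1), (0,3,1), (0,0,2), (-1,0,2), (1,0,2), (0,-2,2), (0,2,2), (0,0,3), (0,-1,3), (0,1,3)]"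
  | "pcells P34 = [(0,0,0), (-1,0,0), (1,0,0), (0,0,1), (0,-1,1), (0,1,1), (-1,-1,1), (-1,1,1), (0,-2,1), (0,2,1), (1,-1,1), (1,1,1)]"
  | "pcells P35 = [(0,0,0), (-1,0,0), (1,0,0), (0,-2,0), (0,2,0), (0,0,1), (0,-1,1), (0,1,1), (-1,-1,1), (-1,1,1), (0,-2,1), (0,2,1), (1,-1,1), (1,1,1), (0,-3,1), (0,3,1), (0,-2,2), (0,2,2)]"
  | "pcells P36 = [(0,0,0), (-2,0,-2), (-2,0,-1), (-2,-1,-1), (-2,1,-1), (-1,0,0), (-2,0,0), (-1,-1,0), (-1,1,0), (0,0,1), (0,-1,1), (0,1,1), (-2,0,1), (-2,-1,1), (-2,1,1)]"
  | "pcells P37 = [(0,0,0), (-2,0,-2), (-1,0,-2), (-2,0,-1), (-1,0,0), (1,0,0), (-2,0,0), (-1,-1,0), (0,0,1)]"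

text \<open>Enough of the eight symmetries to obtain every image of the cell set, by
  \<open>psyms_complete\<close>.\<close>

primrec psyms :: "pid \<Rightarrow> sym list" where
    "psyms P0 = [S0, S1, S2, S3, S4, S5, S6, S7]"
  | "psyms P1 = [S0, S1, S2, S3, S4, S5, S6, S7]"
  | "psyms P2 = [S0, S1, S4, S6]"
  | "psyms P3 = [S0, S4]"
  | "psyms P4 = [S0, S1, S4, S6]"
  | "psyms P5 = [S0, S1, S4, S6]"
  | "psyms P6 = [S0, S1, S4, S6]"
  | "psyms P7 = [S0, S1, S4, S6]"
  | "psyms P8 = [S0, S1, S4, S6]"
  | "psyms P9 = [S0, S1, S4, S6]"
  | "psyms P10 = [S0]"
  | "psyms P11 = [S0, S1, S2, S3]"
  | "psyms P12 = [S0, S4]"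
  | "psyms P13 = [S0, S1, S2, S3, S4, S5, S6, S7]"
  | "psyms P14 = [S0, S1, S2, S3, S4, S5, S6, S7]"
  | "psyms P15 = [S0, S1, S4, S6]"
  | "psyms P16 = [S0, S1, S2, S3, S4, S5, S6, S7]"
  | "psyms P17 = [S0, S2, S4, S5]"
  | "psyms P18 = [S0, S4]"
  | "psyms P19 = [S0, S2, S4, S5]"
  | "psyms P20 = [S0, S4]"
  | "psyms P21 = [S0, S2, S4, S5]"
  | "psyms P22 = [S0, S1, S4, S6]"
  | "psyms P23 = [S0, S2, S4, S5]"
  | "psyms P24 = [S0, S2, S4, S5]"
  | "psyms P25 = [S0, S1, S4, S6]"
  | "psyms P26 = [S0, S4]"
  | "psyms P27 = [S0, S1, S4, S6]"
  | "psyms P28 = [S0, S1, S4, S6]"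
  | "psyms P29 = [S0]"
  | "psyms P30 = [S0, S1, S4, S6]"
  | "psyms P31 = [S0, S4]"
  | "psyms P32 = [S0, S4]"
  | "psyms P33 = [S0, S4]"
  | "psyms P34 = [S0, S4]"
  | "psyms P35 = [S0, S4]"
  | "psyms P36 = [S0, S1, S4, S6]"
  | "psyms P37 = [S0, S1, S2, S3, S4, S5, S6, S7]"

section \<open>The finite search over placed patterns\<close>

text \<open>With a conditional in place of a disjunction, \<open>code_simp\<close> stops at the
  first witness; likewise for \<open>every\<close>.\<close>

fun any :: "('a \<Rightarrow> bool) \<Rightarrow> 'a list \<Rightarrow> bool" where
  "any P [] = False"
| "any P (x # xs) = (if P x then True else any P xs)"

fun every :: "('a \<Rightarrow> bool) \<Rightarrow> 'a list \<Rightarrow> bool" where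
  "every P [] = True"
| "every P (x # xs) = (if P x then every P xs else False)"

lemma any_iff: "any P xs \<longleftrightarrow> (\<exists>x\<in>set xs. P x)"
  by (induction xs) auto

lemma every_iff: "every P xs \<longleftrightarrow> (\<forall>x\<in>set xs. P x)"
  by (induction xs) auto

definition conflict :: "cell list \<Rightarrow> cell list \<Rightarrow> bool" where
  "conflict A B = any (\<lambda>a. any (near a) B) A"

definition place :: "dir \<Rightarrow> pid \<Rightarrow> sym \<Rightarrow> cell list" where
  "place d p g = map (\<lambda>c. shift d (act g c)) (pcells p)"

datatype choice = Leaf | Pat pid sym

primrec cval :: "choice \<Rightarrow> int" where
  "cval Leaf = 0" | "cval (Pat p g) = pval p"

text \<open>100 marks an unknown count: no tag is negative, so a sum with an unknown summand stays
  at least 100, whereas all exact tags lie below.\<close>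

primrec ctag :: "choice \<Rightarrow> int" where
  "ctag Leaf = 0" | "ctag (Pat p g) = (if ptag p = 0 then 100 else ptag p)"

primrec ccells :: "dir \<Rightarrow> choice \<Rightarrow> cell list" where
  "ccells d Leaf = [vec d]" | "ccells d (Pat p g) = place d p g"

text \<open>What the child in direction \<open>d\<close> may be. Placements that touch a known cell,
  the root of a sibling, or the origin elsewhere than at the child itself are dropped
  beforehand.\<close>

definition cands :: "pid list \<Rightarrow> cell list \<Rightarrow> dir list \<Rightarrow> dir \<Rightarrow> choice list" where
  "cands ps B ds d = (let base = B @ map vec (removeAll d ds); v = vec d in
     Leaf # concat (map (\<lambda>p. map (Pat p) (filter (\<lambda>g. let A = place d p g in
         if conflict A base then False
         else \<not> any (\<lambda>u. if u = v then False else near u (0, 0, 0)) A) (psyms p))) ps))"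

text \<open>Depth-first choice of one candidate per direction: \<open>V\<close> adds up the values,
  \<open>t\<close> the tags, \<open>acc\<close> the occupied cells. A choice is abandoned if the
  maxima \<open>mx\<close> of the remaining directions cannot lift the total to \<open>th\<close> or
  if it touches \<open>acc\<close>; \<open>K\<close> judges the complete choices.\<close>

fun go :: "(int \<Rightarrow> int \<Rightarrow> cell list \<Rightarrow> bool) \<Rightarrow> int \<Rightarrow> int \<Rightarrow> int \<Rightarrow> cell list \<Rightarrow>
    (dir \<times> int \<times> choice list) list \<Rightarrow> bool" where
  "go K th V t acc [] = K V t acc"
| "go K th V t acc ((d, mx, L) # Ls) = (let s = sum_list (map (\<lambda>(_, m, _). m) Ls) + V in
     every (\<lambda>c. if s + cval c < th then True else
       let A = ccells d c in
       if conflict A acc then True else go K th (V + cval c) (t + ctag c) (A @ acc) Ls) L)"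

fun max_val :: "int \<Rightarrow> choice list \<Rightarrow> int" where
  "max_val m [] = m"
| "max_val m (c # cs) = max_val (if m < cval c then cval c else m) cs"

definition prep :: "pid list \<Rightarrow> cell list \<Rightarrow> dir list \<Rightarrow> (dir \<times> int \<times> choice list) list" where
  "prep ps B ds = map (\<lambda>d. let L = cands ps B ds d in (d, max_val 0 L, L)) ds"

text \<open>A pattern with a larger value of the same parity is also acceptable, as it still
  \<open>fits\<close>.\<close>

definition covered :: "int \<Rightarrow> int \<Rightarrow> cell list \<Rightarrow> bool" where
  "covered V t acc = any (\<lambda>p. if pval p < V then False else if odd (pval p - V) then False else
     if (if ptag p = 0 then False else ptag p \<noteq> t) then False else
     any (\<lambda>g. every (\<lambda>c. any ((=) (act g c)) acc) (rev (pcells p))) (psyms p)) pids"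

text \<open>Below 2 for even and -1 for odd \<open>V\<close> the branch fails \<open>thr\<close>, so
  nothing is required of it.\<close>

definition final_branch :: "int \<Rightarrow> int \<Rightarrow> cell list \<Rightarrow> bool" where
  "final_branch V t acc = (if even V then if V < 2 then True else covered V t ((0, 0, 0) # acc)
     else if V < -1 then True else covered V t ((0, 0, 0) # acc))"

text \<open>The root has degree \<open>length ds + 1\<close>, its parent included, and the initial
  value is its own weight. The pruning threshold -1 is the smaller one of \<open>thr\<close>; the
  count starts at 1 for the root.\<close>

definition check_branch :: "dir list \<Rightarrow> bool" where
  "check_branch ds = go final_branch (-1) (13 * (int (length ds) - 3) - 2) 1 []
     (prep pids [(0, 0, -1)] ds)"

text \<open>Here no parent exists and \<open>ds\<close> lists all neighbours. From 9 on, the search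
  may only end with \<open>t = 1\<close>, that is, with leaves all around.\<close>

definition check_top :: "dir list \<Rightarrow> bool" where
  "check_top ds = go (\<lambda>V t acc. t = 1) 9 (13 * (int (length ds) - 4) - 2) 1 []
     (prep (filter (\<lambda>p. 11 \<le> pval p) pids) [] ds)"

text \<open>Two branches at the two ends of one edge. Unless the total is harmless, every placement
  must produce a contact other than the edge itself, which joins (0,0,0) to (0,0,-1).\<close>

definition check_pair :: "pid \<Rightarrow> bool" where
  "check_pair p = every (\<lambda>q. let s = pval p + pval q in
     if s < 9 then True else if s = 10 then True
     else if (if s = 12 then if ptag p = 0 then False else if ptag q = 0 then False else ptag p + ptag q = 7 else False) then True
     else every (\<lambda>g. any (\<lambda>v. any (\<lambda>u. if near u v then if u = (0, 0, 0) then v \<noteq> (0, 0, -1) else True else False) (pcells p)) (place ZN q g)) (psyms q)) pids"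

definition fits :: "int \<Rightarrow> int \<Rightarrow> pid \<Rightarrow> bool" where
  "fits \<phi> \<mu> p \<longleftrightarrow> \<phi> \<le> pval p \<and> even (pval p - \<phi>) \<and> (ptag p = 0 \<or> ptag p = \<mu>)"

text \<open>Follow the choices realised by an actual family of separated regions \<open>A d\<close>:
  none of the pruning tests discards them, so \<open>K\<close> holds for some complete choice
  compatible with the tree.\<close>

lemma go_sound:
  fixes A :: "dir \<Rightarrow> cell set" and f m :: "dir \<Rightarrow> int"
  defines "ok \<equiv> \<lambda>d c. set (ccells d c) \<subseteq> A d \<and> f d \<le> cval c \<and> even (cval c - f d) \<and>
      (ctag c = m d \<or> 100 \<le> ctag c)"
  assumes "go K th V t acc Ls"
    and "\<forall>(d, mx, L)\<in>set Ls. (\<exists>c\<in>set L. ok d c) \<and> (\<forall>c\<in>set L. cval c \<le> mx)"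
    and "distinct (map fst Ls)"
    and "\<forall>d\<in>fst ` set Ls. \<forall>d'\<in>fst ` set Ls. d \<noteq> d' \<longrightarrow> (\<forall>u\<in>A d. \<forall>v\<in>A d'. \<not> near u v)"
    and "\<forall>d\<in>fst ` set Ls. \<forall>u\<in>A d. \<forall>v\<in>set acc. \<not> near u v"
    and "\<phi> \<le> V" "even (V - \<phi>)" "t = \<mu> \<or> 100 \<le> t" "0 \<le> \<mu>" "\<And>d. 0 \<le> m d"
    and "th \<le> \<phi> + (\<Sum>d\<leftarrow>map fst Ls. f d)"
  shows "\<exists>V' t' acc'. K V' t' acc' \<and> \<phi> + (\<Sum>d\<leftarrow>map fst Ls. f d) \<le> V' \<and>
      even (V' - (\<phi> + (\<Sum>d\<leftarrow>map fst Ls. f d))) \<and>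
      (t' = \<mu> + (\<Sum>d\<leftarrow>map fst Ls. m d) \<or> 100 \<le> t') \<and>
      set acc' \<subseteq> set acc \<union> (\<Union>d\<in>fst ` set Ls. A d)"
  using assms(2-12)
proof (induction Ls arbitrary: V t acc \<phi> \<mu>)
  case Nil
  then show ?case by (intro exI[of _ V] exI[of _ t] exI[of _ acc]) auto
next
  case (Cons e Ls)
  obtain d mx L where e: "e = (d, mx, L)" by (metis surj_pair)
  obtain c where c: "c \<in> set L" "ok d c" using Cons.prems(2) e by auto
  have sub: "set (ccells d c) \<subseteq> A d" and fc: "f d \<le> cval c" "even (cval c - f d)"
    and tc: "ctag c = m d \<or> 100 \<le> ctag c"
    using c(2) by (auto simp: ok_def)
  have dn: "d \<notin> fst ` set Ls" using Cons.prems(3) e by simp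
  have sep: "\<not> near u v" if "u \<in> A d" "v \<in> set acc" for u v
    using Cons.prems(5) e that by simp
  have sep2: "\<not> near u v" if "d' \<in> fst ` set Ls" "u \<in> A d'" "v \<in> A d" for d' u v
    using Cons.prems(4) e that dn by fastforce
  have bound: "(\<Sum>d\<leftarrow>map fst Ls. f d) \<le> sum_list (map (\<lambda>(_, m, _). m) Ls)"
  proof -
    have "f d' \<le> mx'" if "(d', mx', L') \<in> set Ls" for d' mx' L'
    proof -
      have "(\<exists>c\<in>set L'. ok d' c) \<and> (\<forall>c\<in>set L'. cval c \<le> mx')" using Cons.prems(2) that by auto
      then show ?thesis unfolding ok_def by force
    qed
    then have "(\<Sum>x\<leftarrow>Ls. f (fst x)) \<le> (\<Sum>x\<leftarrow>Ls. case x of (_, m, _) \<Rightarrow> m)"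
      by (intro sum_list_mono) (auto split: prod.splits)
    then show ?thesis by (simp add: comp_def)
  qed
  have th: "\<not> sum_list (map (\<lambda>(_, m, _). m) Ls) + V + cval c < th"
    using bound Cons.prems(6,11) fc e by simp
  have nc: "\<not> conflict (ccells d c) acc"
    unfolding conflict_def any_iff using sub sep by blast
  have go': "go K th (V + cval c) (t + ctag c) (ccells d c @ acc) Ls"
  proof -
    have "\<forall>c\<in>set L. if sum_list (map (\<lambda>(_, m, _). m) Ls) + V + cval c < th then True else
        if conflict (ccells d c) acc then True
        else go K th (V + cval c) (t + ctag c) (ccells d c @ acc) Ls"
      using Cons.prems(1) unfolding e go.simps Let_def every_iff .
    then show ?thesis using c(1) th nc by simp
  qed
  have t': "t + ctag c = \<mu> + m d \<or> 100 \<le> t + ctag c"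
    using Cons.prems(8,9) Cons.prems(10)[of d] tc by linarith
  have sep': "\<forall>d'\<in>fst ` set Ls. \<forall>u\<in>A d'. \<forall>v\<in>set (ccells d c @ acc). \<not> near u v"
  proof (intro ballI)
    fix d' u v assume d': "d' \<in> fst ` set Ls" "u \<in> A d'" and "v \<in> set (ccells d c @ acc)"
    then consider "v \<in> A d" | "v \<in> set acc" using sub by auto
    then show "\<not> near u v"
    proof cases
      case 2
      then show ?thesis using Cons.prems(5) d' e by auto
    qed (use sep2 d' in blast)
  qed
  have 1: "\<forall>(d, mx, L)\<in>set Ls. (\<exists>c\<in>set L. ok d c) \<and> (\<forall>c\<in>set L. cval c \<le> mx)"
    using Cons.prems(2) by simp
  have 2: "distinct (map fst Ls)" using Cons.prems(3) by simp
  have 3: "\<forall>d\<in>fst ` set Ls. \<forall>d'\<in>fst ` set Ls. d \<noteq> d' \<longrightarrow> (\<forall>u\<in>A d. \<forall>v\<in>A d'. \<not> near u v)"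
    using Cons.prems(4) by simp
  have 4: "even (V + cval c - (\<phi> + f d))" "\<phi> + f d \<le> V + cval c" "0 \<le> \<mu> + m d"
    using Cons.prems(6,7,9) Cons.prems(10)[of d] fc by auto
  have 5: "th \<le> (\<phi> + f d) + (\<Sum>d\<leftarrow>map fst Ls. f d)"
    using Cons.prems(11) e by simp
  obtain V' t' acc' where *: "K V' t' acc'"
      "(\<phi> + f d) + (\<Sum>d\<leftarrow>map fst Ls. f d) \<le> V'"
      "even (V' - ((\<phi> + f d) + (\<Sum>d\<leftarrow>map fst Ls. f d)))"
      "t' = (\<mu> + m d) + (\<Sum>d\<leftarrow>map fst Ls. m d) \<or> 100 \<le> t'"
      "set acc' \<subseteq> set (ccells d c @ acc) \<union> (\<Union>d\<in>fst ` set Ls. A d)"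
    using Cons.IH[OF go' 1 2 3 sep' 4(2) 4(1) t' 4(3) Cons.prems(10) 5] by blast
  show ?case
    using * sub unfolding e
    by (intro exI[of _ V'] exI[of _ t'] exI[of _ acc']) (simp add: add.assoc; blast)
qed

lemma max_val_ge: "m \<le> max_val m L \<and> (\<forall>c\<in>set L. cval c \<le> max_val m L)"
proof (induction L arbitrary: m)
  case (Cons a L)
  have "m \<le> (if m < cval a then cval a else m)" "cval a \<le> (if m < cval a then cval a else m)" by simp_all
  then show ?case using Cons[of "if m < cval a then cval a else m"]
    unfolding max_val.simps list.set by fastforce
qed simp

text \<open>The pattern found in a real branch passes the filter of \<open>cands\<close>, since the
  cells tested there belong to other branches or are the centre.\<close>

lemma prep_sound:
  assumes "distinct ds"
    and sep: "\<forall>d\<in>set ds. \<forall>d'\<in>set ds. d \<noteq> d' \<longrightarrow> (\<forall>u\<in>A d. \<forall>v\<in>A d'. \<not> near u v)"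
    and B: "\<forall>d\<in>set ds. \<forall>u\<in>A d. \<forall>v\<in>set B. \<not> near u v"
    and root: "\<forall>d\<in>set ds. \<forall>u\<in>A d. near u 0 \<longrightarrow> u = vec d"
    and vec: "\<forall>d\<in>set ds. vec d \<in> A d"
    and ex: "\<forall>d\<in>set ds. ok d Leaf \<or> (\<exists>p\<in>set ps. \<exists>g\<in>set (psyms p). ok d (Pat p g))"
    and ok: "\<And>d p g. ok d (Pat p g) \<Longrightarrow> set (place d p g) \<subseteq> A d"
  shows "\<forall>(d, mx, L)\<in>set (prep ps B ds). (\<exists>c\<in>set L. ok d c) \<and> (\<forall>c\<in>set L. cval c \<le> mx)"
    and "map fst (prep ps B ds) = ds"
proof -
  show "map fst (prep ps B ds) = ds"
    by (simp add: prep_def Let_def comp_def)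
  have "\<exists>c\<in>set (cands ps B ds d). ok d c" if d: "d \<in> set ds" for d
  proof (cases "ok d Leaf")
    case True
    then show ?thesis by (auto simp: cands_def Let_def)
  next
    case False
    then obtain p g where pg: "p \<in> set ps" "g \<in> set (psyms p)" "ok d (Pat p g)"
      using ex d by blast
    have sub: "set (place d p g) \<subseteq> A d" using ok pg by blast
    have "\<not> near u v" if u: "u \<in> set (place d p g)" and v: "v \<in> set (B @ map vec (removeAll d ds))" for u v
    proof -
      have "u \<in> A d" using u sub by blast
      consider (base) "v \<in> set B" | (sibling) d' where "d' \<in> set ds" "d' \<noteq> d" "v = vec d'"
        using v by auto
      then show ?thesis
      proof cases
        case base
        show ?thesis by (rule B[rule_format, OF d \<open>u \<in> A d\<close> base])
      next
        case sibling
        then have "v \<in> A d'" using vec by simp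
        then show ?thesis
          using sep[rule_format, OF d sibling(1) sibling(2)[symmetric] \<open>u \<in> A d\<close>] by simp
      qed
    qed
    then have nc: "\<not> conflict (place d p g) (B @ map vec (removeAll d ds))"
      unfolding conflict_def any_iff by blast
    have nr: "\<not> any (\<lambda>u. if u = vec d then False else near u (0, 0, 0)) (place d p g)"
    proof -
      have "near u 0 \<longrightarrow> u = vec d" if "u \<in> set (place d p g)" for u
        using sub root d that by blast
      then show ?thesis unfolding any_iff zero_prod_def by metis
    qed
    define Q where "Q = (\<lambda>p g. if conflict (place d p g) (B @ map vec (removeAll d ds)) then False
        else \<not> any (\<lambda>u. if u = vec d then False else near u (0, 0, 0)) (place d p g))"
    have "g \<in> set (filter (Q p) (psyms p))" using pg(2) nc nr by (simp add: Q_def)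
    then have "Pat p g \<in> set (concat (map (\<lambda>p. map (Pat p) (filter (Q p) (psyms p))) ps))"
      using pg(1) by fastforce
    moreover have "cands ps B ds d = Leaf # concat (map (\<lambda>p. map (Pat p) (filter (Q p) (psyms p))) ps)"
      by (simp only: cands_def Q_def Let_def)
    ultimately have "Pat p g \<in> set (cands ps B ds d)" by simp
    with pg show ?thesis by blast
  qed
  then show "\<forall>(d, mx, L)\<in>set (prep ps B ds). (\<exists>c\<in>set L. ok d c) \<and> (\<forall>c\<in>set L. cval c \<le> mx)"
    by (auto simp: prep_def Let_def max_val_ge[THEN conjunct2, rule_format])
qed

lemma psyms_complete:
  "\<exists>g'\<in>set (psyms P). act g' ` set (pcells P) \<subseteq> act g ` set (pcells P)"
proof (cases "g \<in> set (psyms P)")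
  case False
  have "every (\<lambda>p. every (\<lambda>g. if any ((=) g) (psyms p) then True else
      let B = map (act g) (pcells p) in any (\<lambda>g'. every (\<lambda>c. let u = act g' c in any ((=) u) B)
      (pcells p)) (psyms p)) [S0, S1, S2, S3, S4, S5, S6, S7]) pids"
    by code_simp
  moreover have "P \<in> set pids" by (cases P) (simp_all add: pids_def)
  moreover have "g \<in> set [S0, S1, S2, S3, S4, S5, S6, S7]" by (cases g) simp_all
  ultimately have "if any ((=) g) (psyms P) then True else
      let B = map (act g) (pcells P) in any (\<lambda>g'. every (\<lambda>c. let u = act g' c in any ((=) u) B)
      (pcells P)) (psyms P)"
    unfolding every_iff[of _ pids] every_iff[of _ "[S0, S1, S2, S3, S4, S5, S6, S7]"] by blast
  then have "any (\<lambda>g'. every (\<lambda>c. any ((=) (act g' c)) (map (act g) (pcells P))) (pcells P)) (psyms P)"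
    using False by (simp add: any_iff[of "(=) g"] Let_def)
  then obtain g' where g': "g' \<in> set (psyms P)"
      "\<forall>c\<in>set (pcells P). \<exists>b\<in>act g ` set (pcells P). act g' c = b"
    unfolding any_iff every_iff set_map by blast
  have "act g' ` set (pcells P) \<subseteq> act g ` set (pcells P)"
    using g'(2) by (intro image_subsetI) metis
  then show ?thesis using g'(1) by blast
qed blast

text \<open>Representatives, under the eight symmetries, of the sets of two, three or four
  directions other than \<open>ZN\<close>: the possible children of a root of degree 3, 4 or
  5.\<close>

definition classes :: "dir list list" where
  "classes = [[ZP, XP], [XP, XN], [XP, YP], [ZP, XP, XN], [ZP, XP, YP], [XP, XN, YP],
    [XP, XN, YP, YN], [ZP, XP, XN, YP]]"

lemma classes_complete:
  assumes "l \<in> set (subseqs [ZP, XP, XN, YP, YN])" "length l \<in> {2, 3, 4}"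
  shows "\<exists>g. filter (\<lambda>d. act g (vec d) \<in> vec ` set l) [ZP, XP, XN, YP, YN] \<in> set classes"
\<comment> \<open>The filter lists the preimage of \<open>l\<close> under \<open>g\<close> in a
  fixed order of directions, so that it can be compared with the lists in \<open>classes\<close>
  literally.\<close>
proof -
  have "every (\<lambda>l. if any ((=) (length l)) [2, 3, 4] then
      any (\<lambda>g. any ((=) (filter (\<lambda>d. any ((=) (act g (vec d))) (map vec l)) [ZP, XP, XN, YP, YN])) classes)
        [S0, S1, S2, S3, S4, S5, S6, S7] else True) (subseqs [ZP, XP, XN, YP, YN])"
    by code_simp
  from this[unfolded every_iff, rule_format, OF assms(1)]
  have "if any ((=) (length l)) [2, 3, 4] then
      any (\<lambda>g. any ((=) (filter (\<lambda>d. any ((=) (act g (vec d))) (map vec l)) [ZP, XP, XN, YP, YN])) classes)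
        [S0, S1, S2, S3, S4, S5, S6, S7] else True" .
  moreover have "any ((=) (length l)) [2, 3, 4]" using assms(2) by auto
  ultimately have "any (\<lambda>g. any ((=) (filter (\<lambda>d. any ((=) (act g (vec d))) (map vec l)) [ZP, XP, XN, YP, YN])) classes)
      [S0, S1, S2, S3, S4, S5, S6, S7]" by (simp only: if_True)
  then obtain g where "any ((=) (filter (\<lambda>d. any ((=) (act g (vec d))) (map vec l)) [ZP, XP, XN, YP, YN])) classes"
    unfolding any_iff[of _ "[S0, S1, S2, S3, S4, S5, S6, S7]"] by blast
  moreover have "(\<lambda>d. any ((=) (act g (vec d))) (map vec l)) = (\<lambda>d. act g (vec d) \<in> vec ` set l)"
    by (auto simp: any_iff fun_eq_iff)
  ultimately have "any ((=) (filter (\<lambda>d. act g (vec d) \<in> vec ` set l) [ZP, XP, XN, YP, YN])) classes"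
    by (simp only:)
  then show ?thesis unfolding any_iff by blast
qed

section \<open>Patterns in branches\<close>

text \<open>The contribution of one cell to \<open>13 * e - 2 * m\<close>; \<open>one\<close> is its
  contribution to \<open>m\<close>.\<close>

definition wt :: "cell set \<Rightarrow> cell \<Rightarrow> int" where
  "wt S v = (if 2 \<le> deg S v then 13 * (int (deg S v) - 4) - 2 else 0)"

definition one :: "cell set \<Rightarrow> cell \<Rightarrow> int" where
  "one S v = (if 2 \<le> deg S v then 1 else 0)"

definition contains :: "cell set \<Rightarrow> cell \<Rightarrow> cell \<Rightarrow> pid \<Rightarrow> bool" where
  "contains S p r P \<longleftrightarrow> (\<exists>h. isometry h \<and> h (0, 0, -1) = p - r \<and> (\<forall>c\<in>set (pcells P). r + h c \<in> branch S p r))"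

definition good_branch :: "cell set \<Rightarrow> cell \<Rightarrow> cell \<Rightarrow> pid \<Rightarrow> bool" where
  "good_branch S p r P \<longleftrightarrow> fits (sum (wt S) (branch S p r)) (sum (one S) (branch S p r)) P \<and> contains S p r P"

lemma vec_inj [simp]: "vec d = vec d' \<longleftrightarrow> d = d'"
  by (cases d; cases d') auto

lemma ptag_bounds: "0 \<le> ptag P" "ptag P < 100"
  by (cases P; simp)+

lemma pids_complete: "P \<in> set pids"
  by (cases P) (simp_all add: pids_def)

section \<open>Branches in coordinates centred at a cell\<close>

context
  fixes S x \<psi> A
  assumes S: "tree S" and x: "x \<in> S" and \<psi>: "isometry \<psi>"
  defines "A \<equiv> \<lambda>d. {q. x + \<psi> q \<in> branch S x (x + \<psi> (vec d))}"
begin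

lemma child_nbr: "x + \<psi> (vec d) \<in> S \<Longrightarrow> x + \<psi> (vec d) \<in> nbrs S x"
proof -
  have "norm1 (vec d) = 1" using norm1_eq_1_iff by blast
  then have "norm1 (\<psi> (vec d)) = 1" by (simp add: isometry_norm1[OF \<psi>])
  then show "x + \<psi> (vec d) \<in> S \<Longrightarrow> x + \<psi> (vec d) \<in> nbrs S x"
    by (simp add: lattice.nbrs_def adj_def)
qed

lemma child_exists: "y \<in> nbrs S x \<Longrightarrow> \<exists>d. y = x + \<psi> (vec d)"
proof -
  assume y: "y \<in> nbrs S x"
  have b: "bij \<psi>" using \<psi> by (simp add: isometry_def)
  have "norm1 (y - x) = 1" using y by (simp add: lattice.nbrs_def adj_def norm1_diff_commute)
  then have "norm1 (inv \<psi> (y - x)) = 1" using isometry_norm1[OF isometry_inv[OF \<psi>]] by simp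
  then obtain d where "inv \<psi> (y - x) = vec d" using norm1_eq_1_iff by blast
  then have "y - x = \<psi> (vec d)" using b by (metis bij_inv_eq_iff)
  then show ?thesis by (metis add.commute diff_add_cancel)
qed

lemma nbrs_eq: "nbrs S x = (\<lambda>d. x + \<psi> (vec d)) ` {d. x + \<psi> (vec d) \<in> S}"
proof (intro equalityI subsetI)
  fix y assume y: "y \<in> nbrs S x"
  then obtain d where "y = x + \<psi> (vec d)" using child_exists by blast
  then show "y \<in> (\<lambda>d. x + \<psi> (vec d)) ` {d. x + \<psi> (vec d) \<in> S}"
    using y by (auto simp: lattice.nbrs_def)
next
  fix y assume "y \<in> (\<lambda>d. x + \<psi> (vec d)) ` {d. x + \<psi> (vec d) \<in> S}"
  then show "y \<in> nbrs S x" using child_nbr by blast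
qed

lemma child_inj: "inj_on (\<lambda>d. x + \<psi> (vec d)) D"
  by (auto simp: inj_on_def isometry_inj[OF \<psi>])

lemma region_vec: "vec d \<in> A d"
  by (simp add: A_def lattice.branch_root[OF S])

lemma region_sep:
  assumes "x + \<psi> (vec d) \<in> S" "x + \<psi> (vec d') \<in> S" "d \<noteq> d'" "u \<in> A d" "v \<in> A d'"
  shows "\<not> near u v"
proof -
  have ne: "x + \<psi> (vec d) \<noteq> x + \<psi> (vec d')" using assms(3) isometry_inj[OF \<psi>] by simp
  have *: "x + \<psi> u \<in> branch S x (x + \<psi> (vec d))" "x + \<psi> v \<in> branch S x (x + \<psi> (vec d'))"
    using assms(4,5) by (simp_all add: A_def)
  show ?thesis
    using lattice.sibling_branches_not_adj[OF S x child_nbr[OF assms(1)] child_nbr[OF assms(2)] ne *]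
    by (auto simp: near_iff isometry_adj[OF \<psi>])
qed

lemma region_root:
  assumes "x + \<psi> (vec d) \<in> S" "u \<in> A d" "near u 0"
  shows "u = vec d"
proof -
  have n: "x + \<psi> (vec d) \<in> nbrs S x" by (rule child_nbr[OF assms(1)])
  have u: "x + \<psi> u \<in> branch S x (x + \<psi> (vec d))" using assms(2) by (simp add: A_def)
  have z: "x + \<psi> 0 = x" by (simp add: isometry_zero[OF \<psi>])
  have "u \<noteq> 0" using u lattice.branch_subset[OF S n] z by auto
  then have "adj u 0" using assms(3) near_iff by blast
  then have "adj (x + \<psi> u) x" using isometry_adj[OF \<psi>, of x u 0] z by simp
  then have "x + \<psi> u = x + \<psi> (vec d)" using lattice.branch_adj_parent[OF S x n u] by blast
  then show ?thesis using isometry_inj[OF \<psi>] by simp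
qed

text \<open>The embedding of the pattern, read in the frame \<open>\<psi>\<close>, sends (0,0,1) to
  \<open>vec d\<close> and is therefore \<open>turn d\<close> after one of the eight symmetries;
  \<open>psyms_complete\<close> replaces that symmetry by a listed one.\<close>

lemma region_pattern:
  assumes "x + \<psi> (vec d) \<in> S" "contains S x (x + \<psi> (vec d)) P"
  shows "\<exists>g\<in>set (psyms P). set (place d P g) \<subseteq> A d"
proof -
  let ?y = "x + \<psi> (vec d)"
  obtain h where h: "isometry h" "h (0, 0, -1) = x - ?y" "\<forall>c\<in>set (pcells P). ?y + h c \<in> branch S x ?y"
    using assms(2) by (auto simp: contains_def)
  have b: "bij \<psi>" using \<psi> by (simp add: isometry_def)
  have "h (- (0, 0, -1)) = - (x - ?y)"
    by (simp only: isometry_minus[OF h(1)] h(2))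
  then have "h (0, 0, 1) = \<psi> (vec d)" by simp
  then have "(inv \<psi> \<circ> h) (0, 0, 1) = vec d" using b by (simp add: bij_is_inj)
  then obtain g where g: "inv \<psi> \<circ> h = turn d \<circ> act g"
    using isometry_to_vec isometry_comp isometry_inv \<psi> h(1) by blast
  have hc: "h c = \<psi> (turn d (act g c))" for c
  proof -
    have "turn d (act g c) = inv \<psi> (h c)" using fun_cong[OF g, of c] by simp
    then show ?thesis using bij_inv_eq_iff[OF b] by simp
  qed
  have *: "shift d (act g c) \<in> A d" if "c \<in> set (pcells P)" for c
    using h(3) that hc by (simp add: A_def shift_eq isometry_add[OF \<psi>] add.assoc)
  obtain g' where g': "g' \<in> set (psyms P)" "act g' ` set (pcells P) \<subseteq> act g ` set (pcells P)"
    using psyms_complete by blast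
  have "set (place d P g') \<subseteq> A d"
  proof
    fix u assume "u \<in> set (place d P g')"
    then obtain c' where c': "c' \<in> set (pcells P)" "u = shift d (act g' c')"
      unfolding place_def by auto
    then have "act g' c' \<in> act g ` set (pcells P)" using g'(2) by blast
    then obtain c where "c \<in> set (pcells P)" "act g' c' = act g c" by blast
    then show "u \<in> A d" using * c'(2) by simp
  qed
  then show ?thesis using g'(1) by blast
qed

lemma region_choice:
  assumes "x + \<psi> (vec d) \<in> S" "deg S (x + \<psi> (vec d)) = 1 \<or> (\<exists>P\<in>ps. good_branch S x (x + \<psi> (vec d)) P)"
  defines "f \<equiv> sum (wt S) (branch S x (x + \<psi> (vec d)))" and "m \<equiv> sum (one S) (branch S x (x + \<psi> (vec d)))"
  defines "ok \<equiv> \<lambda>c. set (ccells d c) \<subseteq> A d \<and> f \<le> cval c \<and> even (cval c - f) \<and> (ctag c = m \<or> 100 \<le> ctag c)"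
  shows "ok Leaf \<or> (\<exists>P\<in>ps. \<exists>g\<in>set (psyms P). ok (Pat P g))"
  using assms(2)
proof
  let ?y = "x + \<psi> (vec d)"
  assume deg: "deg S ?y = 1"
  have n: "?y \<in> nbrs S x" by (rule child_nbr[OF assms(1)])
  have "nbrs S ?y = {x}"
    using deg lattice.nbrs_sym[OF x n] by (auto simp: lattice.deg_def card_1_singleton_iff)
  then have "branch S x ?y = {?y}" using lattice.branch_decomp[OF S x n] by simp
  then have "f = 0" "m = 0" using deg by (simp_all add: f_def m_def wt_def one_def)
  then have "ok Leaf" unfolding ok_def using region_vec by simp
  then show ?thesis ..
next
  assume "\<exists>P\<in>ps. good_branch S x (x + \<psi> (vec d)) P"
  then obtain P where P: "P \<in> ps" and gb: "good_branch S x (x + \<psi> (vec d)) P" by blast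
  have fit: "fits f m P" and con: "contains S x (x + \<psi> (vec d)) P"
    using gb unfolding good_branch_def f_def m_def by blast+
  obtain g where g: "g \<in> set (psyms P)" "set (place d P g) \<subseteq> A d"
    using region_pattern[OF assms(1) con] by blast
  have "ok (Pat P g)"
    unfolding ok_def ccells.simps cval.simps ctag.simps
    using g(2) fit[unfolded fits_def] by presburger
  then show ?thesis using P g(1) by blast
qed

end


lemma filter_in_subseqs: "filter P xs \<in> set (subseqs xs)"
  by (induction xs) (auto simp: Let_def)

lemma isometry_to_dir: "\<exists>h. isometry h \<and> h (0, 0, -1) = vec d"
proof -
  have "isometry (uminus \<circ> turn d)" by (intro isometry_comp isometry_uminus isometry_turn)
  moreover have "turn d (- (0, 0, 1)) = - vec d"
    by (simp only: isometry_minus[OF isometry_turn] turn_ZP)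
  ultimately show ?thesis by (intro exI[of _ "uminus \<circ> turn d"]) simp
qed

text \<open>The frame can still be turned or reflected about the axis through the parent; this
  freedom brings the child directions into one of the \<open>classes\<close>.\<close>

lemma normal_position:
  assumes S: "tree S" and r: "r \<in> S" "p \<in> nbrs S r" and deg: "deg S r \<in> {3, 4, 5}"
  shows "\<exists>\<psi> ds. isometry \<psi> \<and> \<psi> (0, 0, -1) = p - r \<and> ds \<in> set classes \<and>
    set ds = {d. d \<noteq> ZN \<and> r + \<psi> (vec d) \<in> S}"
proof -
  have "norm1 (p - r) = 1" using r(2) by (simp add: lattice.nbrs_def adj_def norm1_diff_commute)
  then obtain h where h: "isometry h" "h (0, 0, -1) = p - r"
    using norm1_eq_1_iff isometry_to_dir by metis
  define l where "l = filter (\<lambda>d. r + h (vec d) \<in> S) [ZP, XP, XN, YP, YN]"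
  have p: "r + h (vec ZN) \<in> S" using h(2) r(2) by (simp add: lattice.nbrs_def)
  have setl: "set l = {d. d \<noteq> ZN \<and> r + h (vec d) \<in> S}"
  proof -
    have "d \<in> set [ZP, XP, XN, YP, YN] \<longleftrightarrow> d \<noteq> ZN" for d by (cases d) auto
    then show ?thesis unfolding l_def set_filter by blast
  qed
  have "nbrs S r = (\<lambda>d. r + h (vec d)) ` {d. r + h (vec d) \<in> S}"
    by (rule nbrs_eq[OF S r(1) h(1)])
  also have "{d. r + h (vec d) \<in> S} = insert ZN (set l)" using p unfolding setl by blast
  finally have nb: "nbrs S r = (\<lambda>d. r + h (vec d)) ` insert ZN (set l)" .
  have "deg S r = card (insert ZN (set l))"
    unfolding lattice.deg_def nb by (rule card_image[OF child_inj[OF S r(1) h(1)]])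
  also have "\<dots> = Suc (card (set l))"
  proof -
    have "ZN \<notin> set l" unfolding setl by blast
    then show ?thesis by simp
  qed
  also have "card (set l) = length l" by (rule distinct_card) (simp add: l_def)
  finally have "length l \<in> {2, 3, 4}" using deg by auto
  moreover have "l \<in> set (subseqs [ZP, XP, XN, YP, YN])" unfolding l_def by (rule filter_in_subseqs)
  ultimately obtain g where g: "filter (\<lambda>d. act g (vec d) \<in> vec ` set l) [ZP, XP, XN, YP, YN] \<in> set classes"
    using classes_complete by blast
  let ?ds = "filter (\<lambda>d. act g (vec d) \<in> vec ` set l) [ZP, XP, XN, YP, YN]"
  have ds: "set ?ds = {d. d \<noteq> ZN \<and> r + (h \<circ> act g) (vec d) \<in> S}"
  proof -
    have "act g (vec d) \<in> vec ` set l \<longleftrightarrow> r + h (act g (vec d)) \<in> S" if "d \<noteq> ZN" for d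
    proof -
      have "norm1 (act g (vec d)) = 1"
        using isometry_norm1[OF isometry_act] norm1_eq_1_iff by simp
      then obtain e where e: "act g (vec d) = vec e" using norm1_eq_1_iff by blast
      have "act g (vec ZN) = vec ZN" by simp
      have "e \<noteq> ZN"
      proof
        assume "e = ZN"
        then have "act g (vec d) = act g (vec ZN)" using e \<open>act g (vec ZN) = vec ZN\<close> by metis
        then show False using that by (simp only: isometry_inj[OF isometry_act] vec_inj)
      qed
      then show ?thesis unfolding e setl by (simp add: image_iff)
    qed
    moreover have "d \<in> set [ZP, XP, XN, YP, YN] \<longleftrightarrow> d \<noteq> ZN" for d by (cases d) auto
    ultimately show ?thesis unfolding set_filter comp_apply by blast
  qed
  have "isometry (h \<circ> act g)" by (intro isometry_comp h(1) isometry_act)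
  moreover have "(h \<circ> act g) (0, 0, -1) = p - r" using h(2) by simp
  ultimately show ?thesis
    by (intro exI[of _ "h \<circ> act g"] exI[of _ ?ds] conjI g ds)
qed

lemma classes_distinct: "ds \<in> set classes \<Longrightarrow> distinct ds \<and> ZN \<notin> set ds"
  by (auto simp: classes_def)

text \<open>The link from a successful search to a real cell. \<open>B\<close> holds the parent in
  \<open>branch_step\<close> and is empty in \<open>top_bound\<close>.\<close>

lemma go_children:
  fixes S x \<psi>
  defines "f \<equiv> \<lambda>d. sum (wt S) (branch S x (x + \<psi> (vec d)))"
    and "m \<equiv> \<lambda>d. sum (one S) (branch S x (x + \<psi> (vec d)))"
  assumes S: "tree S" and x: "x \<in> S" and \<psi>: "isometry \<psi>" and dist: "distinct ds"
    and inS: "\<And>d. d \<in> set ds \<Longrightarrow> x + \<psi> (vec d) \<in> S"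
    and B: "\<And>v. v \<in> set B \<Longrightarrow> \<exists>e. v = vec e \<and> e \<notin> set ds \<and> x + \<psi> (vec e) \<in> S"
    and children: "\<And>d. d \<in> set ds \<Longrightarrow> deg S (x + \<psi> (vec d)) = 1 \<or> (\<exists>P\<in>set ps. good_branch S x (x + \<psi> (vec d)) P)"
    and go: "go K th V 1 [] (prep ps B ds)" and th: "th \<le> V + (\<Sum>d\<leftarrow>ds. f d)"
  shows "\<exists>V' t' acc'. K V' t' acc' \<and> V + (\<Sum>d\<leftarrow>ds. f d) \<le> V' \<and> even (V' - (V + (\<Sum>d\<leftarrow>ds. f d))) \<and>
    (t' = 1 + (\<Sum>d\<leftarrow>ds. m d) \<or> 100 \<le> t') \<and>
    (\<forall>q\<in>set acc'. \<exists>d\<in>set ds. x + \<psi> q \<in> branch S x (x + \<psi> (vec d)))"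
proof -
  define A where "A = (\<lambda>d. {q. x + \<psi> q \<in> branch S x (x + \<psi> (vec d))})"
  define ok where "ok = (\<lambda>d c. set (ccells d c) \<subseteq> A d \<and> f d \<le> cval c \<and> even (cval c - f d) \<and>
      (ctag c = m d \<or> 100 \<le> ctag c))"
  have m0: "0 \<le> m d" for d unfolding m_def by (intro sum_nonneg) (simp add: one_def)
  have ex: "\<forall>d\<in>set ds. ok d Leaf \<or> (\<exists>P\<in>set ps. \<exists>g\<in>set (psyms P). ok d (Pat P g))"
  proof
    fix d assume d: "d \<in> set ds"
    from region_choice[OF S x \<psi> inS[OF d] children[OF d]]
    show "ok d Leaf \<or> (\<exists>P\<in>set ps. \<exists>g\<in>set (psyms P). ok d (Pat P g))"
      unfolding ok_def f_def m_def A_def .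
  qed
  have sep: "\<forall>d\<in>set ds. \<forall>d'\<in>set ds. d \<noteq> d' \<longrightarrow> (\<forall>u\<in>A d. \<forall>v\<in>A d'. \<not> near u v)"
    unfolding A_def using region_sep[OF S x \<psi> inS inS] by blast
  have sepB: "\<forall>d\<in>set ds. \<forall>u\<in>A d. \<forall>v\<in>set B. \<not> near u v"
  proof (intro ballI)
    fix d u v assume d: "d \<in> set ds" "u \<in> A d" and "v \<in> set B"
    then obtain e where e: "v = vec e" "e \<notin> set ds" "x + \<psi> (vec e) \<in> S" using B by blast
    have "vec e \<in> {q. x + \<psi> q \<in> branch S x (x + \<psi> (vec e))}" by (rule region_vec[OF S x \<psi>])
    moreover have "d \<noteq> e" using d e by blast
    ultimately show "\<not> near u v"
      using region_sep[OF S x \<psi> inS[OF d(1)] e(3), of u v] d(2) unfolding A_def e(1) by blast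
  qed
  have root: "\<forall>d\<in>set ds. \<forall>u\<in>A d. near u 0 \<longrightarrow> u = vec d"
    unfolding A_def using region_root[OF S x \<psi> inS] by blast
  have vecA: "\<forall>d\<in>set ds. vec d \<in> A d"
    unfolding A_def using region_vec[OF S x \<psi>] by blast
  have okP: "set (place d P g) \<subseteq> A d" if "ok d (Pat P g)" for d P g
    using that unfolding ok_def by simp
  note prep = prep_sound[OF dist sep sepB root vecA ex okP]
  have pf: "map fst (prep ps B ds) = ds"
    by (simp add: prep_def Let_def comp_def)
  have fst_set: "fst ` set (prep ps B ds) = set ds"
    using pf by (metis list.set_map)
  have th': "th \<le> V + (\<Sum>d\<leftarrow>map fst (prep ps B ds). f d)"
    unfolding pf by (rule th)
  from go_sound[where A = A and f = f and m = m and \<phi> = V and \<mu> = 1, OF go prep(1)[unfolded ok_def] _ _ _ _ _ _ _ m0 th']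
  show ?thesis
    using dist sep unfolding fst_set pf A_def by (simp add: subset_eq)
qed

text \<open>Self-reproduction of the patterns: the root together with the children's patterns
  contains a pattern for the branch, unless its value is below the threshold.\<close>

lemma branch_step:
  assumes S: "tree S" and p: "p \<in> S" and r: "r \<in> nbrs S p" and deg: "deg S r \<in> {3, 4, 5}"
    and check: "\<And>ds. ds \<in> set classes \<Longrightarrow> check_branch ds"
    and children: "\<forall>c\<in>nbrs S r - {p}. deg S c = 1 \<or> (\<exists>P. good_branch S r c P)"
    and thr: "if even (sum (wt S) (branch S p r)) then 2 \<le> sum (wt S) (branch S p r) else -1 \<le> sum (wt S) (branch S p r)"
  shows "\<exists>P. good_branch S p r P"
proof -
  have rS: "r \<in> S" and pr: "p \<in> nbrs S r" using p r lattice.nbrs_sym by (auto simp: lattice.nbrs_def)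
  obtain \<psi> ds where \<psi>: "isometry \<psi>" "\<psi> (0, 0, -1) = p - r" and ds: "ds \<in> set classes"
      "set ds = {d. d \<noteq> ZN \<and> r + \<psi> (vec d) \<in> S}"
    using normal_position[OF S rS pr deg] by blast
  have dist: "distinct ds" "ZN \<notin> set ds" using classes_distinct[OF ds(1)] by auto
  have pZ: "r + \<psi> (vec ZN) = p" using \<psi>(2) by simp
  have inS: "r + \<psi> (vec d) \<in> S" if "d \<in> set ds" for d using that ds(2) by blast
  have nb: "nbrs S r = insert p ((\<lambda>d. r + \<psi> (vec d)) ` set ds)"
  proof -
    have "{d. r + \<psi> (vec d) \<in> S} = insert ZN (set ds)" using p pZ unfolding ds(2) by auto
    then show ?thesis using nbrs_eq[OF S rS \<psi>(1)] pZ by simp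
  qed
  have inj: "inj_on (\<lambda>d. r + \<psi> (vec d)) D" for D by (rule child_inj[OF S rS \<psi>(1)])
  have pn: "p \<notin> (\<lambda>d. r + \<psi> (vec d)) ` set ds"
  proof
    assume "p \<in> (\<lambda>d. r + \<psi> (vec d)) ` set ds"
    then obtain d where d: "d \<in> set ds" "p = r + \<psi> (vec d)" by blast
    have "r + \<psi> (vec d) = r + \<psi> (vec ZN)" by (rule trans[OF d(2)[symmetric] pZ[symmetric]])
    then have "d = ZN" by (simp only: add_left_cancel isometry_inj[OF \<psi>(1)] vec_inj)
    then show False using d(1) dist(2) by blast
  qed
  have nbp: "nbrs S r - {p} = (\<lambda>d. r + \<psi> (vec d)) ` set ds" using nb pn by auto
  have degr: "deg S r = length ds + 1"
  proof -
    have "card (nbrs S r) = Suc (card ((\<lambda>d. r + \<psi> (vec d)) ` set ds))"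
      unfolding nb using pn by (intro card_insert_disjoint) auto
    also have "card ((\<lambda>d. r + \<psi> (vec d)) ` set ds) = length ds"
      using card_image[OF inj] distinct_card[OF dist(1)] by simp
    finally show ?thesis by (simp add: lattice.deg_def)
  qed
  define f where "f = (\<lambda>d. sum (wt S) (branch S r (r + \<psi> (vec d))))"
  define m where "m = (\<lambda>d. sum (one S) (branch S r (r + \<psi> (vec d))))"
  have sums: "sum g (branch S p r) = g r + (\<Sum>d\<leftarrow>ds. sum g (branch S r (r + \<psi> (vec d))))" for g :: "cell \<Rightarrow> int"
  proof -
    have "(\<Sum>c\<in>nbrs S r - {p}. sum g (branch S r c)) = (\<Sum>d\<in>set ds. sum g (branch S r (r + \<psi> (vec d))))"
      unfolding nbp by (rule sum.reindex[OF inj, unfolded comp_def])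
    also have "\<dots> = (\<Sum>d\<leftarrow>ds. sum g (branch S r (r + \<psi> (vec d))))"
      by (rule sum_list_distinct_conv_sum_set[OF dist(1), symmetric])
    finally show ?thesis using lattice.sum_branch[OF S p r, of g] by (simp only:)
  qed
  have wr: "wt S r = 13 * (int (length ds) - 3) - 2" "one S r = 1"
    using deg degr by (auto simp: wt_def one_def)
  let ?\<phi> = "sum (wt S) (branch S p r)" and ?\<mu> = "sum (one S) (branch S p r)"
  have \<phi>: "?\<phi> = wt S r + (\<Sum>d\<leftarrow>ds. f d)" and \<mu>: "?\<mu> = 1 + (\<Sum>d\<leftarrow>ds. m d)"
    unfolding f_def m_def using sums[of "wt S"] sums[of "one S"] wr(2) by (simp_all only:)
  have ch: "deg S (r + \<psi> (vec d)) = 1 \<or> (\<exists>P\<in>set pids. good_branch S r (r + \<psi> (vec d)) P)"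
    if d: "d \<in> set ds" for d
  proof -
    have "r + \<psi> (vec d) \<in> nbrs S r - {p}" using d nbp by blast
    then show ?thesis using children pids_complete by blast
  qed
  have B: "\<exists>e. v = vec e \<and> e \<notin> set ds \<and> r + \<psi> (vec e) \<in> S" if "v \<in> set [(0, 0, -1)]" for v
    using that dist(2) p pZ by (intro exI[of _ ZN]) simp
  have th: "-1 \<le> wt S r + (\<Sum>d\<leftarrow>ds. f d)"
    unfolding \<phi>[symmetric] using thr by (auto split: if_splits)
  have "go final_branch (-1) (wt S r) 1 [] (prep pids [(0, 0, -1)] ds)"
    using check[OF ds(1)] unfolding check_branch_def wr .
  from go_children[OF S rS \<psi>(1) dist(1) inS B ch this th[unfolded f_def]]
  obtain V' t' acc' where go: "final_branch V' t' acc'" "?\<phi> \<le> V'" "even (V' - ?\<phi>)"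
      "t' = ?\<mu> \<or> 100 \<le> t'"
      "\<forall>q\<in>set acc'. \<exists>d\<in>set ds. r + \<psi> q \<in> branch S r (r + \<psi> (vec d))"
    unfolding \<phi> \<mu> f_def m_def by blast
  have "covered V' t' ((0, 0, 0) # acc')"
    using go(1-3) thr unfolding final_branch_def by (auto split: if_splits)
  then obtain P where P0: "if pval P < V' then False else if odd (pval P - V') then False else
     if (if ptag P = 0 then False else ptag P \<noteq> t') then False else
     any (\<lambda>g. every (\<lambda>c. any ((=) (act g c)) ((0, 0, 0) # acc')) (rev (pcells P))) (psyms P)"
    unfolding covered_def any_iff[of _ pids] by blast
  have 1: "\<not> pval P < V'" using P0 by (cases "pval P < V'") (simp_all only: if_True if_False simp_thms)
  have 2: "even (pval P - V')" using P0 1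
    by (cases "odd (pval P - V')") (simp_all only: if_True if_False simp_thms)
  have 3: "ptag P = 0 \<or> ptag P = t'" using P0 1 2
    by (cases "ptag P = 0"; cases "ptag P = t'") (simp_all only: if_True if_False simp_thms)
  have P: "V' \<le> pval P" "even (pval P - V')" "ptag P = 0 \<or> ptag P = t'"
    using 1 2 3 unfolding not_less by blast+
  have "any (\<lambda>g. every (\<lambda>c. any ((=) (act g c)) ((0, 0, 0) # acc')) (rev (pcells P))) (psyms P)"
    using P0 1 2 3
    by (cases "ptag P = 0"; cases "ptag P = t'") (simp_all only: if_True if_False simp_thms)
  then obtain g where "\<forall>c\<in>set (rev (pcells P)). \<exists>v\<in>set ((0, 0, 0) # acc'). act g c = v"
    unfolding any_iff every_iff by blast
  then have g: "\<forall>c\<in>set (pcells P). act g c \<in> insert (0, 0, 0) (set acc')"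
    unfolding set_rev list.set by blast
  have "fits ?\<phi> ?\<mu> P"
    unfolding fits_def using P go(2-4) ptag_bounds[of P] by auto
  moreover have "contains S p r P"
    unfolding contains_def
  proof (intro exI[of _ "\<psi> \<circ> act g"] conjI ballI)
    show "isometry (\<psi> \<circ> act g)" by (intro isometry_comp \<psi>(1) isometry_act)
    show "(\<psi> \<circ> act g) (0, 0, -1) = p - r" using \<psi>(2) by simp
    fix c assume "c \<in> set (pcells P)"
    then consider "act g c = 0" | "act g c \<in> set acc'" using g by (auto simp: zero_prod_def)
    then show "r + (\<psi> \<circ> act g) c \<in> branch S p r"
    proof cases
      case 1
      then show ?thesis by (simp add: isometry_zero[OF \<psi>(1)] lattice.branch_root[OF S])
    next
      case 2
      then obtain d where d: "d \<in> set ds" "r + \<psi> (act g c) \<in> branch S r (r + \<psi> (vec d))"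
        using go(5) by blast
      moreover have "r + \<psi> (vec d) \<in> nbrs S r - {p}" using d nbp by blast
      ultimately show ?thesis unfolding lattice.branch_decomp[OF S p r] comp_apply by blast
    qed
  qed
  ultimately show ?thesis unfolding good_branch_def by blast
qed

text \<open>\<open>\<phi>\<close> is additive over the two sides of an edge, so \<open>s\<close> is
  the sum of the two pattern values. In a tree the sides touch only along that edge, which rules out
  the conflicts found by \<open>check_pair\<close>.\<close>

lemma pair_bound:
  assumes S: "tree S" and x: "x \<in> S" and y: "y \<in> nbrs S x"
    and P: "good_branch S y x P" and Q: "good_branch S x y Q" and check: "check_pair P"
  shows "\<exists>s. sum (wt S) S \<le> s \<and> even (s - sum (wt S) S) \<and> (s < 9 \<or> s = 10 \<or> s = 12 \<and> sum (one S) S = 7)"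
proof (intro exI[of _ "pval P + pval Q"] conjI)
  have yS: "y \<in> S" and xy: "x \<in> nbrs S y" using x y lattice.nbrs_sym by (auto simp: lattice.nbrs_def)
  have fit: "fits (sum (wt S) (branch S y x)) (sum (one S) (branch S y x)) P"
      "fits (sum (wt S) (branch S x y)) (sum (one S) (branch S x y)) Q" and con: "contains S y x P" "contains S x y Q"
    using P Q by (simp_all add: good_branch_def)
  note split = lattice.sum_split[OF S x y]
  show "sum (wt S) S \<le> pval P + pval Q" "even (pval P + pval Q - sum (wt S) S)"
    using fit split[of "wt S"] by (auto simp: fits_def)
  obtain h where h: "isometry h" "h (0, 0, -1) = y - x" "\<forall>c\<in>set (pcells P). x + h c \<in> branch S y x"
    using con(1) by (auto simp: contains_def)
  have yZ: "x + h (vec ZN) = y" using h(2) by simp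
  then obtain g where g: "g \<in> set (psyms Q)"
      "set (place ZN Q g) \<subseteq> {q. x + h q \<in> branch S x (x + h (vec ZN))}"
    using region_pattern[OF S x h(1), of ZN Q] con(2) yS by auto
  have no: "\<not> (near u v \<and> (u \<noteq> (0, 0, 0) \<or> v \<noteq> (0, 0, -1)))" if "u \<in> set (pcells P)" "v \<in> set (place ZN Q g)" for u v
  proof
    assume near: "near u v \<and> (u \<noteq> (0, 0, 0) \<or> v \<noteq> (0, 0, -1))"
    have a: "x + h u \<in> branch S y x" using h(3) that(1) by blast
    have b: "x + h v \<in> branch S x y" using g(2) that(2) yZ by auto
    have disj: "branch S x y \<inter> branch S y x = {}" by (rule lattice.branch_compl(1)[OF S x y])
    have ne: "u \<noteq> v" using a b disj by auto
    then have adj: "adj (x + h u) (x + h v)" using near isometry_adj[OF h(1)] by (simp add: near_iff)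
    have sub: "x + h u \<in> S" "x + h v \<in> S"
      using a b lattice.branch_subset[OF S xy] lattice.branch_subset[OF S y] by auto
    have "x + h v = y"
      using lattice.branch_step[OF S a xy sub(2) adj] b disj by blast
    moreover have "x + h u = x"
      using lattice.branch_step[OF S b y sub(1)] adj a disj lattice.adj_sym by blast
    ultimately have "h u = h 0" "h v = h (0, 0, -1)" using h(2) isometry_zero[OF h(1)] by auto
    then have "u = 0" "v = (0, 0, -1)" using isometry_inj[OF h(1)] by blast+
    then show False using near by (simp add: zero_prod_def)
  qed
  show "pval P + pval Q < 9 \<or> pval P + pval Q = 10 \<or> pval P + pval Q = 12 \<and> sum (one S) S = 7"
  proof (rule ccontr)
    assume not: "\<not> ?thesis"
    have "\<not> (ptag P \<noteq> 0 \<and> ptag Q \<noteq> 0 \<and> ptag P + ptag Q = 7 \<and> pval P + pval Q = 12)"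
      using not fit split[of "one S"] by (auto simp: fits_def)
    moreover have "let s = pval P + pval Q in
       if s < 9 then True else if s = 10 then True
       else if (if s = 12 then if ptag P = 0 then False else if ptag Q = 0 then False else ptag P + ptag Q = 7 else False) then True
       else every (\<lambda>g. any (\<lambda>v. any (\<lambda>u. if near u v then if u = (0, 0, 0) then v \<noteq> (0, 0, -1) else True else False) (pcells P)) (place ZN Q g)) (psyms Q)"
      using check pids_complete[of Q] unfolding check_pair_def every_iff[of _ pids] by blast
    ultimately have "every (\<lambda>g. any (\<lambda>v. any (\<lambda>u. if near u v then if u = (0, 0, 0) then v \<noteq> (0, 0, -1) else True else False) (pcells P)) (place ZN Q g)) (psyms Q)"
      using not unfolding Let_def by (metis (no_types, lifting))
    then have "\<exists>v\<in>set (place ZN Q g). \<exists>u\<in>set (pcells P). if near u v then if u = (0, 0, 0) then v \<noteq> (0, 0, -1) else True else False"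
      using g(1) unfolding every_iff any_iff by blast
    then show False using no by (metis (no_types, lifting))
  qed
qed

lemma top_bound:
  assumes S: "tree S" and x: "x \<in> S" and y: "y \<in> nbrs S x" and deg: "deg S x \<in> {3, 4, 5}"
    and check: "\<And>ds. ds \<in> set classes \<Longrightarrow> check_top (ZN # ds)"
    and children: "\<forall>c\<in>nbrs S x. deg S c = 1 \<or> (\<exists>P. good_branch S x c P \<and> 11 \<le> pval P)"
  shows "sum (wt S) S < 9 \<or> sum (one S) S = 1"
proof (rule ccontr)
  assume not: "\<not> ?thesis"
  obtain \<psi> ds where \<psi>: "isometry \<psi>" "\<psi> (0, 0, -1) = y - x" and ds: "ds \<in> set classes"
      "set ds = {d. d \<noteq> ZN \<and> x + \<psi> (vec d) \<in> S}"
    using normal_position[OF S x y deg] by blast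
  have yZ: "x + \<psi> (vec ZN) \<in> S" using \<psi>(2) y by (simp add: lattice.nbrs_def)
  let ?ds = "ZN # ds"
  have dist: "distinct ?ds" using classes_distinct[OF ds(1)] by auto
  have set: "set ?ds = {d. x + \<psi> (vec d) \<in> S}" using yZ unfolding list.set ds(2) by blast
  have inj: "inj_on (\<lambda>d. x + \<psi> (vec d)) D" for D by (rule child_inj[OF S x \<psi>(1)])
  have nb: "nbrs S x = (\<lambda>d. x + \<psi> (vec d)) ` set ?ds"
    unfolding set by (rule nbrs_eq[OF S x \<psi>(1)])
  have degx: "deg S x = length ?ds"
    unfolding lattice.deg_def nb card_image[OF inj] by (rule distinct_card[OF dist])
  have wx: "wt S x = 13 * (int (length ?ds) - 4) - 2" "one S x = 1"
    using deg degx by (auto simp: wt_def one_def)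
  define f where "f = (\<lambda>d. sum (wt S) (branch S x (x + \<psi> (vec d))))"
  define m where "m = (\<lambda>d. sum (one S) (branch S x (x + \<psi> (vec d))))"
  have sums: "sum g S = g x + (\<Sum>d\<leftarrow>?ds. sum g (branch S x (x + \<psi> (vec d))))" for g :: "cell \<Rightarrow> int"
  proof -
    have "(\<Sum>c\<in>nbrs S x. sum g (branch S x c)) = (\<Sum>d\<in>set ?ds. sum g (branch S x (x + \<psi> (vec d))))"
      unfolding nb by (rule sum.reindex[OF inj, unfolded comp_def])
    also have "\<dots> = (\<Sum>d\<leftarrow>?ds. sum g (branch S x (x + \<psi> (vec d))))"
      by (rule sum_list_distinct_conv_sum_set[OF dist, symmetric])
    finally show ?thesis using lattice.sum_tree[OF S x, of g] by (simp only:)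
  qed
  have \<phi>: "sum (wt S) S = wt S x + (\<Sum>d\<leftarrow>?ds. f d)" and \<mu>: "sum (one S) S = 1 + (\<Sum>d\<leftarrow>?ds. m d)"
    unfolding f_def m_def using sums[of "wt S"] sums[of "one S"] wx(2) by (simp_all only:)
  have ch: "deg S (x + \<psi> (vec d)) = 1 \<or>
      (\<exists>P\<in>set (filter (\<lambda>p. 11 \<le> pval p) pids). good_branch S x (x + \<psi> (vec d)) P)" if d: "d \<in> set ?ds" for d
  proof -
    have "x + \<psi> (vec d) \<in> nbrs S x" using d nb by blast
    then have "deg S (x + \<psi> (vec d)) = 1 \<or> (\<exists>P. good_branch S x (x + \<psi> (vec d)) P \<and> 11 \<le> pval P)"
      using children by blast
    then show ?thesis using pids_complete unfolding set_filter by blast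
  qed
  have th: "9 \<le> wt S x + (\<Sum>d\<leftarrow>?ds. f d)" using not unfolding \<phi> by linarith
  have go: "go (\<lambda>V t acc. t = 1) 9 (wt S x) 1 [] (prep (filter (\<lambda>p. 11 \<le> pval p) pids) [] ?ds)"
    using check[OF ds(1)] unfolding check_top_def wx .
  have inS: "x + \<psi> (vec d) \<in> S" if "d \<in> set ?ds" for d using that set by blast
  have B: "\<exists>e. v = vec e \<and> e \<notin> set ?ds \<and> x + \<psi> (vec e) \<in> S" if "v \<in> set []" for v
    using that by simp
  obtain V' t' acc' where t': "t' = (1 :: int)" "t' = 1 + (\<Sum>d\<leftarrow>?ds. m d) \<or> 100 \<le> t'"
    using go_children[OF S x \<psi>(1) dist inS B ch go th[unfolded f_def]] unfolding m_def by blast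
  then have "1 + (\<Sum>d\<leftarrow>?ds. m d) = 1" by linarith
  then show False using not unfolding \<mu> by blast
qed

section \<open>Evaluation of the finite checks\<close>

lemma check_branch_1: "check_branch [ZP, XP, XN]"
  by code_simp

lemma check_branch_2: "check_branch [XP, XN]"
  by code_simp

lemma check_branch_3: "every check_branch [[ZP, XP], [XP, YP], [ZP, XP, YP], [XP, XN, YP], [XP, XN, YP, YN], [ZP, XP, XN, YP]]"
  by code_simp

lemma check_top_all: "every (\<lambda>ds. check_top (ZN # ds)) classes"
  by code_simp

lemma check_pair_all: "every check_pair pids"
  by code_simp

lemma check_branch_classes:
  assumes "ds \<in> set classes"
  shows "check_branch ds"
proof -
  consider "ds = [ZP, XP, XN]" | "ds = [XP, XN]" |
    "ds \<in> set [[ZP, XP], [XP, YP], [ZP, XP, YP], [XP, XN, YP], [XP, XN, YP, YN], [ZP, XP, XN, YP]]"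
    using assms unfolding classes_def list.set by blast
  then show ?thesis
    using check_branch_1 check_branch_2 check_branch_3 unfolding every_iff by cases blast+
qed

section \<open>The upper bound\<close>

lemma isometry_id: "isometry (\<lambda>u. u)"
  unfolding isometry_def by (auto simp: bij_id[unfolded id_def])

lemma UNIV_dir: "UNIV = set [XP, XN, YP, YN, ZP, ZN]"
proof (rule UNIV_eq_I)
  fix d show "d \<in> set [XP, XN, YP, YN, ZP, ZN]" by (cases d) simp_all
qed

lemma finite_dir: "finite (D :: dir set)"
  by (rule finite_subset[OF subset_UNIV]) (unfold UNIV_dir, rule finite_set)

lemma card_dir_le: "card (D :: dir set) \<le> 6"
proof -
  have "card D \<le> card (UNIV :: dir set)" by (rule card_mono[OF finite_dir subset_UNIV])
  also have "\<dots> \<le> length [XP, XN, YP, YN, ZP, ZN]" unfolding UNIV_dir by (rule card_length)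
  finally show ?thesis by simp
qed

lemma deg_dirs:
  assumes "tree S" "x \<in> S"
  shows "deg S x = card {d. x + vec d \<in> S}"
  unfolding lattice.deg_def nbrs_eq[OF assms isometry_id]
  by (rule card_image[OF child_inj[OF assms isometry_id]])

lemma deg_le_6: "tree S \<Longrightarrow> x \<in> S \<Longrightarrow> deg S x \<le> 6"
  using deg_dirs card_dir_le by simp

lemma add_add_eq_self: "u + e + d = u \<Longrightarrow> d = - e" for u :: "'a :: ab_group_add"
  by (simp add: add.assoc eq_neg_iff_add_eq_0 add.commute)

text \<open>Both ends of an edge cannot have a neighbour in the same perpendicular direction.\<close>

lemma deg_adjacent:
  assumes S: "tree S" and u: "u \<in> S" and v: "v \<in> nbrs S u"
  shows "deg S u + deg S v \<le> 8"
proof -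
  have vS: "v \<in> S" using v by (simp add: lattice.nbrs_def)
  obtain e where e: "v = u + vec e" using child_exists[OF S u isometry_id v] by blast
  let ?D = "\<lambda>x. {d. x + vec d \<in> S}"
  \<comment> \<open>A further common direction would complete a square of four cells, hence a
    cycle.\<close>
  have "?D u \<inter> ?D v \<subseteq> {d. vec d \<in> {vec e, - vec e}}"
  proof
    fix d assume d: "d \<in> ?D u \<inter> ?D v"
    show "d \<in> {d. vec d \<in> {vec e, - vec e}}"
    proof (rule ccontr)
      assume "d \<notin> {d. vec d \<in> {vec e, - vec e}}"
      then have ne: "vec d \<noteq> vec e" "vec d \<noteq> - vec e" by blast+
      have n1: "norm1 (vec c) = 1" for c using norm1_eq_1_iff by blast
      have uS: "u + vec d \<in> S" and wS: "v + vec d \<in> S" using d by blast+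
      have un: "u + vec d \<in> nbrs S u" by (rule child_nbr[OF S u isometry_id uS])
      have "adj v (v + vec d)" using n1 by (simp add: adj_def)
      moreover have "v + vec d \<noteq> u" using ne(2) add_add_eq_self unfolding e by blast
      ultimately have w: "v + vec d \<in> branch S u v"
        by (intro lattice.branch_step[OF S lattice.branch_root[OF S] v wS])
      have "u + vec d \<noteq> v" using ne(1) unfolding e add_left_cancel .
      from lattice.sibling_branches_not_adj(2)[OF S u un v this lattice.branch_root[OF S] w]
      have "\<not> adj (u + vec d) (v + vec d)" .
      moreover have "adj (u + vec d) (v + vec d)"
      proof -
        have "(u + vec d) - (v + vec d) = - vec e" unfolding e by simp
        then show ?thesis unfolding adj_def by (simp only: norm1_uminus n1)
      qed
      ultimately show False by blast
    qed
  qed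
  then have "card (?D u \<inter> ?D v) \<le> card {d. vec d \<in> {vec e, - vec e}}"
    by (rule card_mono[OF finite_dir])
  also have "\<dots> = card (vec ` {d. vec d \<in> {vec e, - vec e}})"
    by (rule card_image[symmetric]) (rule inj_onI, simp only: vec_inj)
  also have "\<dots> \<le> card (set [vec e, - vec e])" by (intro card_mono finite_set) (simp only: list.set, blast)
  also have "\<dots> \<le> length [vec e, - vec e]" by (rule card_length)
  finally have "card (?D u \<inter> ?D v) \<le> 2" by simp
  moreover have "card (?D u \<union> ?D v) \<le> 6"
    by (rule card_dir_le)
  moreover have "card (?D u) + card (?D v) = card (?D u \<union> ?D v) + card (?D u \<inter> ?D v)"
    by (rule card_Un_Int[OF finite_dir finite_dir])
  ultimately show ?thesis unfolding deg_dirs[OF S u] deg_dirs[OF S vS] by linarith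
qed

section \<open>Excess, inner cells and pruned trees\<close>

definition excess :: "cell set \<Rightarrow> cell \<Rightarrow> int" where
  "excess S v = (if 2 \<le> deg S v then int (deg S v) - 4 else 0)"

lemma wt_eq: "wt S v = 13 * excess S v - 2 * one S v"
  by (simp add: wt_def excess_def one_def)

lemma sum_wt: "sum (wt S) A = 13 * sum (excess S) A - 2 * sum (one S) A"
  unfolding wt_eq by (simp add: sum_subtractf sum_distrib_left)

lemma sum_one_nonneg: "0 \<le> sum (one S) A"
  by (intro sum_nonneg) (simp add: one_def)

lemma sum_one_pos:
  assumes "finite A" "v \<in> A" "2 \<le> deg S v"
  shows "1 \<le> sum (one S) A"
  using member_le_sum[OF assms(2) _ assms(1), of "one S"] assms(3) by (simp add: one_def)

lemma sum_excess_0: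
  assumes "finite A" "sum (one S) A = 0"
  shows "sum (excess S) A = 0"
proof (rule sum.neutral, rule ballI)
  fix v assume "v \<in> A"
  then have "one S v = 0" using assms sum_nonneg_eq_0_iff[of A "one S"] by (auto simp: one_def)
  then show "excess S v = 0" by (auto simp: one_def excess_def split: if_splits)
qed

lemma sum_excess_1:
  assumes "finite A" "v \<in> A" "2 \<le> deg S v" "sum (one S) A = 1"
  shows "sum (excess S) A = int (deg S v) - 4"
proof -
  have "sum (one S) (A - {v}) = 0"
    using assms sum.remove[OF assms(1,2), of "one S"] by (simp add: one_def)
  then have "sum (excess S) (A - {v}) = 0" using assms(1) by (intro sum_excess_0) auto
  then show ?thesis using sum.remove[OF assms(1,2), of "excess S"] assms(3) by (simp add: excess_def)
qed

lemma prune_deg: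
  assumes "tree S" "p \<in> S" "r \<in> nbrs S p" "v \<in> branch S r p"
  shows "deg (insert r (branch S r p)) v = deg S v"
  using lattice.prune_tree(2)[OF assms] by (simp add: lattice.deg_def)

lemma prune_deg_root:
  assumes "tree S" "p \<in> S" "r \<in> nbrs S p"
  shows "deg (insert r (branch S r p)) r = 1"
  using lattice.prune_tree(3)[OF assms] by (simp add: lattice.deg_def)

lemma prune_sums:
  assumes S: "tree S" and p: "p \<in> S" "r \<in> nbrs S p"
  defines "T \<equiv> insert r (branch S r p)"
  shows "sum (one T) T = sum (one S) (branch S r p)" "sum (excess T) T = sum (excess S) (branch S r p)"
proof -
  have pr: "p \<in> nbrs S r" using p lattice.nbrs_sym by blast
  have "r \<notin> branch S r p" using lattice.branch_subset[OF S pr] by blast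
  moreover have "finite (branch S r p)" by (rule lattice.branch_finite[OF S pr])
  moreover have "sum (one T) (branch S r p) = sum (one S) (branch S r p)"
    "sum (excess T) (branch S r p) = sum (excess S) (branch S r p)"
    unfolding T_def using prune_deg[OF S p] by (auto simp: one_def excess_def intro!: sum.cong)
  moreover have "one T r = 0" "excess T r = 0"
    unfolding T_def one_def excess_def prune_deg_root[OF S p] by simp_all
  ultimately show "sum (one T) T = sum (one S) (branch S r p)" "sum (excess T) T = sum (excess S) (branch S r p)"
    unfolding T_def by simp_all
qed

lemma leaf_branch:
  assumes S: "tree S" and x: "x \<in> S" and c: "c \<in> nbrs S x" "deg S c = 1"
  shows "sum (one S) (branch S x c) = 0"
proof -
  have "x \<in> nbrs S c" using x c lattice.nbrs_sym by blast
  then have "nbrs S c = {x}" using c(2) by (metis card_1_singletonE lattice.deg_def singletonD)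
  then show ?thesis using lattice.sum_branch[OF S x c(1), of "one S"] c(2) by (simp add: one_def)
qed

section \<open>Arithmetic of the admissible values\<close>

text \<open>The excluded values are 9 and everything from 11 on. By \<open>ell_base_check\<close>
  these are the only ones a tree with one leaf too many could have.\<close>

definition good :: "int \<Rightarrow> bool" where
  "good \<phi> \<longleftrightarrow> (if odd \<phi> then \<phi> \<le> 7 else \<phi> \<le> 10)"

text \<open>The exceptions that degrees up to 5 leave open: one inner cell, with value 11 at degree
  5, and seven inner cells with \<open>e = 2\<close>.\<close>

definition small :: "int \<Rightarrow> int \<Rightarrow> bool" where
  "small \<phi> m \<longleftrightarrow> good \<phi> \<or> m = 0 \<or> m = 1 \<and> \<phi> \<le> 11 \<or> m = 7 \<and> \<phi> = 12"

text \<open>What a bad total minus a good summand must reach: for even differences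
  \<open>9 - 7 = 12 - 10 = 2\<close>, for odd ones \<open>9 - 10 = -1\<close>.\<close>

definition thr :: "int \<Rightarrow> bool" where
  "thr \<phi> \<longleftrightarrow> (if even \<phi> then 2 \<le> \<phi> else -1 \<le> \<phi>)"

lemma thrI: "2 \<le> \<phi> \<or> odd \<phi> \<and> -1 \<le> \<phi> \<Longrightarrow> thr \<phi>"
  unfolding thr_def by auto

lemma thr_of_good:
  assumes "\<not> good (a + b)" "good b"
  shows "thr a"
  using assms unfolding good_def thr_def by presburger

text \<open>If the complement is exceptional, it has at most 7 inner cells, so
  \<open>m \<le> 7\<close> by the size condition. Badness of the total forces
  \<open>1 \<le> e\<close>, and already \<open>13 - 2 * 7 = -1\<close> is enough when
  \<open>e = 1\<close>.\<close>

lemma thr_arith: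
  fixes e m e' m' :: int
  assumes "1 \<le> m" "1 \<le> m'" "m \<le> 7 \<or> 8 \<le> m'" and bad: "\<not> good (13 * (e + e') - 2 * (m + m'))"
    and small: "small (13 * e' - 2 * m') m'" and two: "m = 1 \<Longrightarrow> m' = 1 \<Longrightarrow> e + e' \<le> 0"
  shows "thr (13 * e - 2 * m)"
proof (cases "good (13 * e' - 2 * m')")
  case True
  have "13 * (e + e') - 2 * (m + m') = (13 * e - 2 * m) + (13 * e' - 2 * m')" by simp
  then show ?thesis using thr_of_good bad True by metis
next
  case False
  then have c: "m \<le> 7" "m' = 1 \<and> e' \<le> 1 \<or> m' = 7 \<and> e' = 2"
    using assms(2,3) small unfolding small_def by auto
  define s t where "s = e + e'" and "t = m + m'"
  have bad': "\<not> 13 * s - 2 * t \<le> 7" "s = 2 \<Longrightarrow> \<not> 13 * s - 2 * t \<le> 10"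
    using bad unfolding s_def t_def by (auto simp: good_def split: if_splits)
  have two': "m \<noteq> 1 \<or> m' \<noteq> 1 \<or> e + e' \<le> 0" using two by blast
  have t: "t = m + m'" "m' = 7 \<Longrightarrow> 8 \<le> t" "2 \<le> t" "s \<ge> 1 \<Longrightarrow> m' = 1 \<Longrightarrow> 3 \<le> t"
    using assms(1,2) two' unfolding t_def s_def by linarith+
  \<comment> \<open>This excludes every \<open>e \<le> 0\<close>.\<close>
  have "e \<noteq> 1 - k" if "1 \<le> k" for k
  proof
    assume "e = 1 - k"
    then have "s \<le> e'" using that unfolding s_def by linarith
    from c(2) show False
    proof (elim disjE conjE)
      assume "m' = 1" "e' \<le> 1"
      then consider "s \<le> 0" | "s = 1" "3 \<le> t" using \<open>s \<le> e'\<close> t(4) by linarith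
      then show False using bad'(1) t(3) by cases linarith+
    next
      assume "m' = 7" "e' = 2"
      then consider "s \<le> 1" "8 \<le> t" | "s = 2" "8 \<le> t" using \<open>s \<le> e'\<close> t(2) by linarith
      then show False using bad' by cases linarith+
    qed
  qed
  from this[of "1 - e"] have "1 \<le> e" by linarith
  then consider "e = 1" | "2 \<le> e" by linarith
  then have "2 \<le> 13 * e - 2 * m \<or> odd (13 * e - 2 * m) \<and> -1 \<le> 13 * e - 2 * m"
  proof cases
    case 1
    have "-1 \<le> 13 * e - 2 * m" using c(1) 1 by linarith
    moreover have "odd (13 * e - 2 * m)" using 1 by simp
    ultimately show ?thesis by blast
  next
    case 2
    have "2 \<le> 13 * e - 2 * m" using c(1) 2 by linarith
    then show ?thesis by blast
  qed
  then show ?thesis by (rule thrI)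
qed

lemma good_mono: "good a \<Longrightarrow> b \<le> a \<Longrightarrow> even (a - b) \<Longrightarrow> good b"
  unfolding good_def by auto

lemma small_of_pair: "a \<le> s \<Longrightarrow> even (s - a) \<Longrightarrow> s < 9 \<or> s = 10 \<or> s = 12 \<and> m = 7 \<Longrightarrow> small a m"
  unfolding small_def good_def by presburger

lemma small_of_top: "a < 9 \<or> m = 1 \<Longrightarrow> (m = 1 \<Longrightarrow> a \<le> 11) \<Longrightarrow> small a m"
  unfolding small_def good_def by presburger

section \<open>Trees with degrees 1, 3, 4 and 5\<close>

lemma claim_class_C:
  assumes "tree S" "\<forall>v\<in>S. deg S v \<in> {1, 3, 4, 5}"
  shows "small (sum (wt S) S) (sum (one S) S)"
  using assms
proof (induction "nat (sum (one S) S)" arbitrary: S rule: less_induct)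
  case less
  note S = less.prems(1) and degs = less.prems(2)
  let ?m = "\<lambda>p r. sum (one S) (branch S p r)" and ?e = "\<lambda>p r. sum (excess S) (branch S p r)"
  let ?f = "\<lambda>p r. sum (wt S) (branch S p r)"
  have fin: "finite S" by (rule lattice.tree_finite[OF S])
  have nS: "r \<in> S" "p \<in> nbrs S r" if "p \<in> S" "r \<in> nbrs S p" for p r
    using that lattice.nbrs_sym by (auto simp: lattice.nbrs_def)
  have finb: "finite (branch S p r)" if "p \<in> S" "r \<in> nbrs S p" for p r
    by (rule lattice.branch_finite[OF S that(2)])
  have mpos: "1 \<le> ?m p r" if "p \<in> S" "r \<in> nbrs S p" "2 \<le> deg S r" for p r
    by (rule sum_one_pos[OF finb[OF that(1,2)] lattice.branch_root[OF S] that(3)])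
  have msplit: "sum (one S) S = ?m p r + ?m r p" if "p \<in> S" "r \<in> nbrs S p" for p r
    by (rule lattice.sum_split[OF S that])
  have fsplit: "sum (wt S) S = ?f p r + ?f r p" if "p \<in> S" "r \<in> nbrs S p" for p r
    by (rule lattice.sum_split[OF S that])
  have mless: "?m r c < ?m p r" if "p \<in> S" "r \<in> nbrs S p" "2 \<le> deg S r" "c \<in> nbrs S r - {p}" for p r c
  proof -
    have "?m r c \<le> (\<Sum>c\<in>nbrs S r - {p}. ?m r c)"
      using that(4) fin by (intro member_le_sum) (auto intro: sum_one_nonneg)
    then show ?thesis using lattice.sum_branch[OF S that(1,2), of "one S"] that(3) by (simp add: one_def)
  qed
  \<comment> \<open>With \<open>p\<close> added as a leaf the branch is a tree of the same class,
    and it has lost \<open>p\<close> as an inner cell.\<close>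
  have IH: "small (?f p r) (?m p r)" if p: "p \<in> S" "2 \<le> deg S p" and r: "r \<in> nbrs S p" for p r
  proof -
    let ?T = "insert p (branch S p r)"
    have rS: "r \<in> S" "p \<in> nbrs S r" using nS[OF p(1) r] .
    note sums = prune_sums[OF S rS]
    have "sum (one ?T) ?T < sum (one S) S"
      unfolding sums using msplit[OF p(1) r] mpos[OF rS p(2)] by linarith
    then have lt: "nat (sum (one ?T) ?T) < nat (sum (one S) S)"
      using sum_one_nonneg[of ?T ?T] by linarith
    have "deg ?T v \<in> {1, 3, 4, 5}" if "v \<in> ?T" for v
    proof (cases "v = p")
      case True
      then show ?thesis using prune_deg_root[OF S rS] by simp
    next
      case False
      then have v: "v \<in> branch S p r" using that by blast
      moreover have "v \<in> S" using v lattice.branch_subset[OF S r] by blast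
      ultimately show ?thesis using prune_deg[OF S rS v] degs by simp
    qed
    then have "small (sum (wt ?T) ?T) (sum (one ?T) ?T)"
      using less.hyps[OF lt lattice.prune_tree(1)[OF S rS]] by blast
    then show ?thesis unfolding sum_wt sums .
  qed
  show ?case
  proof (rule ccontr)
    assume not: "\<not> small (sum (wt S) S) (sum (one S) S)"
    then have bad: "\<not> good (sum (wt S) S)" "sum (one S) S \<noteq> 0" by (auto simp: small_def)
    \<comment> \<open>An exceptional complement has fewer than 8 inner cells, so under this
      condition the branch then has at most 7.\<close>
    let ?size = "\<lambda>p r. ?m p r \<le> 7 \<or> 8 \<le> ?m r p"
    have thr: "thr (?f p r)" if p: "p \<in> S" "2 \<le> deg S p" and r: "r \<in> nbrs S p" "2 \<le> deg S r" and size: "?size p r" for p r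
    proof -
      have rS: "r \<in> S" "p \<in> nbrs S r" using nS[OF p(1) r(1)] .
      have "thr (13 * ?e p r - 2 * ?m p r)"
      proof (rule thr_arith[OF mpos[OF p(1) r] mpos[OF rS p(2)] size])
        show "\<not> good (13 * (?e p r + ?e r p) - 2 * (?m p r + ?m r p))"
        proof -
          have "13 * (?e p r + ?e r p) - 2 * (?m p r + ?m r p) = sum (wt S) S"
            unfolding fsplit[OF p(1) r(1)] unfolding sum_wt by (simp add: algebra_simps)
          then show ?thesis using bad(1) by simp
        qed
        show "small (13 * ?e r p - 2 * ?m r p) (?m r p)"
          using IH[OF rS(1) r(2) rS(2)] unfolding sum_wt .
        assume "?m p r = 1" "?m r p = 1"
        then have "?e p r = int (deg S r) - 4" "?e r p = int (deg S p) - 4"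
          using sum_excess_1[OF finb[OF p(1) r(1)] lattice.branch_root[OF S] r(2)]
            sum_excess_1[OF finb[OF rS] lattice.branch_root[OF S] p(2)] by blast+
        then show "?e p r + ?e r p \<le> 0" using deg_adjacent[OF S p(1) r(1)] by linarith
      qed
      then show ?thesis unfolding sum_wt .
    qed
    have inner: "deg S v \<in> {3, 4, 5}" if "v \<in> S" "2 \<le> deg S v" for v using degs that by fastforce
    have leaf: "deg S v = 1" if "v \<in> S" "\<not> 2 \<le> deg S v" for v using degs that by fastforce
    have step: "\<exists>P. good_branch S p r P"
      if p: "p \<in> S" and r: "r \<in> nbrs S p" "2 \<le> deg S r" and t: "thr (?f p r)"
        and ch: "\<And>c. c \<in> nbrs S r - {p} \<Longrightarrow> 2 \<le> deg S c \<Longrightarrow> \<exists>P. good_branch S r c P" for p r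
    proof (rule branch_step[OF S p r(1) inner[OF nS(1)[OF p r(1)] r(2)] check_branch_classes])
      show "if even (?f p r) then 2 \<le> ?f p r else - 1 \<le> ?f p r" using t unfolding thr_def .
      show "\<forall>c\<in>nbrs S r - {p}. deg S c = 1 \<or> (\<exists>P. good_branch S r c P)"
      proof
        fix c assume c: "c \<in> nbrs S r - {p}"
        then have "c \<in> S" by (simp add: lattice.nbrs_def)
        then show "deg S c = 1 \<or> (\<exists>P. good_branch S r c P)" using ch[OF c] leaf by blast
      qed
    qed
    \<comment> \<open>Towards the leaves \<open>?m\<close> of the branch decreases and that of its
      complement grows, so \<open>?size\<close> is inherited.\<close>
    have pat: "\<exists>P. good_branch S p r P"
      if "p \<in> S" "2 \<le> deg S p" "r \<in> nbrs S p" "2 \<le> deg S r" "?size p r" for p r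
      using that
    proof (induction "nat (?m p r)" arbitrary: p r rule: less_induct)
      case (less p r)
      note p = less.prems(1,2) and r = less.prems(3,4)
      have rS: "r \<in> S" "p \<in> nbrs S r" using nS[OF p(1) r(1)] .
      show ?case
      proof (rule step[OF p(1) r thr[OF less.prems]])
        fix c assume c: "c \<in> nbrs S r - {p}" "2 \<le> deg S c"
        have cS: "c \<in> nbrs S r" using c by blast
        have "?m r c < ?m p r" by (rule mless[OF p(1) r c(1)])
        moreover have "?m p r + ?m r p = ?m r c + ?m c r"
          using msplit[OF p(1) r(1)] msplit[OF rS(1) cS] by linarith
        ultimately show "\<exists>P. good_branch S r c P"
          using less.prems(5) sum_one_nonneg[of S "branch S r c"]
          by (intro less.hyps[OF _ rS(1) r(2) cS c(2)]) linarith+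
      qed
    qed
    \<comment> \<open>Existence of a centroid: among the directed edges whose branch has more than
      half of the inner cells take one with the least branch; its head is a centroid.\<close>
    have "\<exists>x\<in>S. 2 \<le> deg S x \<and> (\<forall>y\<in>nbrs S x. 2 \<le> deg S y \<longrightarrow> 2 * ?m x y \<le> sum (one S) S)"
    proof (cases "\<exists>p r. p \<in> S \<and> 2 \<le> deg S p \<and> r \<in> nbrs S p \<and> 2 \<le> deg S r \<and> sum (one S) S < 2 * ?m p r")
      case False
      obtain x where "x \<in> S" "one S x \<noteq> 0" using bad(2) by (meson sum.not_neutral_contains_not_neutral)
      then show ?thesis using False by (intro bexI[of _ x]) (auto simp: one_def not_less split: if_splits)
    next
      case True
      let ?Q = "\<lambda>z. fst z \<in> S \<and> 2 \<le> deg S (fst z) \<and> snd z \<in> nbrs S (fst z) \<and> 2 \<le> deg S (snd z) \<and>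
        sum (one S) S < 2 * ?m (fst z) (snd z)"
      obtain p0 r0 where "?Q (p0, r0)" using True unfolding fst_conv snd_conv by blast
      then obtain z where z: "?Q z" "\<And>y. ?Q y \<Longrightarrow> nat (?m (fst z) (snd z)) \<le> nat (?m (fst y) (snd y))"
        using ex_has_least_nat[of ?Q "(p0, r0)" "\<lambda>z. nat (?m (fst z) (snd z))"] by blast
      obtain p r where pr: "z = (p, r)" by (metis surj_pair)
      have p: "p \<in> S" "2 \<le> deg S p" "r \<in> nbrs S p" "2 \<le> deg S r" "sum (one S) S < 2 * ?m p r"
        using z(1) unfolding pr by simp_all
      have least: "?m p r \<le> ?m a b" if "a \<in> S" "2 \<le> deg S a" "b \<in> nbrs S a" "2 \<le> deg S b" "sum (one S) S < 2 * ?m a b" for a b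
        using z(2)[of "(a, b)"] that sum_one_nonneg[of S "branch S a b"] unfolding pr by simp
      have rS: "r \<in> S" "p \<in> nbrs S r" using nS[OF p(1,3)] .
      show ?thesis
      proof (intro bexI[of _ r] conjI ballI impI)
        fix y assume y: "y \<in> nbrs S r" "2 \<le> deg S y"
        show "2 * ?m r y \<le> sum (one S) S"
        proof (cases "y = p")
          case True
          show ?thesis using msplit[OF p(1,3)] p(5) unfolding True by linarith
        next
          case False
          then have "?m r y < ?m p r" using y by (intro mless[OF p(1,3,4)]) blast
          then show ?thesis using least[OF rS(1) p(4) y] by linarith
        qed
      qed (use p rS in auto)
    qed
    then obtain x where x: "x \<in> S" "2 \<le> deg S x"
      and half: "\<And>y. y \<in> nbrs S x \<Longrightarrow> 2 \<le> deg S y \<Longrightarrow> 2 * ?m x y \<le> sum (one S) S" by blast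
    have xpat: "\<exists>P. good_branch S x y P" if y: "y \<in> nbrs S x" "2 \<le> deg S y" for y
    proof (rule pat[OF x y])
      show "?m x y \<le> 7 \<or> 8 \<le> ?m y x"
        using half[OF y] msplit[OF x(1) y(1)] by linarith
    qed
    show False
    \<comment> \<open>A branch with value at most 10 is good, so its complement meets the thresholds
      whatever its size, and a pattern is available on both sides of the edge. Otherwise only the
      six patterns of value 11 or 12 occur around \<open>x\<close>.\<close>
    proof (cases "\<exists>y Q. y \<in> nbrs S x \<and> 2 \<le> deg S y \<and> good_branch S x y Q \<and> pval Q < 11")
      case True
      then obtain y Q where y: "y \<in> nbrs S x" "2 \<le> deg S y" and Q: "good_branch S x y Q" "pval Q < 11" by blast
      have yS: "y \<in> S" "x \<in> nbrs S y" using nS[OF x(1) y(1)] .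
      \<comment> \<open>No pattern has the value 9, the only value below 11 that can occur among
        pattern values without being good.\<close>
      have "good (pval Q)" using Q(2) by (cases Q) (simp_all add: good_def)
      moreover have "?f x y \<le> pval Q" "even (pval Q - ?f x y)"
        using Q(1) unfolding good_branch_def fits_def by blast+
      ultimately have "good (?f x y)" by (rule good_mono)
      then have "thr (?f y x)"
        using thr_of_good bad(1) fsplit[OF yS] by metis
      then have "\<exists>P. good_branch S y x P"
        using xpat by (intro step[OF yS(1,2) x(2)]) blast+
      then obtain P where P: "good_branch S y x P" by blast
      have "check_pair P" using check_pair_all pids_complete unfolding every_iff by blast
      from pair_bound[OF S x(1) y(1) P Q(1) this]
      obtain s where s: "sum (wt S) S \<le> s" "even (s - sum (wt S) S)" "s < 9 \<or> s = 10 \<or> s = 12 \<and> sum (one S) S = 7"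
        by blast
      have "small (sum (wt S) S) (sum (one S) S)"
        using small_of_pair[OF s] .
      then show False using not by blast
    next
      case False
      have "\<exists>y. y \<in> nbrs S x"
        using x(2) unfolding lattice.deg_def by (metis card.empty ex_in_conv not_numeral_le_zero)
      then obtain y where y: "y \<in> nbrs S x" by blast
      have "\<forall>c\<in>nbrs S x. deg S c = 1 \<or> (\<exists>P. good_branch S x c P \<and> 11 \<le> pval P)"
      proof
        fix c assume c: "c \<in> nbrs S x"
        then have cS: "c \<in> S" by (simp add: lattice.nbrs_def)
        show "deg S c = 1 \<or> (\<exists>P. good_branch S x c P \<and> 11 \<le> pval P)"
        proof (cases "2 \<le> deg S c")
          case True
          then show ?thesis using xpat[OF c] False c by (meson not_less)
        qed (use leaf[OF cS] in blast)
      qed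
      then have "sum (wt S) S < 9 \<or> sum (one S) S = 1"
        using check_top_all unfolding every_iff
        by (intro top_bound[OF S x(1) y inner[OF x]]) blast+
      moreover have "sum (wt S) S \<le> 11" if "sum (one S) S = 1"
        using sum_excess_1[OF fin x that] inner[OF x] that unfolding sum_wt by auto
      ultimately have "small (sum (wt S) S) (sum (one S) S)"
        by (intro small_of_top)
      then show False using not by blast
    qed
  qed
qed

section \<open>Trees with arbitrary degrees\<close>

text \<open>The second disjunct covers the chains of cells of degree 6 joined through cells of
  degree 2: each further link keeps \<open>e = 2\<close> and adds two inner cells.\<close>

definition bound :: "int \<Rightarrow> int \<Rightarrow> bool" where
  "bound e m \<longleftrightarrow> good (13 * e - 2 * m) \<or> e \<le> 2 \<and> m \<in> {1, 3, 5, 7}"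

lemma boundD: "bound e m \<Longrightarrow> 13 * e - 2 * m \<le> 10 \<or> e \<le> 2 \<and> m \<in> {1, 3, 5, 7}"
  unfolding bound_def good_def by (auto split: if_splits)

lemma boundI: "13 * e - 2 * m \<le> 8 \<or> e \<le> 2 \<and> m \<in> {1, 3, 5, 7} \<Longrightarrow> bound e m"
  unfolding bound_def good_def by (cases "13 * e - 2 * m = 8") auto

text \<open>The joining cell of degree 2 changes the sum of the values by -28, and no part exceeds
  24. One part with at most 10 gives at most 6; two exceptional parts either form an exceptional
  tree again or have \<open>8 \<le> m + m'\<close> and give at most
  \<open>52 - 16 - 28 = 8\<close>.\<close>

lemma bound_join:
  assumes "bound e m" "bound e' m'"
  shows "bound (e + e' - 2) (m + m' + 1)"
proof (rule boundI)
  consider "13 * e - 2 * m \<le> 10 \<or> 13 * e' - 2 * m' \<le> 10"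
    | "e \<le> 2" "m \<in> {1, 3, 5, 7}" "e' \<le> 2" "m' \<in> {1, 3, 5, 7}"
    using boundD[OF assms(1)] boundD[OF assms(2)] by blast
  then show "13 * (e + e' - 2) - 2 * (m + m' + 1) \<le> 8 \<or> e + e' - 2 \<le> 2 \<and> m + m' + 1 \<in> {1, 3, 5, 7}"
  proof cases
    case 1
    have "13 * e - 2 * m \<le> 24" "13 * e' - 2 * m' \<le> 24"
      using boundD[OF assms(1)] boundD[OF assms(2)] by auto
    then have "(13 * e - 2 * m) + (13 * e' - 2 * m') - 28 \<le> 8" using 1 by linarith
    then show ?thesis by (simp add: algebra_simps)
  next
    case 2
    show ?thesis
    proof (cases "m + m' \<le> 6")
      case True
      then show ?thesis using 2 by auto
    next
      case False
      then have "8 \<le> m + m'" using 2(2,4) by auto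
      then have "(13 * e - 2 * m) + (13 * e' - 2 * m') - 28 \<le> 8" using 2(1,3) by linarith
      then show ?thesis by (simp add: algebra_simps)
    qed
  qed
qed

lemma bound_of_small: "small (13 * e - 2 * m) m \<Longrightarrow> (m = 0 \<Longrightarrow> e = 0) \<Longrightarrow> bound e m"
  unfolding small_def bound_def by (auto simp: good_def)

lemma tree_deg_pos:
  assumes S: "tree S" and v: "v \<in> S" and card: "2 \<le> card S"
  shows "1 \<le> deg S v"
proof -
  have fin: "finite S" by (rule lattice.tree_finite[OF S])
  have "S \<noteq> {v}" using card by auto
  then obtain w where "w \<in> S" "w \<noteq> v" using v by blast
  then have "nbrs S v \<noteq> {}"
    using lattice.rtrancl_first_step[OF lattice.tree_connected[OF S v]] by blast
  then show ?thesis using fin by (simp add: lattice.deg_def Suc_le_eq card_gt_0_iff)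
qed

lemma excess_bound:
  assumes "tree S"
  shows "bound (sum (excess S) S) (sum (one S) S)"
  using assms
proof (induction "card S" arbitrary: S rule: less_induct)
  case less
  note S = less.prems
  have fin: "finite S" by (rule lattice.tree_finite[OF S])
  consider (single) "card S < 2" | (two) v where "v \<in> S" "deg S v = 2" | (six) v where "2 \<le> card S" "v \<in> S" "deg S v = 6" "\<And>c. c \<in> S \<Longrightarrow> deg S c \<noteq> 2"
    | (main) "2 \<le> card S" "\<And>v. v \<in> S \<Longrightarrow> deg S v \<noteq> 2 \<and> deg S v \<noteq> 6"
    using not_less by blast
  then show ?case
  proof cases
    case single
    have "\<not> 2 \<le> deg S v" for v
      using card_mono[OF fin, of "nbrs S v"] single by (auto simp: lattice.deg_def lattice.nbrs_def)
    then have "one S v = 0" "excess S v = 0" for v by (simp_all add: one_def excess_def)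
    then show ?thesis by (intro boundI) simp
  next
    case (two v)
    then obtain a b where ab: "nbrs S v = {a, b}" "a \<noteq> b"
      by (metis card_2_iff lattice.deg_def)
    have part: "bound (sum (excess S) (branch S v c)) (sum (one S) (branch S v c))" if c: "c \<in> nbrs S v" for c
    proof -
      let ?T = "insert v (branch S v c)"
      have cS: "c \<in> S" "v \<in> nbrs S c" using c two(1) lattice.nbrs_sym by (auto simp: lattice.nbrs_def)
      \<comment> \<open>The other neighbour of \<open>v\<close> is missing from the piece, which
        makes the piece smaller.\<close>
      obtain d where d: "d \<in> nbrs S v" "d \<noteq> c" using ab by blast
      have "d \<notin> ?T"
        using lattice.sibling_branches_disjoint[OF S two(1) c d(1) d(2)[symmetric]] lattice.branch_root[OF S, of d v]
          d(1) by (auto simp: lattice.nbrs_def)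
      moreover have "d \<in> S" "?T \<subseteq> S" using d(1) lattice.branch_subset[OF S c] two(1) by (auto simp: lattice.nbrs_def)
      ultimately have "card ?T < card S" using fin by (intro psubset_card_mono) blast+
      from less.hyps[OF this lattice.prune_tree(1)[OF S cS]]
      show ?thesis unfolding prune_sums[OF S cS] .
    qed
    have "sum f S = f v + (sum f (branch S v a) + sum f (branch S v b))" for f :: "cell \<Rightarrow> int"
      using lattice.sum_tree[OF S two(1), of f] ab by simp
    then have "sum (excess S) S = sum (excess S) (branch S v a) + sum (excess S) (branch S v b) - 2"
      "sum (one S) S = sum (one S) (branch S v a) + sum (one S) (branch S v b) + 1"
      using two(2) by (simp_all add: excess_def one_def)
    then show ?thesis using bound_join[OF part part] ab by simp
  next
    case (six v)
    have "sum (one S) (branch S v c) = 0" if c: "c \<in> nbrs S v" for c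
    proof (rule leaf_branch[OF S six(2) c])
      have "c \<in> S" using c by (simp add: lattice.nbrs_def)
      moreover have "deg S c \<noteq> 2" using six(4) \<open>c \<in> S\<close> by blast
      ultimately show "deg S c = 1" using deg_adjacent[OF S six(2) c] six(3) tree_deg_pos[OF S _ six(1), of c] by linarith
    qed
    then have m: "sum (one S) S = 1" using lattice.sum_tree[OF S six(2), of "one S"] six(3) by (simp add: one_def)
    then have "sum (excess S) S = 2" using sum_excess_1[OF fin six(2) _ m] six(3) by simp
    then show ?thesis using m by (intro boundI) simp
  next
    case main
    have "deg S v \<in> {1, 3, 4, 5}" if v: "v \<in> S" for v
      using tree_deg_pos[OF S v main(1)] deg_le_6[OF S v] main(2)[OF v] by auto
    then have "small (sum (wt S) S) (sum (one S) S)" using claim_class_C[OF S] by blast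
    then show ?thesis unfolding sum_wt using sum_excess_0[OF fin] by (intro bound_of_small) auto
  qed
qed

text \<open>\<open>deg - 2\<close> is the excess plus 2 at inner cells and -1 at leaves, so the
  handshake identity counts the leaves.\<close>

lemma leaves_and_inner:
  assumes S: "tree S" and card: "2 \<le> card S"
  shows "int (card S) = int (card {v\<in>S. deg S v = 1}) + sum (one S) S"
    and "int (card {v\<in>S. deg S v = 1}) = sum (excess S) S + 2 * sum (one S) S + 2"
proof -
  have fin: "finite S" by (rule lattice.tree_finite[OF S])
  let ?l = "\<lambda>v. if deg S v = 1 then 1 else 0 :: int"
  have pos: "1 \<le> deg S v" if "v \<in> S" for v by (rule tree_deg_pos[OF S that card])
  have l: "int (card {v\<in>S. deg S v = 1}) = sum ?l S"
    using fin by (simp add: sum.If_cases Int_def)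
  have "int (card S) = (\<Sum>v\<in>S. ?l v + one S v)"
  proof -
    have "(\<Sum>v\<in>S. ?l v + one S v) = (\<Sum>v\<in>S. 1)"
      using pos by (intro sum.cong) (fastforce simp: one_def)+
    then show ?thesis by simp
  qed
  then show "int (card S) = int (card {v\<in>S. deg S v = 1}) + sum (one S) S"
    unfolding l by (simp add: sum.distrib)
  have "(\<Sum>v\<in>S. int (deg S v) - 2) = (\<Sum>v\<in>S. excess S v + 2 * one S v - ?l v)"
    using pos by (intro sum.cong) (fastforce simp: one_def excess_def)+
  then show "int (card {v\<in>S. deg S v = 1}) = sum (excess S) S + 2 * sum (one S) S + 2"
    using lattice.handshake[OF S] unfolding l by (simp add: sum.distrib sum_subtractf sum_distrib_left)
qed

section \<open>Growing trees with many leaves\<close>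

context sym_graph
begin

lemma nbrs_insert: "v \<notin> S \<Longrightarrow> nbrs (insert v S) w = (if adj w v then insert v (nbrs S w) else nbrs S w)"
  by (auto simp: nbrs_def)

lemma tree_insert:
  assumes S: "tree S" and v: "v \<notin> S" and nv: "nbrs S v = {u}"
  shows "tree (insert v S)"
proof -
  have uv: "u \<in> S" "adj v u" using nv by (auto simp: nbrs_def)
  have only: "w = u" if "w \<in> S" "adj v w" for w using nv that by (auto simp: nbrs_def)
  have sub: "edges S \<subseteq> edges (insert v S)" by (rule edges_mono) blast
  have vu: "(v, u) \<in> edges (insert v S)" using uv by (simp add: edges_def)
  have reach: "(u, a) \<in> (edges (insert v S))\<^sup>*" if "a \<in> insert v S" for a
  proof (cases "a = v")
    case True
    then show ?thesis using edges_rtrancl_sym[OF r_into_rtrancl[OF vu]] by simp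
  next
    case False
    then have "(u, a) \<in> (edges S)\<^sup>*" using that uv tree_connected[OF S] by blast
    then show ?thesis using rtrancl_mono[OF sub] by blast
  qed
  \<comment> \<open>A walk enters and leaves the new leaf only through \<open>u\<close>, so its
    visits to \<open>v\<close> can be cut out.\<close>
  have path: "if b = v then (a, u) \<in> (edges (S - {r}))\<^sup>* else (a, b) \<in> (edges (S - {r}))\<^sup>*"
    if "(a, b) \<in> (edges (insert v S - {r}))\<^sup>*" "a \<noteq> v" for a b r
    using that(1)
  proof (induction rule: rtrancl_induct)
    case base
    show ?case using that(2) by simp
  next
    case (step x y)
    have xy: "x \<in> insert v S - {r}" "y \<in> insert v S - {r}" "adj x y" using step.hyps(2) by (auto simp: edges_def)
    show ?case
    proof (cases "x = v")
      case True
      then have "y \<noteq> v" using xy(3) by auto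
      then have "y = u" using only True xy by auto
      then show ?thesis using step.IH True \<open>y \<noteq> v\<close> by simp
    next
      case x: False
      show ?thesis
      proof (cases "y = v")
        case True
        then have "x = u" using only x xy adj_sym by auto
        then show ?thesis using step.IH True x by simp
      next
        case False
        then have "(x, y) \<in> edges (S - {r})" using xy x by (auto simp: edges_def)
        then show ?thesis using step.IH x False by (simp add: rtrancl.rtrancl_into_rtrancl)
      qed
    qed
  qed
  have aux: "False" if "r \<in> S" "v \<in> nbrs (insert v S) r" "c \<in> nbrs (insert v S) r" "c \<noteq> v" "(c, v) \<in> (edges (insert v S - {r}))\<^sup>*" for r c
  proof -
    have "r = u" using only that(1,2) adj_sym by (auto simp: nbrs_def)
    moreover have "(c, u) \<in> (edges (S - {r}))\<^sup>*" using path[OF that(5,4)] by simp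
    moreover have "c \<in> S - {r}" using that(3,4) by (auto simp: nbrs_def)
    ultimately show False using edges_rtrancl_mem by blast
  qed
  have acyc: "c = c'" if r: "r \<in> insert v S" and c: "c \<in> nbrs (insert v S) r" "c' \<in> nbrs (insert v S) r"
    and p: "(c, c') \<in> (edges (insert v S - {r}))\<^sup>*" for r c c'
  proof (cases "r = v")
    case True
    then show ?thesis using c only by (auto simp: nbrs_def)
  next
    case False
    then have rS: "r \<in> S" using r by blast
    show ?thesis
    proof (rule ccontr)
      assume ne: "c \<noteq> c'"
      consider "c = v" | "c' = v" | "c \<noteq> v" "c' \<noteq> v" by blast
      then show False
      proof cases
        case 1
        then show False using aux[OF rS] c ne edges_rtrancl_sym[OF p] by blast
      next
        case 2
        then show False using aux[OF rS] c ne p by blast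
      next
        case 3
        then have "(c, c') \<in> (edges (S - {r}))\<^sup>*" "c \<in> nbrs S r" "c' \<in> nbrs S r"
          using path[OF p] c by (auto simp: nbrs_def)
        then show False using tree_acyclic[OF S rS] ne by blast
      qed
    qed
  qed
  have conn: "(a, b) \<in> (edges (insert v S))\<^sup>*" if "a \<in> insert v S" "b \<in> insert v S" for a b
    using reach that edges_rtrancl_sym rtrancl_trans by meson
  show ?thesis
    unfolding tree_def using tree_finite[OF S] conn acyc by (intro conjI ballI impI notI) auto
qed

lemma edges_image: "(\<And>a b. adj (f a) (f b) \<longleftrightarrow> adj a b) \<Longrightarrow> (a, b) \<in> (edges A)\<^sup>* \<Longrightarrow> (f a, f b) \<in> (edges (f ` A))\<^sup>*"
  by (rotate_tac 1, induction rule: rtrancl_induct) (auto simp: edges_def intro: rtrancl.rtrancl_into_rtrancl)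

lemma nbrs_image:
  assumes "\<And>a b. adj (f a) (f b) \<longleftrightarrow> adj a b"
  shows "nbrs (f ` S) (f v) = f ` nbrs S v"
  unfolding nbrs_def using assms by auto

lemma tree_image:
  assumes inv: "\<And>a. g (f a) = a" "\<And>a. f (g a) = a" and adj: "\<And>a b. adj (f a) (f b) \<longleftrightarrow> adj a b" and S: "tree S"
  shows "tree (f ` S)"
proof -
  have adj': "adj (g a) (g b) \<longleftrightarrow> adj a b" for a b using adj[of "g a" "g b"] inv by simp
  have img: "g ` (f ` A) = A" for A using inv by (simp add: image_image)
  have sub: "f ` A - {f r} = f ` (A - {r})" for A r using inv(1) by auto metis+
  have acyc: "c = c'" if r: "r \<in> S" and c: "c \<in> nbrs (f ` S) (f r)" "c' \<in> nbrs (f ` S) (f r)"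
    and p: "(c, c') \<in> (edges (f ` S - {f r}))\<^sup>*" for r c c'
  proof -
    obtain d d' where d: "d \<in> nbrs S r" "d' \<in> nbrs S r" "c = f d" "c' = f d'"
      using c unfolding nbrs_image[OF adj] by blast
    have "(g c, g c') \<in> (edges (g ` (f ` (S - {r}))))\<^sup>*"
      using edges_image[OF adj' p] unfolding sub .
    then have "(d, d') \<in> (edges (S - {r}))\<^sup>*" unfolding img d(3,4) inv(1) .
    then show ?thesis using tree_acyclic[OF S r d(1,2)] d by blast
  qed
  have conn: "(f a, f b) \<in> (edges (f ` S))\<^sup>*" if "a \<in> S" "b \<in> S" for a b
    by (rule edges_image[OF adj tree_connected[OF S that]])
  have "finite (f ` S)" "f ` S \<noteq> {}" using tree_finite[OF S] S by (auto simp: tree_def)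
  then show ?thesis unfolding tree_def using conn acyc by (intro conjI ballI impI notI) blast+
qed

end

definition leaf_set :: "cell set \<Rightarrow> cell set" where
  "leaf_set S = {v\<in>S. deg S v = 1}"

lemma leaf_set_insert:
  assumes S: "tree S" and card: "2 \<le> card S" and v: "v \<notin> S" and nv: "nbrs S v = {u}"
  shows "leaf_set (insert v S) = insert v (leaf_set S - {u})"
proof -
  have fin: "finite S" by (rule lattice.tree_finite[OF S])
  have u: "u \<in> S" using nv by (auto simp: lattice.nbrs_def)
  have adj: "adj w v \<longleftrightarrow> w = u" if "w \<in> S" for w
  proof -
    have "w \<in> nbrs S v \<longleftrightarrow> adj w v"
      using that lattice.adj_sym[of w v] unfolding lattice.nbrs_def by blast
    then show ?thesis unfolding nv by blast
  qed
  have nm: "v \<notin> nbrs S w" for w using v by (simp add: lattice.nbrs_def)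
  have dv: "deg (insert v S) v = 1"
    using lattice.nbrs_insert[OF v, of v] nv by (simp add: lattice.deg_def)
  have "deg (insert v S) u = Suc (deg S u)"
    using lattice.nbrs_insert[OF v, of u] adj[OF u] nm fin by (simp add: lattice.deg_def)
  then have du: "deg (insert v S) u \<noteq> 1" using tree_deg_pos[OF S u card] by simp
  have dw: "deg (insert v S) w = deg S w" if "w \<in> S" "w \<noteq> u" for w
    using lattice.nbrs_insert[OF v, of w] adj[OF that(1)] that(2) by (simp add: lattice.deg_def)
  show ?thesis
  proof (rule set_eqI)
    fix w
    consider "w = v" | "w = u" | "w \<in> S" "w \<noteq> u" | "w \<notin> insert v S" by blast
    then show "w \<in> leaf_set (insert v S) \<longleftrightarrow> w \<in> insert v (leaf_set S - {u})"
    proof cases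
      case 2
      then show ?thesis using u v du unfolding leaf_set_def by blast
    next
      case 3
      then show ?thesis using v dw[OF 3] unfolding leaf_set_def by auto
    qed (use dv in \<open>auto simp: leaf_set_def\<close>)
  qed
qed

text \<open>Only the cells of \<open>S\<close> in the half space \<open>k \<le> x\<close> matter for a growth beyond it: \<open>U\<close> lists at
  least these, \<open>D\<close> lists cells known to be in \<open>S\<close>, and \<open>L\<close> those of them that are leaves.\<close>

definition state :: "cell set \<Rightarrow> int \<Rightarrow> cell list \<Rightarrow> cell list \<Rightarrow> cell list \<Rightarrow> int \<Rightarrow> bool" where
  "state S k D U L l \<longleftrightarrow> tree S \<and> 2 \<le> card S \<and> int (card (leaf_set S)) = l \<and>
     (\<forall>v\<in>S. k \<le> fst v \<longrightarrow> v \<in> set U) \<and> set D \<subseteq> S \<and> (\<forall>d\<in>set D. d \<in> leaf_set S \<longleftrightarrow> d \<in> set L)"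

text \<open>Each new cell must meet the listed part of the tree in exactly one cell
  \<open>u\<close>. The test \<open>k < fst v\<close> ensures that all its neighbours in the tree
  are listed in \<open>U\<close>, and \<open>u\<close> must be in \<open>D\<close> so that it is
  known whether a leaf is lost.\<close>

fun grow :: "int \<Rightarrow> cell list \<Rightarrow> cell list \<Rightarrow> cell list \<Rightarrow> int \<Rightarrow> cell list \<Rightarrow>
    (cell list \<times> cell list \<times> cell list \<times> int) option" where
  "grow k D U L l [] = Some (D, U, L, l)"
| "grow k D U L l (v # vs) = (case filter (near v) U of
       [u] \<Rightarrow> if u = v then None else if fst v \<le> k then None else if any ((=) u) D then
         (if any ((=) u) L then grow k (v # D) (v # U) (v # removeAll u L) l vs
          else grow k (v # D) (v # U) (v # L) (l + 1) vs) else None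
     | _ \<Rightarrow> None)"

lemma grow_sound:
  assumes "state S k D U L l" "grow k D U L l vs = Some (D', U', L', l')"
  shows "\<exists>S'. state S' k D' U' L' l' \<and> card S' = card S + length vs"
  using assms
proof (induction vs arbitrary: S D U L l)
  case Nil
  then show ?case by auto
next
  case (Cons v vs)
  obtain u where u: "filter (near v) U = [u]"
    using Cons.prems(2) by (auto split: list.splits)
  have c: "u \<noteq> v" "k < fst v" "any ((=) u) D"
    using Cons.prems(2) u by (auto split: if_splits)
  have uD: "u \<in> set D" using c(3) by (simp add: any_iff)
  have g: "if u \<in> set L then grow k (v # D) (v # U) (v # removeAll u L) l vs = Some (D', U', L', l')
      else grow k (v # D) (v # U) (v # L) (l + 1) vs = Some (D', U', L', l')"
    using Cons.prems(2) u c by (simp add: any_iff split: if_splits)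
  have S: "tree S" "2 \<le> card S" "int (card (leaf_set S)) = l" and SU: "\<And>v. v \<in> S \<Longrightarrow> k \<le> fst v \<Longrightarrow> v \<in> set U"
    and DS: "set D \<subseteq> S" and DL: "\<And>d. d \<in> set D \<Longrightarrow> d \<in> leaf_set S \<longleftrightarrow> d \<in> set L"
    using Cons.prems(1) unfolding state_def by blast+
  have fin: "finite S" "finite (leaf_set S)" using lattice.tree_finite[OF S(1)] by (simp_all add: leaf_set_def)
  have uS: "u \<in> S" using uD DS by blast
  have nu: "w = u" if "w \<in> set U" "near v w" for w
  proof -
    have "w \<in> set (filter (near v) U)" using that by simp
    then show ?thesis unfolding u by simp
  qed
  have vS: "v \<notin> S"
  proof
    assume "v \<in> S"
    then have "v \<in> set U" using SU c(2) by simp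
    then have "v = u" by (intro nu) (simp_all add: near_iff)
    then show False using c(1) by blast
  qed
  have nb: "w = u" if w: "w \<in> S" "adj v w" for w
  proof -
    have "fst v - 1 \<le> fst w"
    proof -
      have "\<bar>fst (v - w)\<bar> \<le> norm1 (v - w)" by (cases "v - w") simp
      then show ?thesis using w(2) unfolding adj_def by (simp add: fst_diff)
    qed
    then have "w \<in> set U" using SU[OF w(1)] c(2) by linarith
    then show ?thesis using w(2) by (intro nu) (simp_all add: near_iff)
  qed
  have "u \<in> set (filter (near v) U)" unfolding u by simp
  then have "adj v u" using c(1) by (simp add: near_iff)
  then have nv: "nbrs S v = {u}" using uS nb unfolding lattice.nbrs_def by blast
  let ?S = "insert v S"
  have t: "tree ?S" by (rule lattice.tree_insert[OF S(1) vS nv])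
  have lv: "leaf_set ?S = insert v (leaf_set S - {u})" by (rule leaf_set_insert[OF S(1,2) vS nv])
  have vl: "v \<notin> leaf_set S" using vS by (simp add: leaf_set_def)
  have card: "card ?S = Suc (card S)" using fin vS by simp
  have cl: "card (leaf_set ?S) = Suc (card (leaf_set S - {u}))"
    unfolding lv using fin vl by (intro card_insert_disjoint) auto
  have U': "\<forall>w\<in>?S. k \<le> fst w \<longrightarrow> w \<in> set (v # U)" using SU by auto
  have D': "set (v # D) \<subseteq> ?S" using DS by auto
  show ?case
  proof (cases "u \<in> set L")
    case True
    then have "u \<in> leaf_set S" using DL uD by blast
    then have "card (leaf_set ?S) = card (leaf_set S)"
      unfolding cl using fin(2) by (metis card_Suc_Diff1)
    then have "state ?S k (v # D) (v # U) (v # removeAll u L) l"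
      unfolding state_def using t card S U' D' DL DS vS lv by auto
    from Cons.IH[OF this] g True card show ?thesis by auto
  next
    case False
    then have "u \<notin> leaf_set S" using DL uD by blast
    then have "int (card (leaf_set ?S)) = l + 1" unfolding cl using S(3) by simp
    then have "state ?S k (v # D) (v # U) (v # L) (l + 1)"
      unfolding state_def using t card S U' D' DL DS vS lv False \<open>u \<notin> leaf_set S\<close> by auto
    from Cons.IH[OF this] g False card show ?thesis by auto
  qed
qed

section \<open>Coordinates of the extremal trees\<close>

definition domino :: "cell list" where
  "domino = [(0, 0, 0), (1, 0, 0)]"

lemma state_domino: "state (set domino) k domino domino domino 2"
proof -
  have S: "set domino = {(0, 0, 0), (1, 0, 0)}" by (simp add: domino_def)
  have adj: "adj (1, 0, 0) (0, 0, 0)" "adj (0, 0, 0) (1, 0, 0)"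
    using near_iff[of "(1, 0, 0)" "(0, 0, 0)"] near_iff[of "(0, 0, 0)" "(1, 0, 0)"] by simp_all
  have 1: "tree {(0, 0, 0)}"
    unfolding lattice.tree_def lattice.nbrs_def lattice.edges_def by auto
  have 2: "nbrs {(0, 0, 0)} (1, 0, 0) = {(0, 0, 0)}" using adj by (auto simp: lattice.nbrs_def)
  have "tree (insert (1, 0, 0) {(0, 0, 0)})" by (rule lattice.tree_insert[OF 1 _ 2]) simp
  then have t: "tree (set domino)" unfolding S by (simp add: insert_commute)
  have "nbrs (set domino) (0, 0, 0) = {(1, 0, 0)}" "nbrs (set domino) (1, 0, 0) = {(0, 0, 0)}"
    unfolding S using adj by (auto simp: lattice.nbrs_def)
  then have "leaf_set (set domino) = set domino" unfolding leaf_set_def by (auto simp: S lattice.deg_def)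
  then show ?thesis unfolding state_def using t by (simp add: S)
qed

text \<open>The plane of the two legs alternates along the spine, so that legs of consecutive spine
  cells do not touch.\<close>

definition perp :: "int \<Rightarrow> int \<Rightarrow> int \<Rightarrow> cell" where
  "perp x a b = (if even x then (x, a, b) else (x, b, a))"

text \<open>Each triple turns the last spine cell into a cell of degree 4: three cells for two
  leaves.\<close>

definition chain_cells :: "nat \<Rightarrow> cell list" where
  "chain_cells c = concat (map (\<lambda>i. let x = int i + 1 in [(x + 1, 0, 0), perp x 1 0, perp x (-1) 0]) [0..<c])"

text \<open>The last spine cell gets degree 3 and its two legs degree 5: ten cells, seven new leaves
  and excess 1.\<close>

definition end_cells :: "int \<Rightarrow> cell list" where
  "end_cells x = [perp x 1 0, perp x (-1) 0] @
     concat (map (\<lambda>s. [perp x (2 * s) 0, perp x s 1, perp x s (-1),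
       if even x then (x + 1, s, 0) else (x + 1, 0, s)]) [1, -1])"

text \<open>The remainder after the last full period. From 16 cells on, six for the chain and ten
  for the end, ending with \<open>end_cells\<close> is possible; the final \<open>take\<close> fills
  up the residue modulo 3.\<close>

definition tail_cells :: "nat \<Rightarrow> cell list" where
  "tail_cells j = (if j \<le> 15 then take j (chain_cells 5) else
     let i = (j - 16) div 3; x = int i + 3 in
     chain_cells (2 + i) @ end_cells x @
     take ((j - 16) mod 3) [perp x 3 0, if even x then (x - 1, 2, 0) else (x - 1, 0, 2)])"

text \<open>The ending of \<open>end_cells\<close>, mirrored, at the other end of the spine.\<close>

definition cap_cells :: "cell list" where
  "cap_cells = [(0, 1, 0), (0, -1, 0)] @
     concat (map (\<lambda>s. [(0, 2 * s, 0), (0, s, 1), (0, s, -1), (-1, s, 0)]) [1, -1])"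

text \<open>Three spine cells of degree 4; beyond each of the two legs of the third, a path with
  degrees 4, 4, 3 that ends in two cells of degree 5. These are 13 inner cells with excess
  2.\<close>

definition period_cells :: "cell list" where
  "period_cells = chain_cells 3 @ concat (map (\<lambda>s. [(3, 0, 2 * s), (3, 1, s), (3, -1, s), (3, 0, 3 * s), (2, 0, 2 * s),
     (4, 0, 2 * s), (3, 1, 3 * s), (3, -1, 3 * s)] @
     concat (map (\<lambda>t. [(2, t, 3 * s), (4, t, 3 * s), (3, 2 * t, 3 * s), (3, t, 4 * s)]) [1, -1])) [1, -1])"

text \<open>Completes the domino to four cells of degree 6 joined through cells of degree 2;
  prefixes give the exceptional sizes.\<close>

definition star_cells :: "cell list" where
  "star_cells = [(-1, 0, 0), (0, 1, 0), (0, -1, 0), (0, 0, 1), (0, 0, -1)] @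
     concat (map (\<lambda>x. [(x, 0, 0), (x + 1, 0, 0), (x, 1, 0), (x, -1, 0), (x, 0, 1), (x, 0, -1)]) [2, 4, 6])"

text \<open>A period advances by the odd number 3, so the last two coordinates are swapped to
  restore the alternation of \<open>perp\<close>.\<close>

fun renorm :: "cell \<Rightarrow> cell" where
  "renorm (x, y, z) = (x - 3, z, y)"

text \<open>The front of the tree after a period, in renormalised coordinates. It also covers the
  front of the cap, as \<open>grow_cap\<close> verifies, so every period starts from the same
  data.\<close>

definition slab :: "cell list" where
  "slab = map renorm (filter (\<lambda>v. 3 \<le> fst v) ((3, 0, 0) # period_cells))"

definition stem :: "cell list" where
  "stem = [(1, 0, 0)]"

lemma grow_cap:
  "case grow (-9) domino domino domino 2 cap_cells of
     Some (D, U, L, l) \<Rightarrow> every (\<lambda>v. if fst v < 0 then True else any ((=) v) slab) U \<and>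
       any ((=) (1, 0, 0)) D \<and> any ((=) (1, 0, 0)) L \<and> l = 9 \<and> every (\<lambda>v. -9 \<le> fst v) U
   | None \<Rightarrow> False"
  by code_simp

lemma grow_period:
  "case grow 0 stem slab stem 0 period_cells of
     Some (D, U, L, l) \<Rightarrow> every (\<lambda>v. if fst v < 3 then True else any ((=) (renorm v)) slab) U \<and>
       any ((=) (4, 0, 0)) D \<and> any ((=) (4, 0, 0)) L \<and> l = 28
   | None \<Rightarrow> False"
  by code_simp

section \<open>Polycubes as digraphs\<close>

text \<open>The leaf count enters only additively, so one run starting from 0 serves for trees of
  every length.\<close>

lemma grow_shift: "grow k D U L (l + c) vs = map_option (\<lambda>(D', U', L', l'). (D', U', L', l' + c)) (grow k D U L l vs)"
proof (induction vs arbitrary: D U L l)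
  case (Cons v vs)
  have e: "l + c + 1 = (l + 1) + c" by simp
  show ?case by (auto split: list.split simp: Cons.IH e)
qed simp

lemma grow_domino:
  assumes "grow (-9) domino domino domino 2 vs = Some (D, U, L, l)"
  shows "\<exists>S. tree S \<and> card S = 2 + length vs \<and> int (card (leaf_set S)) = l"
proof -
  have "card (set domino) = 2" by (simp add: domino_def)
  then show ?thesis using grow_sound[OF state_domino assms] unfolding state_def by auto
qed

lemma leaf_set_image:
  assumes "\<And>a b. adj (f a) (f b) \<longleftrightarrow> adj a b" "inj f"
  shows "leaf_set (f ` S) = f ` leaf_set S"
proof -
  have "deg (f ` S) (f v) = deg S v" for v
    unfolding lattice.deg_def lattice.nbrs_image[OF assms(1)] using assms(2) by (intro card_image) (auto simp: inj_on_def)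
  then show ?thesis unfolding leaf_set_def by auto
qed

lemma renorm:
  shows "renorm ((\<lambda>(x, y, z). (x + 3, z, y)) v) = v" "(\<lambda>(x, y, z). (x + 3, z, y)) (renorm v) = v"
    "adj (renorm u) (renorm v) \<longleftrightarrow> adj u v" "fst (renorm v) = fst v - 3"
proof -
  obtain a b c a' b' c' where [simp]: "u = (a, b, c)" "v = (a', b', c')" by (metis surj_pair)
  show "renorm ((\<lambda>(x, y, z). (x + 3, z, y)) v) = v" "(\<lambda>(x, y, z). (x + 3, z, y)) (renorm v) = v" "fst (renorm v) = fst v - 3"
    by simp_all
  show "adj (renorm u) (renorm v) \<longleftrightarrow> adj u v" by (auto simp: adj_def)
qed

lemma length_period_cells: "length period_cells = 41"
  by code_simp

text \<open>The cap gives 12 cells with 9 leaves. After a period the tree, renormalised, is again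
  described by \<open>slab\<close> with the open leaf \<open>stem\<close>.\<close>

lemma periodic_state: "\<exists>S. state S 0 stem slab stem (9 + 28 * int k) \<and> card S = 12 + 41 * k"
proof (induction k)
  case 0
  obtain D U L l where g: "grow (-9) domino domino domino 2 cap_cells = Some (D, U, L, l)"
      and c: "every (\<lambda>v. if fst v < 0 then True else any ((=) v) slab) U" "any ((=) (1, 0, 0)) D"
        "any ((=) (1, 0, 0)) L" "l = 9"
    using grow_cap by (auto split: option.splits)
  obtain S where S: "state S (-9) D U L l" "card S = card (set domino) + length cap_cells"
    using grow_sound[OF state_domino g] by blast
  have lo: "v \<in> set slab" if "v \<in> S" "0 \<le> fst v" for v
  proof -
    have "v \<in> set U" using S(1) that unfolding state_def by force
    then show ?thesis using c(1) that(2) unfolding every_iff any_iff by (metis not_less)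
  qed
  have "(1, 0, 0) \<in> set D" "(1, 0, 0) \<in> set L" using c(2,3) unfolding any_iff by blast+
  then have "state S 0 stem slab stem 9"
    using S(1) lo unfolding state_def c(4) stem_def by auto
  moreover have "card S = 12" unfolding S(2) by (simp add: domino_def cap_cells_def)
  ultimately show ?case by auto
next
  case (Suc k)
  then obtain S where S: "state S 0 stem slab stem (9 + 28 * int k)" "card S = 12 + 41 * k" by blast
  obtain D U L where g: "grow 0 stem slab stem 0 period_cells = Some (D, U, L, 28)"
      and c: "every (\<lambda>v. if fst v < 3 then True else any ((=) (renorm v)) slab) U" "any ((=) (4, 0, 0)) D"
        "any ((=) (4, 0, 0)) L"
    using grow_period by (auto split: option.splits)
  have "grow 0 stem slab stem (9 + 28 * int k) period_cells = Some (D, U, L, 28 + (9 + 28 * int k))"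
    using grow_shift[of 0 stem slab stem 0 "9 + 28 * int k" period_cells] g by simp
  from grow_sound[OF S(1) this]
  obtain S' where S': "state S' 0 D U L (28 + (9 + 28 * int k))" "card S' = card S + length period_cells" by blast
  let ?T = "renorm ` S'"
  have inj: "inj renorm" by (rule inj_on_inverseI[where g = "\<lambda>(x, y, z). (x + 3, z, y)"]) (rule renorm(2))
  have t: "tree ?T" using S'(1) unfolding state_def
    by (intro lattice.tree_image[where g = "\<lambda>(x, y, z). (x + 3, z, y)"] renorm) blast
  have card: "card ?T = card S'" by (rule card_image) (rule inj_on_subset[OF inj subset_UNIV])
  have lv: "leaf_set ?T = renorm ` leaf_set S'" by (rule leaf_set_image[OF renorm(3) inj])
  have clv: "card (leaf_set ?T) = card (leaf_set S')" unfolding lv by (rule card_image) (rule inj_on_subset[OF inj subset_UNIV])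
  have lo: "\<forall>w\<in>?T. 0 \<le> fst w \<longrightarrow> w \<in> set slab"
  proof (intro ballI impI)
    fix w assume "w \<in> ?T" "0 \<le> fst w"
    then obtain v where v: "v \<in> S'" "w = renorm v" "3 \<le> fst v" using renorm(4) by auto
    then have "v \<in> set U" using S'(1) unfolding state_def by force
    then show "w \<in> set slab" using c(1) v(2,3) unfolding every_iff any_iff by (metis not_less)
  qed
  have D4: "(4, 0, 0) \<in> set D" "(4, 0, 0) \<in> set L" using c(2,3) unfolding any_iff by blast+
  then have "(4, 0, 0) \<in> leaf_set S'" using S'(1) unfolding state_def by blast
  then have "renorm (4, 0, 0) \<in> leaf_set ?T" unfolding lv by (rule imageI)
  then have "(1, 0, 0) \<in> leaf_set ?T" "(1, 0, 0) \<in> ?T" by (simp_all add: leaf_set_def)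
  then have "state ?T 0 stem slab stem (9 + 28 * int (Suc k))"
    using t lo S'(1) clv card unfolding state_def stem_def by auto
  moreover have "card ?T = 12 + 41 * Suc k" unfolding card S'(2) S(2) length_period_cells by simp
  ultimately show ?case by blast
qed

text \<open>The formula at \<open>12 + j\<close> without its exceptional values.\<close>

definition target :: "nat \<Rightarrow> nat" where
  "target j = (if j \<le> 28 then f_cub (12 + j) else f_cub (j - 29) + 28)"

lemma ell_cub_period:
  "j < 41 \<Longrightarrow> 12 + 41 * k + j \<notin> {13, 19, 25} \<Longrightarrow> ell_cub (12 + 41 * k + j) = target j + 28 * k"
proof (induction k)
  case 0
  then show ?case by (subst ell_cub.simps) (auto simp: target_def)
next
  case (Suc k)
  show ?case
  proof (cases "k = 0 \<and> j \<le> 28")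
    case True
    then show ?thesis by (subst ell_cub.simps) (auto simp: target_def)
  next
    case False
    then have "82 \<le> 12 + 41 * Suc k + j" by (cases k) auto
    then have 1: "ell_cub (12 + 41 * Suc k + j) = ell_cub (12 + 41 * Suc k + j - 41) + 28"
      by (subst ell_cub.simps) auto
    have 2: "12 + 41 * Suc k + j - 41 = 12 + 41 * k + j" by simp
    have "12 + 41 * k + j \<notin> {13, 19, 25}" using False by (cases k) auto
    from Suc.IH[OF Suc.prems(1) this] show ?thesis unfolding 1 2 by simp
  qed
qed

lemma grow_tails:
  "every (\<lambda>j. case grow 0 stem slab stem 0 (tail_cells j) of
     Some (D, U, L, l) \<Rightarrow> int (target j) \<le> 9 + l \<and> length (tail_cells j) = j | None \<Rightarrow> False) [0..<41]"
  by code_simp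

lemma grow_small:
  "every (\<lambda>n. let vs = take (n - 2) (if any ((=) n) [6, 7, 13, 19, 25] then star_cells else chain_cells 4) in
     case grow (-9) domino domino domino 2 vs of
     Some (D, U, L, l) \<Rightarrow> int (ell_cub n) \<le> l \<and> length vs = n - 2 | None \<Rightarrow> False)
     [2, 3, 4, 5, 6, 7, 8, 9, 10, 11, 13, 19, 25]"
  by code_simp

lemma tree_with_many_leaves:
  assumes "2 \<le> n"
  shows "\<exists>S. tree S \<and> card S = n \<and> ell_cub n \<le> card (leaf_set S)"
proof (cases "n \<in> set [2, 3, 4, 5, 6, 7, 8, 9, 10, 11, 13, 19, 25]")
  case True
  obtain vs D U L l where "grow (-9) domino domino domino 2 vs = Some (D, U, L, l)" "int (ell_cub n) \<le> l" "length vs = n - 2"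
    using grow_small[unfolded every_iff, rule_format, OF True] unfolding Let_def by (auto split: option.splits)
  then show ?thesis using grow_domino assms by fastforce
next
  case False
  have n: "12 \<le> n" using False assms by (simp, presburger)
  have n': "n \<notin> {13, 19, 25}" using False by simp
  define j k where "j = (n - 12) mod 41" and "k = (n - 12) div 41"
  have nk: "n = 12 + 41 * k + j" "j < 41" unfolding j_def k_def using n by simp_all
  then have "j \<in> set [0..<41]" by simp
  from grow_tails[unfolded every_iff, rule_format, OF this]
  obtain D U L l where g: "grow 0 stem slab stem 0 (tail_cells j) = Some (D, U, L, l)"
      "int (target j) \<le> 9 + l" "length (tail_cells j) = j"
    by (auto split: option.splits)
  obtain S where S: "state S 0 stem slab stem (9 + 28 * int k)" "card S = 12 + 41 * k"
    using periodic_state by blast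
  have "grow 0 stem slab stem (9 + 28 * int k) (tail_cells j) = Some (D, U, L, l + (9 + 28 * int k))"
    using grow_shift[of 0 stem slab stem 0 "9 + 28 * int k" "tail_cells j"] g(1) by simp
  from grow_sound[OF S(1) this]
  obtain S' where S': "state S' 0 D U L (l + (9 + 28 * int k))" "card S' = card S + length (tail_cells j)" by blast
  have "ell_cub n = target j + 28 * k" using ell_cub_period[OF nk(2), of k] n' unfolding nk(1) by blast
  then have "ell_cub n \<le> card (leaf_set S')" using S'(1) g(2) unfolding state_def by linarith
  moreover have "tree S'" "card S' = n" using S' S(2) g(3) nk(1) unfolding state_def by simp_all
  ultimately show ?thesis by blast
qed

section \<open>The formula as a consequence of the bound on the excess\<close>

text \<open>The recursion-free range of \<open>ell_cub\<close>, in a form that can be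
  evaluated.\<close>

definition ell_base :: "nat \<Rightarrow> nat" where
  "ell_base n = (if n = 6 \<or> n = 7 \<or> n = 13 \<or> n = 19 \<or> n = 25 then f_cub n + 1
     else if n \<le> 40 then f_cub n else f_cub (n - 41) + 28)"

lemma ell_cub_base: "n < 82 \<Longrightarrow> ell_cub n = ell_base n"
  by (subst ell_cub.simps) (simp add: ell_base_def)

text \<open>The number tested is \<open>13 * n - 26 - 41 * m\<close> for
  \<open>m = n - ell_base n - 1\<close>, the value of a tree with one leaf too many. It is never
  \<open>good\<close>.\<close>

lemma ell_base_check:
  "every (\<lambda>n. let \<phi> = 13 * int n - 26 - 41 * (int n - int (ell_base n) - 1) in if 11 \<le> \<phi> then True else \<phi> = 9) [2..<82]"
  by code_simp

lemma ell_base_exceptional: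
  assumes "int n = 3 * m + 3 \<or> int n = 3 * m + 4" "m = 1 \<or> m = 3 \<or> m = 5 \<or> m = 7"
  shows "int n - m \<le> int (ell_base n)"
proof -
  consider "m = 1" "n = 6" | "m = 1" "n = 7" | "m = 3" "n = 12" | "m = 3" "n = 13"
    | "m = 5" "n = 18" | "m = 5" "n = 19" | "m = 7" "n = 24" | "m = 7" "n = 25"
    using assms by (elim disjE) simp_all
  then show ?thesis by cases (simp_all add: ell_base_def f_cub_def)
qed

lemma inner_bound:
  assumes "bound e m" "int n = 3 * m + e + 2" "2 \<le> n"
  shows "int n - m \<le> int (ell_cub n)"
  using assms
proof (induction n arbitrary: e m rule: less_induct)
  case (less n)
  show ?case
  proof (cases "82 \<le> n")
    case True
    \<comment> \<open>Removing a period changes \<open>(e, m)\<close> by \<open>(2, 13)\<close> and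
      preserves the value; the exceptional pairs have \<open>n \<le> 25\<close> and cannot occur
      here.\<close>
    have b: "bound (e - 2) (m - 13)"
    proof -
      have "\<not> (e \<le> 2 \<and> m \<in> {1, 3, 5, 7})" using less.prems(2) True by auto
      then have "good (13 * e - 2 * m)" using less.prems(1) unfolding bound_def by blast
      moreover have "13 * (e - 2) - 2 * (m - 13) = 13 * e - 2 * m" by simp
      ultimately show ?thesis unfolding bound_def by simp
    qed
    have "int (n - 41) - (m - 13) \<le> int (ell_cub (n - 41))"
      using less.prems(2) True by (intro less.IH[OF _ b]) auto
    moreover have "ell_cub n = ell_cub (n - 41) + 28" using True by (subst ell_cub.simps) auto
    ultimately show ?thesis using True by simp
  next
    case False
    consider (good) "good (13 * e - 2 * m)" | (small) "e = 1 \<or> e = 2" "m \<in> {1, 3, 5, 7}"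
    proof (cases "good (13 * e - 2 * m)")
      case bad: False
      then have m: "e \<le> 2" "m \<in> {1, 3, 5, 7}" using less.prems(1) unfolding bound_def by blast+
      have "1 \<le> e"
      proof (rule ccontr)
        assume "\<not> 1 \<le> e"
        then have "13 * e - 2 * m \<le> 7" using m(2) by auto
        then show False using bad by (auto simp: good_def split: if_splits)
      qed
      then have "e = 1 \<or> e = 2" using m(1) by linarith
      then show ?thesis using m(2) that(2) by blast
    qed (use that(1) in blast)
    then show ?thesis
    proof cases
      case good
      let ?a = "13 * int n - 26 - 41 * (int n - int (ell_cub n) - 1)"
      have "n \<in> {2..<82}" using less.prems(3) False by simp
      then have "n \<in> set [2..<82]" unfolding set_upt .
      from ell_base_check[unfolded every_iff, rule_format, OF this]
      have "if 11 \<le> 13 * int n - 26 - 41 * (int n - int (ell_base n) - 1) then True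
          else 13 * int n - 26 - 41 * (int n - int (ell_base n) - 1) = 9" unfolding Let_def .
      moreover have "ell_cub n = ell_base n" using False by (intro ell_cub_base) simp
      ultimately have "if 11 \<le> ?a then True else ?a = 9" by (simp only:)
      then have a: "11 \<le> ?a \<or> ?a = 9" by (metis (full_types))
      show ?thesis
      proof (rule ccontr)
        assume not: "\<not> ?thesis"
        \<comment> \<open>\<open>d + 1\<close> leaves too many would give the value
          \<open>?a + 41 * d\<close>; as \<open>9 \<le> ?a\<close>, this is at least 50 unless
          \<open>d = 0\<close>.\<close>
        define d where "d = int n - int (ell_cub n) - 1 - m"
        have d: "0 \<le> d" unfolding d_def using not by linarith
        have "13 * e - 2 * m = ?a + 41 * d"
          using less.prems(2) unfolding d_def by (simp add: algebra_simps)
        moreover have "?a + 41 * d = ?a \<or> 50 \<le> ?a + 41 * d" using a d by (cases "d = 0") auto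
        ultimately consider "13 * e - 2 * m = 9" | "11 \<le> 13 * e - 2 * m" using a by linarith
        then show False using good by cases (auto simp: good_def split: if_splits)
      qed
    next
      case small
      have "ell_cub n = ell_base n" using False by (intro ell_cub_base) simp
      moreover have "int n = 3 * m + 3 \<or> int n = 3 * m + 4" using small(1) less.prems(2) by linarith
      moreover have "m = 1 \<or> m = 3 \<or> m = 5 \<or> m = 7" using small(2) by blast
      ultimately show ?thesis using ell_base_exceptional by (simp only:)
    qed
  qed
qed

lemma leaves_upper_bound:
  assumes S: "tree S" and card: "2 \<le> card S"
  shows "card (leaf_set S) \<le> ell_cub (card S)"
proof -
  note l = leaves_and_inner[OF S card, folded leaf_set_def]
  have "int (card S) = 3 * sum (one S) S + sum (excess S) S + 2" using l by linarith
  from inner_bound[OF excess_bound[OF S] this card] show ?thesis using l(1) by linarith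
qed

section \<open>Translation of polycubes into sets of cells\<close>

lemma abs_le_square: "\<bar>p\<bar> \<le> p\<^sup>2" for p :: int
proof (cases "p = 0")
  case False
  then have "\<bar>p\<bar> * 1 \<le> \<bar>p\<bar> * \<bar>p\<bar>" by (intro mult_left_mono) auto
  then show ?thesis by (simp add: power2_eq_square)
qed simp

lemma adj_iff_dist: "adj u v \<longleftrightarrow> dist (to_R3 u) (to_R3 v) = 1"
proof -
  obtain a b c a' b' c' where uv: "u = (a, b, c)" "v = (a', b', c')" by (metis surj_pair)
  define p q r where "p = a - a'" and "q = b - b'" and "r = c - c'"
  have "dist (to_R3 u) (to_R3 v) = 1 \<longleftrightarrow> p\<^sup>2 + q\<^sup>2 + r\<^sup>2 = 1"
    unfolding uv dist_to_R3 p_def q_def r_def real_sqrt_eq_1_iff by (simp only: of_int_eq_1_iff)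
  moreover have "adj u v \<longleftrightarrow> \<bar>p\<bar> + \<bar>q\<bar> + \<bar>r\<bar> = 1"
    unfolding adj_def uv p_def q_def r_def by simp
  moreover have "p\<^sup>2 + q\<^sup>2 + r\<^sup>2 = 1" if "\<bar>p\<bar> + \<bar>q\<bar> + \<bar>r\<bar> = 1"
  proof -
    have "(p = 1 \<or> p = -1) \<and> q = 0 \<and> r = 0 \<or> p = 0 \<and> (q = 1 \<or> q = -1) \<and> r = 0 \<or> p = 0 \<and> q = 0 \<and> (r = 1 \<or> r = -1)"
      using that by arith
    then show ?thesis by auto
  qed
  moreover have "\<bar>p\<bar> + \<bar>q\<bar> + \<bar>r\<bar> = 1" if s: "p\<^sup>2 + q\<^sup>2 + r\<^sup>2 = 1"
  proof -
    have "\<bar>p\<bar> + \<bar>q\<bar> + \<bar>r\<bar> \<le> 1" using abs_le_square[of p] abs_le_square[of q] abs_le_square[of r] s by linarith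
    moreover have "\<not> (p = 0 \<and> q = 0 \<and> r = 0)" using s by auto
    ultimately show ?thesis by arith
  qed
  ultimately show ?thesis by blast
qed

lemma polycube_simps:
  "arcs (cubic_lattice \<restriction> S) = lattice.edges S" "tail (cubic_lattice \<restriction> S) = fst" "head (cubic_lattice \<restriction> S) = snd"
proof -
  show "arcs (cubic_lattice \<restriction> S) = lattice.edges S"
    unfolding lattice.edges_def adj_iff_dist by (auto simp: cubic_lattice_def induce_subgraph_def)
qed (simp_all add: cubic_lattice_def)

declare induce_subgraph_arcs [simp del] induce_subgraph_tail [simp del] induce_subgraph_head [simp del]

lemma out_degree_polycube: "v \<in> S \<Longrightarrow> out_degree (cubic_lattice \<restriction> S) v = deg S v"
proof -
  assume v: "v \<in> S"
  have "out_arcs (cubic_lattice \<restriction> S) v = Pair v ` nbrs S v"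
    unfolding out_arcs_def polycube_simps lattice.edges_def lattice.nbrs_def using v by force
  then show ?thesis unfolding out_degree_def lattice.deg_def by (simp add: card_image inj_on_def)
qed

lemma num_leaves_polycube: "num_leaves (cubic_lattice \<restriction> S) = card (leaf_set S)"
  unfolding num_leaves_def leaves_def leaf_set_def using out_degree_polycube by (metis (mono_tags, lifting) induce_subgraph_verts)

text \<open>Walks as lists of arcs, independent of the digraph record, so that walks in subgraphs
  for different cell sets can be combined.\<close>

fun chain :: "'a \<Rightarrow> ('a \<times> 'a) list \<Rightarrow> 'a \<Rightarrow> bool" where
  "chain u [] v \<longleftrightarrow> u = v"
| "chain u (e # es) v \<longleftrightarrow> fst e = u \<and> chain (snd e) es v"

lemma cas_polycube: "pre_digraph.cas (cubic_lattice \<restriction> S) u p v \<longleftrightarrow> chain u p v"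
proof (induction p arbitrary: u)
  case Nil
  show ?case unfolding pre_digraph.cas.simps chain.simps ..
next
  case (Cons e p)
  show ?case unfolding pre_digraph.cas.simps chain.simps Cons.IH polycube_simps ..
qed

lemma chain_append: "chain u (p @ q) v \<longleftrightarrow> (\<exists>w. chain u p w \<and> chain w q v)"
  by (induction p arbitrary: u) auto

lemma chain_end: "chain u p v \<Longrightarrow> p \<noteq> [] \<Longrightarrow> v \<in> snd ` set p"
  by (induction p arbitrary: u) (auto, metis chain.simps(1))

lemma awalk_verts_polycube:
  "chain u p v \<Longrightarrow> pre_digraph.awalk_verts (cubic_lattice \<restriction> S) u p = u # map snd p"
  using pre_digraph.awalk_verts_conv'[of "cubic_lattice \<restriction> S" u p v]
  by (cases p) (simp_all add: cas_polycube polycube_simps)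

lemma cycle_polycube:
  "pre_digraph.cycle (cubic_lattice \<restriction> S) p \<longleftrightarrow>
    (\<exists>u\<in>S. set p \<subseteq> lattice.edges S \<and> chain u p u \<and> distinct (map snd p) \<and> p \<noteq> [])"
proof -
  have "pre_digraph.awalk (cubic_lattice \<restriction> S) u p u \<and> distinct (tl (pre_digraph.awalk_verts (cubic_lattice \<restriction> S) u p))
    \<longleftrightarrow> u \<in> S \<and> set p \<subseteq> lattice.edges S \<and> chain u p u \<and> distinct (map snd p)" for u
    unfolding pre_digraph.awalk_def cas_polycube polycube_simps induce_subgraph_verts
    using awalk_verts_polycube[of u p u S] by auto
  then show ?thesis unfolding pre_digraph.cycle_def by blast
qed

lemma chain_path:
  "chain a p b \<Longrightarrow> set p \<subseteq> lattice.edges S \<Longrightarrow> u \<notin> insert a (snd ` set p) \<Longrightarrow> (a, b) \<in> (lattice.edges (S - {u}))\<^sup>*"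
proof (induction p arbitrary: a)
  case (Cons e p)
  obtain x y where e: "e = (x, y)" by (metis surj_pair)
  have "(a, y) \<in> lattice.edges (S - {u})" using Cons.prems unfolding e lattice.edges_def by auto
  moreover have "(y, b) \<in> (lattice.edges (S - {u}))\<^sup>*" using Cons.prems unfolding e by (intro Cons.IH) auto
  ultimately show ?case by (rule converse_rtrancl_into_rtrancl)
qed simp

lemma reachable_edges:
  assumes "u \<in> S"
  shows "(u, v) \<in> rtrancl_on S (lattice.edges S) \<longleftrightarrow> (u, v) \<in> (lattice.edges S)\<^sup>*"
proof
  show "(u, v) \<in> rtrancl_on S (lattice.edges S) \<Longrightarrow> (u, v) \<in> (lattice.edges S)\<^sup>*"
    by (induction rule: rtrancl_on.induct) (auto intro: rtrancl.rtrancl_into_rtrancl)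
  show "(u, v) \<in> (lattice.edges S)\<^sup>* \<Longrightarrow> (u, v) \<in> rtrancl_on S (lattice.edges S)"
  proof (induction rule: rtrancl_induct)
    case (step x y)
    moreover have "y \<in> S" using step.hyps(2) by (simp add: lattice.edges_def)
    ultimately show ?case by (meson rtrancl_on_into_rtrancl_on)
  qed (use assms in simp)
qed

text \<open>Symmetrising adds no arcs, because \<open>edges\<close> is symmetric already.\<close>

lemma connected_polycube:
  "Digraph_Component.connected (cubic_lattice \<restriction> S) \<longleftrightarrow>
    S \<noteq> {} \<and> (\<forall>u\<in>S. \<forall>v\<in>S. (u, v) \<in> (lattice.edges S)\<^sup>*)"
proof -
  let ?G = "cubic_lattice \<restriction> S"
  have "arcs_ends (with_proj (mk_symmetric ?G)) = lattice.edges S"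
  proof -
    have "(\<Union>e\<in>lattice.edges S. {(fst e, snd e), (snd e, fst e)}) = lattice.edges S"
      using lattice.edges_sym[of S] unfolding Relation.sym_def by fastforce
    then show ?thesis by (simp add: arcs_ends_conv mk_symmetric_def polycube_simps)
  qed
  moreover have "verts (with_proj (mk_symmetric ?G)) = S" by (simp add: mk_symmetric_def)
  ultimately show ?thesis
    unfolding Digraph_Component.connected_def strongly_connected_def reachable_def
    using reachable_edges by (metis (no_types, lifting))
qed

text \<open>A path between two neighbours of \<open>r\<close> that avoids \<open>r\<close> closes
  through \<open>r\<close> to a cycle; conversely, deleting a vertex from a cycle leaves a path
  between two of its neighbours.\<close>

lemma undirected_tree_polycube:
  assumes fin: "finite S"
  shows "undirected_tree (cubic_lattice \<restriction> S) \<longleftrightarrow> tree S"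
proof
  assume T: "undirected_tree (cubic_lattice \<restriction> S)"
  have "c = c'" if r: "r \<in> S" and c: "c \<in> nbrs S r" "c' \<in> nbrs S r" and path: "(c, c') \<in> (lattice.edges (S - {r}))\<^sup>*" for r c c'
  proof (rule ccontr)
    assume ne: "c \<noteq> c'"
    let ?H = "cubic_lattice \<restriction> (S - {r})"
    have wf: "wf_digraph ?H"
      by unfold_locales (auto simp: polycube_simps lattice.edges_def)
    have cS: "c \<in> S - {r}" using c(1) by (auto simp: lattice.nbrs_def)
    have "arcs_ends ?H = lattice.edges (S - {r})" by (simp add: arcs_ends_conv polycube_simps)
    then have "c \<rightarrow>\<^sup>*\<^bsub>?H\<^esub> c'" unfolding reachable_def using reachable_edges[OF cS] path by simp
    then obtain p where p: "pre_digraph.apath ?H c p c'" using wf_digraph.reachable_apath[OF wf] by blast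
    have ch: "chain c p c'" "set p \<subseteq> lattice.edges (S - {r})"
      using p unfolding pre_digraph.apath_def pre_digraph.awalk_def cas_polycube polycube_simps by blast+
    have dist: "distinct (c # map snd p)"
      using p awalk_verts_polycube[OF ch(1)] unfolding pre_digraph.apath_def by simp
    have pne: "p \<noteq> []" using ch(1) ne by auto
    let ?p = "(r, c) # p @ [(c', r)]"
    have "set ?p \<subseteq> lattice.edges S"
      using ch(2) r c lattice.adj_sym[of r c'] lattice.edges_mono[of "S - {r}" S]
      unfolding lattice.edges_def lattice.nbrs_def by auto
    moreover have "chain r ?p r" using ch(1) unfolding chain.simps chain_append fst_conv snd_conv by blast
    moreover have "r \<notin> snd ` set p" using ch(2) unfolding lattice.edges_def by auto
    then have "distinct (map snd ?p)" using dist cS by auto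
    ultimately have "pre_digraph.cycle (cubic_lattice \<restriction> S) ?p" unfolding cycle_polycube using r by blast
    moreover have "3 \<le> length ?p" using pne by (cases p) auto
    ultimately show False using T unfolding undirected_tree_def by blast
  qed
  then show "tree S"
    using T fin unfolding undirected_tree_def connected_polycube lattice.tree_def by blast
next
  assume S: "tree S"
  have "\<not> (pre_digraph.cycle (cubic_lattice \<restriction> S) p \<and> 3 \<le> length p)" for p
  proof
    assume "pre_digraph.cycle (cubic_lattice \<restriction> S) p \<and> 3 \<le> length p"
    then obtain u where u: "u \<in> S" "set p \<subseteq> lattice.edges S" "chain u p u" "distinct (map snd p)" "3 \<le> length p"
      unfolding cycle_polycube by blast
    obtain e p' where p': "p = e # p'" using u(5) by (cases p) auto
    then obtain q e' where p: "p = e # q @ [e']" using u(5) by (cases p' rule: rev_cases) auto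
    \<comment> \<open>Length at least 3 leaves a nonempty middle part, so the two neighbours of
      \<open>u\<close> on the cycle differ.\<close>
    have q: "q \<noteq> []" using u(5) p by auto
    obtain c c' u' u'' where e: "e = (u', c)" "e' = (c', u'')" by (metis surj_pair)
    have ch: "u' = u" "u'' = u" "chain c q c'" using u(3) unfolding p e by (auto simp: chain_append)
    have d: "u \<noteq> c" "u \<notin> snd ` set q" "c \<notin> snd ` set q" using u(4) unfolding p e ch by auto
    have "c' \<noteq> c" using chain_end[OF ch(3) q] d(3) by blast
    moreover have "(c, c') \<in> (lattice.edges (S - {u}))\<^sup>*"
      using u(2) d by (intro chain_path[OF ch(3)]) (auto simp: p)
    moreover have "c \<in> nbrs S u" "c' \<in> nbrs S u"
      using u(2) lattice.adj_sym[of c' u] unfolding p e ch lattice.edges_def lattice.nbrs_def by auto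
    ultimately show False using lattice.tree_acyclic[OF S u(1)] by blast
  qed
  moreover have "Digraph_Component.connected (cubic_lattice \<restriction> S)"
    using S unfolding connected_polycube lattice.tree_def by blast
  ultimately show "undirected_tree (cubic_lattice \<restriction> S)" unfolding undirected_tree_def by blast
qed

section \<open>Exact values and growth rate\<close>

lemma L_cub_eq:
  assumes n: "2 \<le> n"
  shows "L_cub n = ell_cub n"
  unfolding L_cub_def
proof (rule Max_eqI[OF finite_num_leaves])
  fix k assume "k \<in> {num_leaves T |T. tree_like_polycube n T}"
  then obtain S where S: "finite S" "card S = n" "undirected_tree (cubic_lattice \<restriction> S)" "k = num_leaves (cubic_lattice \<restriction> S)"
    unfolding tree_like_polycube_def by blast
  have "tree S" using S(3) undirected_tree_polycube[OF S(1)] by blast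
  then show "k \<le> ell_cub n" using leaves_upper_bound[of S] S(2,4) n unfolding num_leaves_polycube by simp
next
  obtain S where S: "tree S" "card S = n" "ell_cub n \<le> card (leaf_set S)" using tree_with_many_leaves[OF n] by blast
  have fin: "finite S" by (rule lattice.tree_finite[OF S(1)])
  have "card (leaf_set S) = ell_cub n" using S leaves_upper_bound[OF S(1)] n by simp
  moreover have "tree_like_polycube n (cubic_lattice \<restriction> S)"
    unfolding tree_like_polycube_def using fin S undirected_tree_polycube[OF fin] by blast
  ultimately show "ell_cub n \<in> {num_leaves T |T. tree_like_polycube n T}"
    using num_leaves_polycube by (metis (mono_tags, lifting) mem_Collect_eq)
qed

text \<open>The recursion adds 41 to the argument and 28 to the value, so
  \<open>41 * ell_cub n - 28 * n\<close> is periodic from there on; 300 is a crude bound for its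
  range.\<close>

lemma ell_cub_linear:
  "2 \<le> n \<Longrightarrow> \<bar>41 * int (ell_cub n) - 28 * int n\<bar> \<le> 300"
proof (induction n rule: less_induct)
  case (less n)
  have f: "2 * int m - 1 \<le> 3 * int (f_cub m)" "3 * int (f_cub m) \<le> 2 * int m + 4" for m
  proof -
    have g: "2 * m \<le> 3 * ((2 * m + c) div 3) + 1 \<and> 3 * ((2 * m + c) div 3) \<le> 2 * m + 4" if "c = 2 \<or> c = 3 \<or> c = 4" for c
      using that by presburger
    have "2 * m \<le> 3 * f_cub m + 1 \<and> 3 * f_cub m \<le> 2 * m + 4"
      unfolding f_cub_def using g[of 2] g[of 3] g[of 4]
      by (cases "m \<le> 11"; cases "m \<le> 27") (simp_all only: if_True if_False simp_thms)
    then show "2 * int m - 1 \<le> 3 * int (f_cub m)" "3 * int (f_cub m) \<le> 2 * int m + 4" by linarith+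
  qed
  show ?case
  proof (cases "82 \<le> n")
    case True
    then have "ell_cub n = ell_cub (n - 41) + 28" by (subst ell_cub.simps) auto
    moreover have "\<bar>41 * int (ell_cub (n - 41)) - 28 * int (n - 41)\<bar> \<le> 300" using True by (intro less.IH) auto
    ultimately show ?thesis using True by (simp add: of_nat_diff)
  next
    case False
    then have e: "ell_cub n = ell_base n" by (intro ell_cub_base) simp
    show ?thesis
    proof (cases "n \<le> 40")
      case True
      then have "ell_cub n = f_cub n \<or> ell_cub n = f_cub n + 1" unfolding e ell_base_def by simp
      then show ?thesis using f[of n] True by linarith
    next
      case F: False
      then have "ell_cub n = f_cub (n - 41) + 28" unfolding e ell_base_def by auto
      moreover have "int (n - 41) = int n - 41" using F by simp
      ultimately show ?thesis using f[of "n - 41"] F False by linarith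
    qed
  qed
qed

theorem theorem5p15:
  shows "(\<forall>n\<ge>2. L_cub n = ell_cub n) \<and>
    (\<lambda>n. real (L_cub n)) \<sim>[at_top] (\<lambda>n. 28 / 41 * real n)"
proof
  show eq: "\<forall>n\<ge>2. L_cub n = ell_cub n" using L_cub_eq by blast
  have "(\<lambda>n. real (L_cub n) - 28 / 41 * real n) \<in> O[at_top](\<lambda>_. 1)"
  proof (rule bigoI[where c = "300"])
    show "\<forall>\<^sub>F n in at_top. norm (real (L_cub n) - 28 / 41 * real n) \<le> 300 * norm (1 :: real)"
    proof (rule eventually_mono[OF eventually_ge_at_top[of 2]])
      fix n :: nat assume n: "2 \<le> n"
      have "real_of_int \<bar>41 * int (ell_cub n) - 28 * int n\<bar> \<le> real_of_int 300"
        using ell_cub_linear[OF n] by (simp only: of_int_le_iff)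
      then show "norm (real (L_cub n) - 28 / 41 * real n) \<le> 300 * norm (1 :: real)"
        using eq n by (simp add: abs_le_iff field_simps)
    qed
  qed
  moreover have "(\<lambda>_. 1) \<in> o[at_top](\<lambda>n. 28 / 41 * real n)"
  proof (rule smalloI_tendsto)
    show "((\<lambda>n. 1 / (28 / 41 * real n)) \<longlongrightarrow> 0) at_top"
      using tendsto_mult[OF tendsto_const[of "41 / 28 :: real"] lim_1_over_n] by simp
    show "\<forall>\<^sub>F n in at_top. 28 / 41 * real n \<noteq> 0"
      using eventually_gt_at_top[of "0 :: nat"] by eventually_elim simp
  qed
  ultimately have "(\<lambda>n. real (L_cub n) - 28 / 41 * real n) \<in> o[at_top](\<lambda>n. 28 / 41 * real n)"
    by (rule landau_o.big_small_trans)
  then show "(\<lambda>n. real (L_cub n)) \<sim>[at_top] (\<lambda>n. 28 / 41 * real n)"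
    by (rule smallo_imp_asymp_equiv)
qed

end
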